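(* Let $\Phi^{(1)}=((U^{(1)}_\omega(t))_{\omega\in\Omega,t\in\mathbb{R}^+},(\theta_t)_{t\in\mathbb{R}})$ and $\Phi^{(2)}=((U^{(2)}_\omega(t))_{\omega\in\Omega,t\in\mathbb{R}^+},(\theta_t)_{t\in\mathbb{R}})$ be measurable linear skew-product semidynamical systems on Banach spaces $(X_1,\|\cdot\|_1)$ and $(X_2,\|\cdot\|_2)$ respectively, both covering the same ergodic metric dynamical system $((\Omega,\mathfrak{F},\mathbb{P}),(\theta_t)_{t\in\mathbb{R}})$. Assume: (A1) There is an injective bounded linear map $i\colon X_2\to X_1$. (A2) For any $\omega\in\Omega$ and $t\ge 0$, $U^{(1)}_\omega(t)\circ i=i\circ U^{(2)}_\omega(t)$. (A3) For any $\omega\in\Omega$ there is a map $U^{(1,2)}_\omega(1)\in\mathcal{L}(X_1,X_2)$ such that $U^{(1)}_\omega(1)=i\circ U^{(1,2)}_\omega(1)$ and $U^{(2)}_\omega(1)=U^{(1,2)}_\omega(1)\circ i$; moreover there exists $M>0$ such that $\|U^{(1,2)}_\omega(1)\|_{1,2}\le M$ for all $\omega\in\Omega$. (A4) For all $u\in X_1$ the mapping $\Omega\ni\omega\mapsto U^{(1,2)}_\omega(1)u\in X_2$ is $(\mathfrak{F},\mathfrak{B}(X_2))$-measurable. (A5) $X_1$ and $X_2$ are separable. (A6) For any $A\in\mathfrak{B}(X_2)$ there exists $B\in\mathfrak{B}(X_1)$ such that $A=i^{-1}(B)$. If $\Phi^{(1)}$ admits an Oseledets decomposition in case (O1), then $\Phi^{(2)}$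 admits an Oseledets decomposition in case (O1). If $\Phi^{(1)}$ admits an Oseledets decomposition in case (O2), then $\Phi^{(2)}$ admits an Oseledets decomposition in case (O2).
   Context: **Notation.** $\mathbb{R}^+=[0,\infty)$; $\mathfrak{B}(S)$ is the Borel $\sigma$-algebra of a metric space $S$; $\mathcal{L}(X)$ and $\mathcal{L}(X_m,X_n)$ are the spaces of bounded linear operators; $\|\cdot\|_{m,n}$ is the operator norm on $\mathcal{L}(X_m,X_n)$, $m,n\in\{1,2\}$; $\ln^+ x=\max(\ln x,0)$. **Metric dynamical systems.** $(\Omega,\mathfrak{F},\mathbb{P})$ is a complete probability space. A metric dynamical system is a $(\mathfrak{B}(\mathbb{R})\otimes\mathfrak{F},\mathfrak{F})$-measurable map $\theta\colon\mathbb{R}\times\Omega\to\Omega$, $\theta_t\omega:=\theta(t,\omega)$, with $\theta_0\omega=\omega$, $\theta_{t+s}\omega=\theta_t\theta_s\omega$ for all $\omega\in\Omega$ and $t,s\in\mathbb{R}$, and with each $\theta_t$ $\mathbb{P}$-preserving. A subset $\Omega'\subset\Omega$ is invariant if $\theta_t(\Omega')=\Omega'$ for all $t\in\mathbb{R}$. The system is ergodic if every invariant $F\in\mathfrak{F}$ has $\mathbb{P}(F)\in\{0,1\}$. **Semiflows.** A measurable linear skew-product semidynamical system (semiflow) $\Phi=((U_\omega(t))_{\omega\in\Omega,t\in\mathbb{R}^+},(\theta_t)_{t\in\mathbb{R}})$ on a Banach space $X$ covering $(\theta_t)$ is a $(\mathfrak{B}(\mathbb{R}^+)\otimes\mathfrak{F}\otimes\mathfrak{B}(X),\mathfrak{B}(X))$-measurable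 map $(t,\omega,u)\mapsto U_\omega(t)u\in X$ such that $U_\omega(t)\in\mathcal{L}(X)$, $U_\omega(0)=\mathrm{Id}_X$, and $U_{\theta_s\omega}(t)\circ U_\omega(s)=U_\omega(t+s)$ for all $\omega\in\Omega$, $t,s\in\mathbb{R}^+$. A negative semiorbit passing through $(\omega,u)\in\Omega\times X$ is a $(\mathfrak{B}((-\infty,0]),\mathfrak{B}(X))$-measurable map $\tilde u\colon(-\infty,0]\to X$ with $\tilde u(0)=u$ and $\tilde u(s+t)=U_{\theta_s\omega}(t)\tilde u(s)$ whenever $s\le 0$, $t\ge 0$, $s+t\le 0$. **Standing assumptions on semiflows.** Each semiflow under consideration satisfies: (E1) the functions $\omega\mapsto\sup_{0\le s\le 1}\ln^+\|U_\omega(s)\|$ and $\omega\mapsto\sup_{0\le s\le 1}\ln^+\|U_{\theta_s\omega}(1-s)\|$ belong to $L_1(\Omega,\mathfrak{F},\mathbb{P})$. By Kingman's theorem there is then $\lambda_{\mathrm{top}}\in[-\infty,\infty)$, the top Lyapunov exponent of the semiflow, with $\lim_{t\to\infty}\frac1t\ln\|U_\omega(t)\|=\lambda_{\mathrm{top}}$ for $\mathbb{P}$-a.e. $\omega$. (E2) $\lambda_{\mathrm{top}}>-\infty$. **Measurability and temperedness.** For $\Omega_0\in\mathfrak{F}$, a family $\{E(\omega)\}_{\omega\in\Omega_0}$ of $l$-dimensional vector subspaces of $X$ is measurable if there are $(\mathfrak{F},\mathfrak{B}(X))$-measurable functions $v_1,\dots,v_l\colon\Omega_0\to X$ such that $(v_1(\omega),\dots,v_l(\omega))$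 is a basis of $E(\omega)$ for each $\omega\in\Omega_0$. If $E(\omega)\oplus F(\omega)=X$ with $E(\omega)$ $l$-dimensional and $F(\omega)$ closed of codimension $l$, the family of projections associated with this decomposition is $\{P(\omega)\}_{\omega\in\Omega_0}$, where $P(\omega)$ is the projection of $X$ onto $F(\omega)$ along $E(\omega)$. It is strongly measurable if $\omega\mapsto P(\omega)u$ is $(\mathfrak{F},\mathfrak{B}(X))$-measurable for each $u\in X$. A strongly measurable family of projections associated with an invariant decomposition (i.e. $\Omega_0$ invariant, $U_\omega(t)E(\omega)=E(\theta_t\omega)$, $U_\omega(t)F(\omega)\subset F(\theta_t\omega)$ for $t\ge0$) is tempered if $\lim_{t\to\pm\infty}\frac1t\ln\|P(\theta_t\omega)\|=0$ for $\mathbb{P}$-a.e. $\omega\in\Omega_0$. **Oseledets decomposition.** $\Phi$ (on $X$) admits an Oseledets decomposition if there is an invariant $\Omega_0\subset\Omega$, $\mathbb{P}(\Omega_0)=1$, such that one of the following mutually exclusive cases holds. *Case (O1).* There are $k$ real numbers $\lambda_1=\lambda_{\mathrm{top}}>\dots>\lambda_k$, $k$ measurable families $\{E_1(\omega)\}_{\omega\in\Omega_0},\dots,\{E_k(\omega)\}_{\omega\in\Omega_0}$ of finite-dimensional vector subspaces, and a family $\{F_\infty(\omega)\}_{\omega\in\Omega_0}$ of closed vector subspaces of finite codimension such that: (i) for $j=1,\dots,k$, $\omega\in\Omega_0$, $t\ge0$: $U_\omega(t)E_j(\omega)=E_j(\theta_t\omega)$ and $U_\omega(t)F_\infty(\omega)\subset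 F_\infty(\theta_t\omega)$; (ii) $E_1(\omega)\oplus\dots\oplus E_k(\omega)\oplus F_\infty(\omega)=X$ for $\omega\in\Omega_0$; write $F_j(\omega):=\bigoplus_{m=j+1}^kE_m(\omega)\oplus F_\infty(\omega)$ for $j=0,\dots,k$; (iii) for $j=1,\dots,k$ the family of projections associated with $\big(\bigoplus_{n=1}^jE_n(\omega)\big)\oplus F_j(\omega)=X$ is strongly measurable and tempered; (iv) for $j=1,\dots,k$, $\omega\in\Omega_0$ and nonzero $u\in E_j(\omega)$: $\lim_{t\to\infty}\frac1t\ln\|U_\omega(t)u\|=\lambda_j$; (v) for $j=1,\dots,k$ and $\omega\in\Omega_0$, a nonzero $u\in F_{j-1}(\omega)$ belongs to $E_j(\omega)$ if and only if there exists a negative semiorbit $\tilde u$ passing through $(\omega,u)$ with $\lim_{s\to-\infty}\frac1s\ln\|\tilde u(s)\|=\lambda_j$; (vi) for $\omega\in\Omega_0$: $\lim_{t\to\infty}\frac1t\ln\|U_\omega(t)|_{F_\infty(\omega)}\|=-\infty$. *Case (O2).* There is a strictly decreasing sequence of real numbers $\lambda_1=\lambda_{\mathrm{top}}>\dots>\lambda_j>\lambda_{j+1}>\cdots$ with limit $-\infty$, measurable families $\{E_j(\omega)\}_{\omega\in\Omega_0}$, $j\in\mathbb{N}$ ($j\ge 1$), of finite-dimensional vector subspaces, and families $\{F_j(\omega)\}_{\omega\in\Omega_0}$, $j\in\mathbb{N}$, of closed vector subspaces of finite codimension (with $F_0(\omega):=X$) such that: (i) for $j\in\mathbb{N}$,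 $\omega\in\Omega_0$, $t\ge0$: $U_\omega(t)E_j(\omega)=E_j(\theta_t\omega)$ and $U_\omega(t)F_j(\omega)\subset F_j(\theta_t\omega)$; (ii) for $j\in\mathbb{N}$, $\omega\in\Omega_0$: $E_1(\omega)\oplus\dots\oplus E_j(\omega)\oplus F_j(\omega)=X$ and $F_j(\omega)=E_{j+1}(\omega)\oplus F_{j+1}(\omega)$; (iii) for $j\in\mathbb{N}$ the family of projections associated with $\big(\bigoplus_{n=1}^jE_n(\omega)\big)\oplus F_j(\omega)=X$ is strongly measurable and tempered; (iv) for $j\in\mathbb{N}$, $\omega\in\Omega_0$ and nonzero $u\in E_j(\omega)$: $\lim_{t\to\infty}\frac1t\ln\|U_\omega(t)u\|=\lambda_j$; (v) for $j\in\mathbb{N}$ and $\omega\in\Omega_0$, a nonzero $u\in F_{j-1}(\omega)$ belongs to $E_j(\omega)$ if and only if there exists a negative semiorbit $\tilde u$ passing through $(\omega,u)$ with $\lim_{s\to-\infty}\frac1s\ln\|\tilde u(s)\|=\lambda_j$; (vi) for $j\in\mathbb{N}$, $\omega\in\Omega_0$: $\lim_{t\to\infty}\frac1t\ln\|U_\omega(t)|_{F_j(\omega)}\|=\lambda_{j+1}$.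
   Formalization: In the definition of tempered, the zero projection (F_∞={0} in case (O1)) is counted as tempered; with ln 0 = −∞ there, as in (vi), the claim fails, e.g. for X_1 = R × L^1[0,1] with a nilpotent shift on the second factor and X_2 = R. *)

theory Defs
  imports "HOL-Probability.Probability"
begin

section \<open>Metric dynamical systems\<close>

locale metric_dynamical_system = prob_space M + complete_measure M
  for M :: "'w measure" +
  fixes \<theta> :: "real \<Rightarrow> 'w \<Rightarrow> 'w"
  assumes flow_measurable: "(\<lambda>(t, \<omega>). \<theta> t \<omega>) \<in> borel \<Otimes>\<^sub>M M \<rightarrow>\<^sub>M M"
    and flow_zero: "\<omega> \<in> space M \<Longrightarrow> \<theta> 0 \<omega> = \<omega>"
    and flow_add: "\<omega> \<in> space M \<Longrightarrow> \<theta> (t + s) \<omega> = \<theta> t (\<theta> s \<omega>)"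
    and flow_preserving: "distr M M (\<theta> t) = M"

definition flow_invariant :: "'w measure \<Rightarrow> (real \<Rightarrow> 'w \<Rightarrow> 'w) \<Rightarrow> 'w set \<Rightarrow> bool"
  where "flow_invariant M \<theta> W \<longleftrightarrow> W \<subseteq> space M \<and> (\<forall>t. \<theta> t ` W = W)"

locale ergodic_system = metric_dynamical_system +
  assumes ergodic: "F \<in> sets M \<Longrightarrow> flow_invariant M \<theta> F \<Longrightarrow> measure M F \<in> {0, 1}"

section \<open>Semiflows\<close>

text \<open>
  The generator \<open>U \<omega> t\<close> is a bounded linear operator whose values matter only for
  \<open>\<omega> \<in> space M\<close> and \<open>t \<ge> 0\<close>.
\<close>

locale semiflow = metric_dynamical_system M \<theta>
  for M :: "'w measure" and \<theta> :: "real \<Rightarrow> 'w \<Rightarrow> 'w" +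
  fixes U :: "'w \<Rightarrow> real \<Rightarrow> ('a::banach \<Rightarrow>\<^sub>L 'a)"
  assumes semiflow_measurable:
      "(\<lambda>(t, \<omega>, u). blinfun_apply (U \<omega> t) u)
         \<in> restrict_space borel {0..} \<Otimes>\<^sub>M (M \<Otimes>\<^sub>M borel) \<rightarrow>\<^sub>M borel"
    and semiflow_zero: "\<omega> \<in> space M \<Longrightarrow> U \<omega> 0 = id_blinfun"
    and semiflow_add: "\<omega> \<in> space M \<Longrightarrow> 0 \<le> t \<Longrightarrow> 0 \<le> s \<Longrightarrow>
           U (\<theta> s \<omega>) t o\<^sub>L U \<omega> s = U \<omega> (t + s)"

definition negative_semiorbit ::
    "(real \<Rightarrow> 'w \<Rightarrow> 'w) \<Rightarrow> ('w \<Rightarrow> real \<Rightarrow> ('a::banach \<Rightarrow>\<^sub>L 'a)) \<Rightarrow> 'w \<Rightarrow> 'a \<Rightarrow> (real \<Rightarrow> 'a) \<Rightarrow> bool"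
  where "negative_semiorbit \<theta> U \<omega> u v \<longleftrightarrow>
    v \<in> restrict_space borel {..0} \<rightarrow>\<^sub>M borel \<and> v 0 = u \<and>
    (\<forall>s t. s \<le> 0 \<and> 0 \<le> t \<and> s + t \<le> 0 \<longrightarrow> v (s + t) = blinfun_apply (U (\<theta> s \<omega>) t) (v s))"

section \<open>Lyapunov exponents\<close>

text \<open>
  The library has \<open>ln 0 = 0\<close> on the reals; growth rates need \<open>ln 0 = -\<infinity>\<close>.
\<close>

definition ln_ext :: "real \<Rightarrow> ereal"
  where "ln_ext x = (if x \<le> 0 then -\<infinity> else ereal (ln x))"

definition growth_rate :: "(real \<Rightarrow> real) \<Rightarrow> real \<Rightarrow> ereal"
  where "growth_rate r t = ereal (1 / t) * ln_ext (r t)"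

text \<open>
  The suprema are taken in \<open>[0, \<infinity>]\<close>; membership in \<open>L\<^sub>1\<close> is measurability together with a
  finite integral.
\<close>

definition standing_E1 ::
    "'w measure \<Rightarrow> (real \<Rightarrow> 'w \<Rightarrow> 'w) \<Rightarrow> ('w \<Rightarrow> real \<Rightarrow> ('a::banach \<Rightarrow>\<^sub>L 'a)) \<Rightarrow> bool"
  where "standing_E1 M \<theta> U \<longleftrightarrow>
    (let f = (\<lambda>\<omega>. SUP s\<in>{0..1}. ennreal (max (ln (norm (U \<omega> s))) 0));
         g = (\<lambda>\<omega>. SUP s\<in>{0..1}. ennreal (max (ln (norm (U (\<theta> s \<omega>) (1 - s)))) 0))
     in f \<in> borel_measurable M \<and> (\<integral>\<^sup>+\<omega>. f \<omega> \<partial>M) < \<infinity> \<and>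
        g \<in> borel_measurable M \<and> (\<integral>\<^sup>+\<omega>. g \<omega> \<partial>M) < \<infinity>)"

text \<open>
  By Kingman's subadditive ergodic theorem this number exists for an ergodic system
  under \<open>standing_E1\<close>.
\<close>

definition top_exponent :: "'w measure \<Rightarrow> ('w \<Rightarrow> real \<Rightarrow> ('a::banach \<Rightarrow>\<^sub>L 'a)) \<Rightarrow> ereal"
  where "top_exponent M U =
    (THE l. l < \<infinity> \<and> (AE \<omega> in M. (growth_rate (\<lambda>t. norm (U \<omega> t)) \<longlongrightarrow> l) at_top))"

definition standing_E2 :: "'w measure \<Rightarrow> ('w \<Rightarrow> real \<Rightarrow> ('a::banach \<Rightarrow>\<^sub>L 'a)) \<Rightarrow> bool"
  where "standing_E2 M U \<longleftrightarrow> top_exponent M U > -\<infinity>"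

section \<open>Families of subspaces and projections\<close>

text \<open>
  Sums of subspaces are the elementwise sums of \<^theory>\<open>HOL-Library.Set_Algebras\<close>
  (the empty sum is \<open>{0}\<close>).
\<close>

definition independent_subspaces :: "nat set \<Rightarrow> (nat \<Rightarrow> 'a::real_vector set) \<Rightarrow> bool"
  where "independent_subspaces I S \<longleftrightarrow>
    (\<forall>x. (\<forall>n\<in>I. x n \<in> S n) \<and> (\<Sum>n\<in>I. x n) = 0 \<longrightarrow> (\<forall>n\<in>I. x n = 0))"

definition is_direct_sum :: "'a::real_vector set \<Rightarrow> 'a set \<Rightarrow> 'a set \<Rightarrow> bool"
  where "is_direct_sum A B V \<longleftrightarrow> A + B = V \<and> A \<inter> B = {0}"

definition closed_finite_codim_subspace :: "'a::real_normed_vector set \<Rightarrow> bool"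
  where "closed_finite_codim_subspace F \<longleftrightarrow>
    subspace F \<and> closed F \<and> (\<exists>B. finite B \<and> span (F \<union> B) = UNIV)"

text \<open>A measurable family of \<open>l\<close>-dimensional subspaces.\<close>

definition measurable_subspaces ::
    "'w measure \<Rightarrow> 'w set \<Rightarrow> nat \<Rightarrow> ('w \<Rightarrow> 'a::real_normed_vector set) \<Rightarrow> bool"
  where "measurable_subspaces M W l E \<longleftrightarrow>
    (\<exists>v :: nat \<Rightarrow> 'w \<Rightarrow> 'a.
       (\<forall>n<l. v n \<in> restrict_space M W \<rightarrow>\<^sub>M borel) \<and>
       (\<forall>\<omega>\<in>W. inj_on (\<lambda>n. v n \<omega>) {..<l} \<and> independent ((\<lambda>n. v n \<omega>) ` {..<l}) \<and>
               span ((\<lambda>n. v n \<omega>) ` {..<l}) = E \<omega>))"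

text \<open>The projection onto \<open>F\<close> along \<open>E\<close>, for \<open>E \<oplus> F\<close> the whole space.\<close>

definition projection_along :: "'a::real_vector set \<Rightarrow> 'a set \<Rightarrow> 'a \<Rightarrow> 'a"
  where "projection_along E F u = (THE v. v \<in> F \<and> u - v \<in> E)"

definition strongly_measurable ::
    "'w measure \<Rightarrow> 'w set \<Rightarrow> ('w \<Rightarrow> 'a::real_normed_vector \<Rightarrow> 'a) \<Rightarrow> bool"
  where "strongly_measurable M W P \<longleftrightarrow> (\<forall>u. (\<lambda>\<omega>. P \<omega> u) \<in> restrict_space M W \<rightarrow>\<^sub>M borel)"

text \<open>
  A nonzero projection has norm at least 1. If \<open>F = {0}\<close>, the projection vanishes and
  the library's \<open>ln 0 = 0\<close> makes it tempered: the logarithm here agrees with \<open>ln\<^sup>+\<close>.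
  This is intended, as it admits decompositions whose remaining subspace is \<open>{0}\<close>, for
  instance in finite dimension.
\<close>

definition tempered ::
    "'w measure \<Rightarrow> (real \<Rightarrow> 'w \<Rightarrow> 'w) \<Rightarrow> 'w set \<Rightarrow> ('w \<Rightarrow> 'a::real_normed_vector \<Rightarrow> 'a) \<Rightarrow> bool"
  where "tempered M \<theta> W P \<longleftrightarrow>
    (AE \<omega> in M. \<omega> \<in> W \<longrightarrow>
       ((\<lambda>t. 1 / t * ln (onorm (P (\<theta> t \<omega>)))) \<longlongrightarrow> 0) at_top \<and>
       ((\<lambda>t. 1 / t * ln (onorm (P (\<theta> t \<omega>)))) \<longlongrightarrow> 0) at_bot)"

definition onorm_on :: "'a::real_normed_vector set \<Rightarrow> ('a \<Rightarrow> 'b::real_normed_vector) \<Rightarrow> real"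
  where "onorm_on S f = (SUP x\<in>S. norm (f x) / norm x)"

section \<open>Oseledets decompositions\<close>

text \<open>
  The exponents and subspaces are indexed from 1. In the first case \<open>F\<^sub>j\<close> is derived from
  \<open>F\<^sub>\<infinity>\<close>; in the second the \<open>F\<^sub>j\<close> are part of the data, with \<open>F\<^sub>0\<close> the whole space.
\<close>

definition tail_sum ::
    "nat \<Rightarrow> (nat \<Rightarrow> 'w \<Rightarrow> 'a::real_vector set) \<Rightarrow> ('w \<Rightarrow> 'a set) \<Rightarrow> nat \<Rightarrow> 'w \<Rightarrow> 'a set"
  where "tail_sum k E Finf j \<omega> = (\<Sum>m=j+1..k. E m \<omega>) + Finf \<omega>"

definition oseledets_decomposition_O1 ::
    "'w measure \<Rightarrow> (real \<Rightarrow> 'w \<Rightarrow> 'w) \<Rightarrow> ('w \<Rightarrow> real \<Rightarrow> ('a::banach \<Rightarrow>\<^sub>L 'a)) \<Rightarrow> 'w set \<Rightarrow>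
     nat \<Rightarrow> (nat \<Rightarrow> real) \<Rightarrow> (nat \<Rightarrow> 'w \<Rightarrow> 'a set) \<Rightarrow> ('w \<Rightarrow> 'a set) \<Rightarrow> bool"
  where "oseledets_decomposition_O1 M \<theta> U W k lam E Finf \<longleftrightarrow>
    1 \<le> k \<and> ereal (lam 1) = top_exponent M U \<and>
    (\<forall>j\<in>{1..<k}. lam (Suc j) < lam j) \<and>
    (\<forall>j\<in>{1..k}. \<exists>l. measurable_subspaces M W l (E j)) \<and>
    (\<forall>\<omega>\<in>W. closed_finite_codim_subspace (Finf \<omega>)) \<and>
    \<comment> \<open>(i)\<close>
    (\<forall>j\<in>{1..k}. \<forall>\<omega>\<in>W. \<forall>t\<ge>0.
       blinfun_apply (U \<omega> t) ` E j \<omega> = E j (\<theta> t \<omega>) \<and>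
       blinfun_apply (U \<omega> t) ` Finf \<omega> \<subseteq> Finf (\<theta> t \<omega>)) \<and>
    \<comment> \<open>(ii)\<close>
    (\<forall>\<omega>\<in>W. independent_subspaces {1..k} (\<lambda>n. E n \<omega>) \<and>
       is_direct_sum (\<Sum>n=1..k. E n \<omega>) (Finf \<omega>) UNIV) \<and>
    \<comment> \<open>(iii)\<close>
    (\<forall>j\<in>{1..k}.
       let P = (\<lambda>\<omega>. projection_along (\<Sum>n=1..j. E n \<omega>) (tail_sum k E Finf j \<omega>))
       in strongly_measurable M W P \<and> tempered M \<theta> W P) \<and>
    \<comment> \<open>(iv)\<close>
    (\<forall>j\<in>{1..k}. \<forall>\<omega>\<in>W. \<forall>u\<in>E j \<omega>. u \<noteq> 0 \<longrightarrow>
       (growth_rate (\<lambda>t. norm (blinfun_apply (U \<omega> t) u)) \<longlongrightarrow> ereal (lam j)) at_top) \<and>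
    \<comment> \<open>(v)\<close>
    (\<forall>j\<in>{1..k}. \<forall>\<omega>\<in>W. \<forall>u\<in>tail_sum k E Finf (j - 1) \<omega>. u \<noteq> 0 \<longrightarrow>
       (u \<in> E j \<omega> \<longleftrightarrow>
        (\<exists>v. negative_semiorbit \<theta> U \<omega> u v \<and>
             (growth_rate (\<lambda>s. norm (v s)) \<longlongrightarrow> ereal (lam j)) at_bot))) \<and>
    \<comment> \<open>(vi)\<close>
    (\<forall>\<omega>\<in>W.
       (growth_rate (\<lambda>t. onorm_on (Finf \<omega>) (blinfun_apply (U \<omega> t))) \<longlongrightarrow> -\<infinity>) at_top)"

definition admits_oseledets_O1 ::
    "'w measure \<Rightarrow> (real \<Rightarrow> 'w \<Rightarrow> 'w) \<Rightarrow> ('w \<Rightarrow> real \<Rightarrow> ('a::banach \<Rightarrow>\<^sub>L 'a)) \<Rightarrow> bool"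
  where "admits_oseledets_O1 M \<theta> U \<longleftrightarrow>
    (\<exists>W. W \<in> sets M \<and> flow_invariant M \<theta> W \<and> measure M W = 1 \<and>
       (\<exists>k lam E Finf. oseledets_decomposition_O1 M \<theta> U W k lam E Finf))"

definition oseledets_decomposition_O2 ::
    "'w measure \<Rightarrow> (real \<Rightarrow> 'w \<Rightarrow> 'w) \<Rightarrow> ('w \<Rightarrow> real \<Rightarrow> ('a::banach \<Rightarrow>\<^sub>L 'a)) \<Rightarrow> 'w set \<Rightarrow>
     (nat \<Rightarrow> real) \<Rightarrow> (nat \<Rightarrow> 'w \<Rightarrow> 'a set) \<Rightarrow> (nat \<Rightarrow> 'w \<Rightarrow> 'a set) \<Rightarrow> bool"
  where "oseledets_decomposition_O2 M \<theta> U W lam E F \<longleftrightarrow>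
    ereal (lam 1) = top_exponent M U \<and>
    (\<forall>j\<ge>1. lam (Suc j) < lam j) \<and> filterlim lam at_bot sequentially \<and>
    (\<forall>j\<ge>1. \<exists>l. measurable_subspaces M W l (E j)) \<and>
    (\<forall>j\<ge>1. \<forall>\<omega>\<in>W. closed_finite_codim_subspace (F j \<omega>)) \<and>
    (\<forall>\<omega>\<in>W. F 0 \<omega> = UNIV) \<and>
    \<comment> \<open>(i)\<close>
    (\<forall>j\<ge>1. \<forall>\<omega>\<in>W. \<forall>t\<ge>0.
       blinfun_apply (U \<omega> t) ` E j \<omega> = E j (\<theta> t \<omega>) \<and>
       blinfun_apply (U \<omega> t) ` F j \<omega> \<subseteq> F j (\<theta> t \<omega>)) \<and>
    \<comment> \<open>(ii)\<close>
    (\<forall>j\<ge>1. \<forall>\<omega>\<in>W. independent_subspaces {1..j} (\<lambda>n. E n \<omega>) \<and>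
       is_direct_sum (\<Sum>n=1..j. E n \<omega>) (F j \<omega>) UNIV \<and>
       is_direct_sum (E (Suc j) \<omega>) (F (Suc j) \<omega>) (F j \<omega>)) \<and>
    \<comment> \<open>(iii)\<close>
    (\<forall>j\<ge>1.
       let P = (\<lambda>\<omega>. projection_along (\<Sum>n=1..j. E n \<omega>) (F j \<omega>))
       in strongly_measurable M W P \<and> tempered M \<theta> W P) \<and>
    \<comment> \<open>(iv)\<close>
    (\<forall>j\<ge>1. \<forall>\<omega>\<in>W. \<forall>u\<in>E j \<omega>. u \<noteq> 0 \<longrightarrow>
       (growth_rate (\<lambda>t. norm (blinfun_apply (U \<omega> t) u)) \<longlongrightarrow> ereal (lam j)) at_top) \<and>
    \<comment> \<open>(v)\<close>
    (\<forall>j\<ge>1. \<forall>\<omega>\<in>W. \<forall>u\<in>F (j - 1) \<omega>. u \<noteq> 0 \<longrightarrow>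
       (u \<in> E j \<omega> \<longleftrightarrow>
        (\<exists>v. negative_semiorbit \<theta> U \<omega> u v \<and>
             (growth_rate (\<lambda>s. norm (v s)) \<longlongrightarrow> ereal (lam j)) at_bot))) \<and>
    \<comment> \<open>(vi)\<close>
    (\<forall>j\<ge>1. \<forall>\<omega>\<in>W.
       (growth_rate (\<lambda>t. onorm_on (F j \<omega>) (blinfun_apply (U \<omega> t)))
          \<longlongrightarrow> ereal (lam (Suc j))) at_top)"

definition admits_oseledets_O2 ::
    "'w measure \<Rightarrow> (real \<Rightarrow> 'w \<Rightarrow> 'w) \<Rightarrow> ('w \<Rightarrow> real \<Rightarrow> ('a::banach \<Rightarrow>\<^sub>L 'a)) \<Rightarrow> bool"
  where "admits_oseledets_O2 M \<theta> U \<longleftrightarrow>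
    (\<exists>W. W \<in> sets M \<and> flow_invariant M \<theta> W \<and> measure M W = 1 \<and>
       (\<exists>lam E F. oseledets_decomposition_O2 M \<theta> U W lam E F))"

end

theory Submission
  imports Defs
begin

text \<open>
  Since \<open>E\<^sub>j(\<omega>) = U(1) E\<^sub>j(\<theta>\<^sub>-\<^sub>1\<omega>)\<close> and \<open>U(1)\<close> factors through \<open>i\<close>, each \<open>E\<^sub>j(\<omega>)\<close> lies in the
  range of \<open>i\<close>, and the preimages under \<open>i\<close> of all the subspaces decompose \<open>X\<^sub>2\<close>. The two norms of a
  trajectory bound each other up to a unit time shift, so all growth rates agree; measurability passes
  to \<open>X\<^sub>2\<close> because every Borel set of \<open>X\<^sub>2\<close> is a preimage of one of \<open>X\<^sub>1\<close>.

  The difficult point is temperedness of the new projections, that is, a subexponential bound for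
  \<open>i\<^sup>-\<^sup>1\<close> on \<open>E\<^sub>j(\<theta>\<^sub>t\<omega>)\<close>, which reduces to one for the inverse of \<open>U(1)\<close> on \<open>E\<^sub>j\<close>. The backward
  trajectories in the finite-dimensional space \<open>E\<^sub>j(\<omega>)\<close> grow at most exponentially; let \<open>exp (l(\<omega>))\<close> be the
  best constant in this estimate. It controls the inverse of \<open>U(1)\<close>, and \<open>l \<le> l \<circ> \<theta>\<^sub>1 + g\<close> with \<open>g\<close>
  integrable. By the maximal ergodic inequality this forces \<open>l\<close> to grow sublinearly along almost
  every orbit, in both directions of time.
\<close>

section \<open>A maximal ergodic inequality\<close>

text \<open>The inverse of \<open>i\<close> is unbounded. On one \<open>E j \<omega>\<close> it is
  bounded by finite dimension, but this says nothing about how the bound varies along an orbit, and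
  no integrability of it is known. Hence the one-sided criterion: for a finite measurable
  \<open>f\<close> that drops by at most an integrable \<open>g\<close> per unit time, returns below
  a fixed level are so frequent that \<open>g\<close> controls every excursion above it. Taking the
  supremum over all past lengths \<open>n\<close> is what gives \<open>l\<close> this property. A
  trajectory of length \<open>n\<close> ending at \<open>\<omega>\<close> continues to one of length
  \<open>n + 1\<close> ending at \<open>\<theta> 1 \<omega>\<close>; this costs the norm of
  \<open>U \<omega> 1\<close>, whose positive logarithm is integrable by (E1), and one unit of the
  discount rate. The rate \<open>\<bar>lam j\<bar> + 1\<close> exceeds the backward rate
  \<open>- lam j\<close>, which keeps the supremum finite. To make \<open>l\<close> measurable, a
  countable dense set is projected into \<open>E j\<close> by differences of the strongly measurable
  projections. The ergodic argument uses integer times only; the two halves of (E1) bridge the gaps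
  to real times.\<close>

context metric_dynamical_system
begin

lemma measurable_flow [measurable]: "\<theta> t \<in> M \<rightarrow>\<^sub>M M"
proof -
  have "(\<lambda>\<omega>. (t, \<omega>)) \<in> M \<rightarrow>\<^sub>M borel \<Otimes>\<^sub>M M" by simp
  from measurable_compose[OF this flow_measurable] show ?thesis by simp
qed

lemma flow_in_space: "\<omega> \<in> space M \<Longrightarrow> \<theta> t \<omega> \<in> space M"
  using measurable_space[OF measurable_flow] .

lemma AE_flow:
  assumes "AE \<omega> in M. P \<omega>"
  shows "AE \<omega> in M. P (\<theta> t \<omega>)"
  by (rule AE_distrD[OF measurable_flow[of t], unfolded flow_preserving, OF assms])

lemma AE_flow_int:
  assumes "AE \<omega> in M. P \<omega>"
  shows "AE \<omega> in M. \<forall>n::int. P (\<theta> (of_int n) \<omega>)"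
  using AE_flow[OF assms] by (subst AE_all_countable) blast

lemma integrable_flow:
  fixes f :: "'w \<Rightarrow> real"
  assumes "integrable M f"
  shows "integrable M (\<lambda>\<omega>. f (\<theta> t \<omega>))"
  using assms flow_preserving[of t] by (intro integrable_distr[OF measurable_flow]) simp

lemma integral_flow:
  fixes f :: "'w \<Rightarrow> real"
  assumes "integrable M f"
  shows "(\<integral>\<omega>. f (\<theta> t \<omega>) \<partial>M) = (\<integral>\<omega>. f \<omega> \<partial>M)"
  using integral_distr[OF measurable_flow, of f t] assms flow_preserving[of t] by simp

text \<open>Garsia's proof of the maximal ergodic theorem, with the running maximum of the partial
  sums of \<open>g - a\<close> defined by recursion along the orbit.\<close>

lemma maximal_inequality:
  fixes g :: "'w \<Rightarrow> real" and a d :: real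
  assumes g: "integrable M g" "\<And>\<omega>. 0 \<le> g \<omega>" and a: "0 < a"
  obtains B where "B \<in> sets M" "measure M B \<le> (\<integral>\<omega>. g \<omega> \<partial>M) / a"
    "\<And>\<omega> n. \<omega> \<in> space M \<Longrightarrow> \<omega> \<notin> B \<Longrightarrow> (\<Sum>k<n. g (\<theta> (d * real k) \<omega>)) \<le> a * real n"
proof -
  define m where "m = rec_nat (\<lambda>_. 0) (\<lambda>N r \<omega>. max 0 (g \<omega> - a + r (\<theta> d \<omega>)))"
  have m0: "m 0 \<omega> = 0" for \<omega> by (simp add: m_def)
  have mS: "m (Suc N) \<omega> = max 0 (g \<omega> - a + m N (\<theta> d \<omega>))" for N \<omega> by (simp add: m_def)
  have m_nonneg: "0 \<le> m N \<omega>" for N \<omega> by (cases N) (simp_all add: m0 mS)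
  have m_int: "integrable M (m N)" for N
  proof (induction N)
    case 0
    have "m 0 = (\<lambda>_. 0)" by (simp add: m0 fun_eq_iff)
    then show ?case by simp
  next
    case (Suc N)
    have "m (Suc N) = (\<lambda>\<omega>. max 0 (g \<omega> - a + m N (\<theta> d \<omega>)))" by (simp add: mS fun_eq_iff)
    then show ?case using integrable_flow[OF Suc.IH, of d] g(1) by simp
  qed
  have [measurable]: "m N \<in> borel_measurable M" "g \<in> borel_measurable M" for N
    using m_int g(1) by auto
  have m_mono: "m N \<omega> \<le> m (Suc N) \<omega>" for N \<omega>
  proof (induction N arbitrary: \<omega>)
    case 0 show ?case by (simp add: m0 m_nonneg)
  next
    case (Suc N) show ?case using Suc.IH[of "\<theta> d \<omega>"] by (simp add: mS[of N] mS[of "Suc N"])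
  qed
  have sum_le: "(\<Sum>k<n. g (\<theta> (d * real k) \<omega>)) - a * real n \<le> m n \<omega>" if "\<omega> \<in> space M" for n \<omega>
    using that
  proof (induction n arbitrary: \<omega>)
    case 0 show ?case by (simp add: m0)
  next
    case (Suc n)
    have "\<theta> (d * real (Suc k)) \<omega> = \<theta> (d * real k) (\<theta> d \<omega>)" for k
      using flow_add[OF Suc.prems, of "d * real k" d] by (simp add: algebra_simps)
    then have "(\<Sum>k<Suc n. g (\<theta> (d * real k) \<omega>)) = g \<omega> + (\<Sum>k<n. g (\<theta> (d * real k) (\<theta> d \<omega>)))"
      by (simp add: sum.lessThan_Suc_shift flow_zero[OF Suc.prems] del: sum.lessThan_Suc)
    with Suc.IH[OF flow_in_space[OF Suc.prems, of d]] show ?case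
      by (simp add: mS algebra_simps)
  qed
  define A where "A N = {\<omega> \<in> space M. 0 < m N \<omega>}" for N
  have A_sets [measurable]: "A N \<in> sets M" for N by (simp add: A_def)
  have A_le: "measure M (A N) \<le> (\<integral>\<omega>. g \<omega> \<partial>M) / a" for N
  proof (cases N)
    case 0
    have "A N = {}" by (simp add: A_def 0 m0)
    then show ?thesis using a g(2) by simp
  next
    case (Suc N')
    have I: "integrable M (\<lambda>\<omega>. indicator (A N) \<omega> * (g \<omega> - a))"
      using integrable_real_mult_indicator[OF A_sets, of "\<lambda>\<omega>. g \<omega> - a" N] g(1)
      by (simp add: mult.commute)
    have ind: "integrable M (\<lambda>\<omega>. a * indicator (A N) \<omega>)"
      by (intro integrable_mult_right integrable_real_indicator) (simp_all add: emeasure_eq_measure)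
    have "0 = (\<integral>\<omega>. m N \<omega> - m N (\<theta> d \<omega>) \<partial>M)"
      using integral_flow[OF m_int, of N d] integrable_flow[OF m_int, of N d] m_int[of N] by simp
    \<comment> \<open>On \<open>A N\<close> the maximum is positive, so \<open>m N\<close> is
      \<open>g - a\<close> plus the shorter maximum at \<open>\<theta> d \<omega>\<close>; off
      \<open>A N\<close> it is zero. By invariance of the measure the difference on the left
      integrates to 0.\<close>
    also have "\<dots> \<le> (\<integral>\<omega>. indicator (A N) \<omega> * (g \<omega> - a) \<partial>M)"
    proof (rule integral_mono)
      fix \<omega> assume w: "\<omega> \<in> space M"
      show "m N \<omega> - m N (\<theta> d \<omega>) \<le> indicator (A N) \<omega> * (g \<omega> - a)"
      proof (cases "\<omega> \<in> A N")
        case True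
        then show ?thesis using m_mono[of N' "\<theta> d \<omega>"] by (auto simp: A_def Suc mS[of N' \<omega>] max_def split: if_splits)
      next
        case False
        then show ?thesis using w m_nonneg[of N \<omega>] m_nonneg[of N "\<theta> d \<omega>"] by (simp add: A_def)
      qed
    qed (use I integrable_flow[OF m_int, of N d] m_int[of N] in simp_all)
    \<comment> \<open>As \<open>g\<close> is nonnegative, the indicator may be dropped from its
      part, which leaves a bound by the integral of \<open>g\<close> over the whole space.\<close>
    also have "\<dots> \<le> (\<integral>\<omega>. g \<omega> - a * indicator (A N) \<omega> \<partial>M)"
    proof (rule integral_mono[OF I])
      show "integrable M (\<lambda>\<omega>. g \<omega> - a * indicator (A N) \<omega>)"
        by (rule Bochner_Integration.integrable_diff[OF g(1) ind])
    qed (use g(2) in \<open>auto simp: indicator_def\<close>)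
    also have "\<dots> = (\<integral>\<omega>. g \<omega> \<partial>M) - a * measure M (A N)"
      by (subst Bochner_Integration.integral_diff[OF g(1) ind]) simp
    finally show ?thesis using a by (simp add: field_simps)
  qed
  have inc: "incseq A"
    by (rule incseq_SucI) (use m_mono in \<open>auto simp: A_def intro: less_le_trans\<close>)
  have "(\<lambda>N. measure M (A N)) \<longlonglongrightarrow> measure M (\<Union>N. A N)"
    by (rule finite_Lim_measure_incseq) (use inc in auto)
  then have 1: "measure M (\<Union>N. A N) \<le> (\<integral>\<omega>. g \<omega> \<partial>M) / a"
    by (rule LIMSEQ_le_const2) (use A_le in blast)
  have 2: "(\<Sum>k<n. g (\<theta> (d * real k) \<omega>)) \<le> a * real n"
    if w: "\<omega> \<in> space M" "\<omega> \<notin> (\<Union>N. A N)" for \<omega> n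
  proof -
    have "m n \<omega> \<le> 0" using w by (auto simp: A_def not_less)
    then show ?thesis using sum_le[OF w(1), of n] by linarith
  qed
  show ?thesis by (rule that[OF _ 1 2]) auto
qed

end

text \<open>Along a block of \<open>m\<close> times, either the sequence \<open>f\<close> returns below the level \<open>K\<close>, and then
  \<open>f 0\<close> is controlled by the increments up to the first return, or all \<open>m\<close> times count.\<close>

lemma first_return_bound:
  fixes f g :: "nat \<Rightarrow> real"
  assumes "\<And>k. f k \<le> f (Suc k) + g k" "\<And>k. 0 \<le> g k"
  shows "f 0 \<le> K + (\<Sum>k<m. if K < f k then g k + 1 else 0) \<or>
         real m \<le> (\<Sum>k<m. if K < f k then g k + 1 else 0)"
  using assms
proof (induction m arbitrary: f g)
  case 0 show ?case by simp
next
  case (Suc m)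
  define h where "h k = (if K < f k then g k + 1 else 0)" for k
  have h: "0 \<le> h k" for k using Suc.prems(2)[of k] by (simp add: h_def)
  have s: "(\<Sum>k<Suc m. h k) = h 0 + (\<Sum>k<m. h (Suc k))" by (rule sum.lessThan_Suc_shift)
  have nn: "0 \<le> (\<Sum>k<m. h (Suc k))" by (intro sum_nonneg h)
  have IH: "f (Suc 0) \<le> K + (\<Sum>k<m. h (Suc k)) \<or> real m \<le> (\<Sum>k<m. h (Suc k))"
    using Suc.IH[of "\<lambda>k. f (Suc k)" "\<lambda>k. g (Suc k)"] Suc.prems by (simp add: h_def)
  have "f 0 \<le> K + (\<Sum>k<Suc m. h k) \<or> real (Suc m) \<le> (\<Sum>k<Suc m. h k)"
  proof (cases "K < f 0")
    case True
    then have "h 0 = g 0 + 1" by (simp add: h_def)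
    then show ?thesis unfolding s using IH Suc.prems(1)[of 0] Suc.prems(2)[of 0] by linarith
  next
    case False
    then show ?thesis unfolding s using nn h[of 0] by linarith
  qed
  then show ?case by (simp only: h_def)
qed

section \<open>Sublinear growth along almost every orbit\<close>

context metric_dynamical_system
begin

text \<open>Each value of \<open>f\<close> is finite, so the sets where \<open>f\<close> exceeds
  \<open>n\<close> shrink to nothing and dominated convergence applies with
  \<open>\<bar>g\<bar>\<close> as majorant. Finiteness of \<open>f\<close> stands in here for
  integrability.\<close>

lemma small_tail_integral:
  fixes f g :: "'w \<Rightarrow> real"
  assumes [measurable]: "f \<in> borel_measurable M" and g: "integrable M g" and e: "0 < e"
  obtains K where "(\<integral>\<omega>. (if K < f \<omega> then g \<omega> else 0) \<partial>M) \<le> e"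
proof -
  have [measurable]: "g \<in> borel_measurable M" using g by auto
  have "(\<lambda>n. \<integral>\<omega>. (if real n < f \<omega> then g \<omega> else 0) \<partial>M) \<longlonglongrightarrow> (\<integral>\<omega>. 0 \<partial>M)"
  proof (rule integral_dominated_convergence[where w = "\<lambda>\<omega>. \<bar>g \<omega>\<bar>"])
    show "AE \<omega> in M. (\<lambda>n. if real n < f \<omega> then g \<omega> else 0) \<longlonglongrightarrow> 0"
    proof (rule AE_I2, rule tendsto_eventually)
      fix \<omega>
      show "\<forall>\<^sub>F n in sequentially. (if real n < f \<omega> then g \<omega> else 0) = 0"
        using eventually_ge_at_top[of "nat \<lceil>f \<omega>\<rceil>"] by eventually_elim (auto simp: not_less nat_le_iff ceiling_le_iff)
    qed
  qed (use g in auto)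
  then have "\<forall>\<^sub>F n in sequentially. (\<integral>\<omega>. (if real n < f \<omega> then g \<omega> else 0) \<partial>M) < e"
    using e by (intro order_tendstoD) auto
  then obtain n where "(\<integral>\<omega>. (if real n < f \<omega> then g \<omega> else 0) \<partial>M) < e"
    by (auto simp: eventually_sequentially)
  then show ?thesis by (intro that[of "real n"]) simp
qed

text \<open>\<open>P\<close> may be non-measurable, which is why its exceptions are enclosed in
  measurable sets. Taking bounds \<open>1 / (n + 1)\<close>, the intersection of the enclosures is a
  null set.\<close>

lemma AE_of_small_exceptions:
  assumes "\<And>e. 0 < e \<Longrightarrow> \<exists>B\<in>sets M. measure M B \<le> e \<and> (\<forall>\<omega>\<in>space M - B. P \<omega>)"
  shows "AE \<omega> in M. P \<omega>"
proof -
  have "\<forall>n. \<exists>B. B \<in> sets M \<and> measure M B \<le> 1 / real (Suc n) \<and> (\<forall>\<omega>\<in>space M - B. P \<omega>)"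
    using assms[of "1 / real (Suc _)"] by (auto simp: Bex_def)
  then obtain B where B: "\<And>n. B n \<in> sets M" "\<And>n. measure M (B n) \<le> 1 / real (Suc n)"
      "\<And>n \<omega>. \<omega> \<in> space M - B n \<Longrightarrow> P \<omega>" by metis
  have "measure M (\<Inter>n. B n) \<le> 1 / real (Suc n)" for n
    by (rule order_trans[OF finite_measure_mono B(2)]) (use B in auto)
  then have "(\<lambda>n. measure M (\<Inter>n. B n)) \<longlonglongrightarrow> 0"
    by (intro tendsto_sandwich[OF _ _ tendsto_const LIMSEQ_Suc[OF lim_1_over_n]]) auto
  then have "measure M (\<Inter>n. B n) = 0" by (simp add: LIMSEQ_const_iff)
  then have "(\<Inter>n. B n) \<in> null_sets M" using B(1) by (intro null_setsI) (auto simp: emeasure_eq_measure)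
  then show ?thesis by (rule AE_I') (use B(3) in auto)
qed

text \<open>Replacing \<open>g\<close> by \<open>(g + 1) 1\<^bsub>{f > K}\<^esub>\<close>, whose integral is small, the maximal inequality
  bounds both the time until \<open>f\<close> next falls below \<open>K\<close> and the growth of \<open>f\<close> until then.\<close>

lemma sublinear_along_orbits:
  fixes f g :: "'w \<Rightarrow> real"
  assumes f [measurable]: "f \<in> borel_measurable M"
    and g: "integrable M g" "\<And>\<omega>. 0 \<le> g \<omega>"
    and le: "AE \<omega> in M. f \<omega> \<le> f (\<theta> 1 \<omega>) + g \<omega>"
  shows "AE \<omega> in M. \<forall>e>0. \<exists>K. \<forall>n::int. f (\<theta> (of_int n) \<omega>) \<le> K + e * \<bar>of_int n\<bar>"
proof -
  \<comment> \<open>The factor 2 comes from positive times: the block from \<open>n\<close> to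
    \<open>2 n\<close> is estimated through the sum over all times from 0 to
    \<open>2 n\<close>.\<close>
  define P where "P e \<omega> \<longleftrightarrow> (\<exists>K. \<forall>n::int. f (\<theta> (of_int n) \<omega>) \<le> K + 2 * e * \<bar>of_int n\<bar>)" for e :: real and \<omega>
  have main: "AE \<omega> in M. P e \<omega>" if e: "0 < e" "e \<le> 1/2" for e
  proof -
    have le': "AE \<omega> in M. \<forall>n::int. f (\<theta> (of_int n) \<omega>) \<le> f (\<theta> 1 (\<theta> (of_int n) \<omega>)) + g (\<theta> (of_int n) \<omega>)"
      by (rule AE_flow_int[OF le])
    have "AE \<omega> in M. (\<forall>n::int. f (\<theta> (of_int n) \<omega>) \<le> f (\<theta> 1 (\<theta> (of_int n) \<omega>)) + g (\<theta> (of_int n) \<omega>)) \<longrightarrow> P e \<omega>"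
    proof (rule AE_of_small_exceptions)
      fix \<eta> :: real assume \<eta>: "0 < \<eta>"
      \<comment> \<open>With threshold \<open>e\<close> in the maximal inequality, this integral
        leaves an exceptional set of measure at most \<open>\<eta> / 2\<close> for each of the two
        directions of time.\<close>
      obtain K where K: "(\<integral>\<omega>. (if K < f \<omega> then g \<omega> + 1 else 0) \<partial>M) \<le> e * \<eta> / 2"
        using small_tail_integral[OF f, of "\<lambda>\<omega>. g \<omega> + 1" "e * \<eta> / 2"] g(1) e \<eta> by auto
      define h where "h \<omega> = (if K < f \<omega> then g \<omega> + 1 else 0)" for \<omega>
      have [measurable]: "g \<in> borel_measurable M" using g by auto
      have h: "integrable M h" unfolding h_def
        by (rule Bochner_Integration.integrable_bound[where f = "\<lambda>\<omega>. g \<omega> + 1"]) (use g in auto)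
      have h0: "0 \<le> h \<omega>" for \<omega> using g(2)[of \<omega>] by (simp add: h_def)
      have hi: "(\<integral>\<omega>. h \<omega> \<partial>M) / e \<le> \<eta> / 2" using K e by (simp add: h_def field_simps)
      obtain B1 where B1: "B1 \<in> sets M" "measure M B1 \<le> \<eta> / 2"
          "\<And>\<omega> n. \<omega> \<in> space M \<Longrightarrow> \<omega> \<notin> B1 \<Longrightarrow> (\<Sum>k<n. h (\<theta> (1 * real k) \<omega>)) \<le> e * real n"
        using maximal_inequality[OF h h0 e(1), of 1] hi by (metis order_trans)
      obtain B2 where B2: "B2 \<in> sets M" "measure M B2 \<le> \<eta> / 2"
          "\<And>\<omega> n. \<omega> \<in> space M \<Longrightarrow> \<omega> \<notin> B2 \<Longrightarrow> (\<Sum>k<n. h (\<theta> (-1 * real k) \<omega>)) \<le> e * real n"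
        using maximal_inequality[OF h h0 e(1), of "-1"] hi by (metis order_trans)
      show "\<exists>B\<in>sets M. measure M B \<le> \<eta> \<and> (\<forall>\<omega>\<in>space M - B.
          (\<forall>n::int. f (\<theta> (of_int n) \<omega>) \<le> f (\<theta> 1 (\<theta> (of_int n) \<omega>)) + g (\<theta> (of_int n) \<omega>)) \<longrightarrow> P e \<omega>)"
      proof (intro bexI conjI ballI impI)
        show "B1 \<union> B2 \<in> sets M" using B1 B2 by auto
        show "measure M (B1 \<union> B2) \<le> \<eta>" using measure_Un_le[OF B1(1) B2(1)] B1(2) B2(2) by simp
        fix \<omega> assume w: "\<omega> \<in> space M - (B1 \<union> B2)"
          and step: "\<forall>n::int. f (\<theta> (of_int n) \<omega>) \<le> f (\<theta> 1 (\<theta> (of_int n) \<omega>)) + g (\<theta> (of_int n) \<omega>)"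
        have sp: "\<omega> \<in> space M" using w by simp
        have step': "f (\<theta> (of_int n) \<omega>) \<le> f (\<theta> (of_int (n + 1)) \<omega>) + g (\<theta> (of_int n) \<omega>)" for n :: int
          using step[rule_format, of n] flow_add[OF sp, of 1 "of_int n"] by (simp add: add.commute)
        have fwd: "(\<Sum>k<n. h (\<theta> (real k) \<omega>)) \<le> e * real n" for n using B1(3)[OF sp, of n] w by simp
        have bwd: "(\<Sum>k<n. h (\<theta> (- real k) \<omega>)) \<le> e * real n" for n using B2(3)[OF sp, of n] w by simp
        \<comment> \<open>The condition \<open>e * real q < real m\<close> rules out the second
          alternative of \<open>first_return_bound\<close>, so \<open>f\<close> falls to
          \<open>K\<close> or below within the block of length \<open>m\<close> from time
          \<open>p\<close>.\<close>
        have block: "f (\<theta> (of_int p) \<omega>) \<le> K + e * real q"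
          if q: "(\<Sum>k<m. h (\<theta> (of_int (p + int k)) \<omega>)) \<le> e * real q" "e * real q < real m" for p m q
        proof -
          have "f (\<theta> (of_int (p + int k)) \<omega>) \<le> f (\<theta> (of_int (p + int (Suc k))) \<omega>) + g (\<theta> (of_int (p + int k)) \<omega>)" for k
            using step'[of "p + int k"] by (simp add: algebra_simps)
          from first_return_bound[of "\<lambda>k. f (\<theta> (of_int (p + int k)) \<omega>)", OF this g(2), of K m]
          show ?thesis using q unfolding h_def of_nat_0 add_0_right by linarith
        qed
        have "f (\<theta> (of_int p) \<omega>) \<le> \<bar>K\<bar> + e + 2 * e * \<bar>of_int p\<bar>" for p :: int
        proof (cases "0 \<le> p")
          case True
          then obtain n where p: "p = int n" using nonneg_int_cases by blast
          have "(\<Sum>k<Suc n. h (\<theta> (of_int (p + int k)) \<omega>)) = (\<Sum>k\<in>{n..<2*n+1}. h (\<theta> (real k) \<omega>))"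
            by (rule sum.reindex_bij_witness[of _ "\<lambda>k. k - n" "\<lambda>k. k + n"]) (auto simp: p algebra_simps)
          also have "\<dots> \<le> (\<Sum>k<2*n+1. h (\<theta> (real k) \<omega>))"
            by (rule sum_mono2) (auto simp: h0)
          also have "\<dots> \<le> e * real (2*n+1)" by (rule fwd)
          finally have 1: "(\<Sum>k<Suc n. h (\<theta> (of_int (p + int k)) \<omega>)) \<le> e * real (2*n+1)" .
          \<comment> \<open>This is where \<open>e \<le> 1/2\<close> enters:
            \<open>e (2 n + 1)\<close> stays below the block length \<open>n + 1\<close>.\<close>
          have "e * real (2*n+1) \<le> 1/2 * real (2*n+1)" by (rule mult_right_mono) (use e in auto)
          also have "\<dots> < real (Suc n)" by simp
          finally have 2: "e * real (2*n+1) < real (Suc n)" .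
          show ?thesis using block[OF 1 2] by (simp add: p algebra_simps)
        next
          case False
          then obtain n where p: "p = - int n" by (metis int_cases2 of_nat_0_le_iff)
          \<comment> \<open>The block from \<open>-n\<close> to 0 is read backwards from time 0, so
            the maximal inequality for the reversed flow applies.\<close>
          have "(\<Sum>k<Suc n. h (\<theta> (of_int (p + int k)) \<omega>)) = (\<Sum>k<Suc n. h (\<theta> (- real k) \<omega>))"
            by (rule sum.reindex_bij_witness[of _ "\<lambda>k. n - k" "\<lambda>k. n - k"]) (auto simp: p of_nat_diff)
          then have 1: "(\<Sum>k<Suc n. h (\<theta> (of_int (p + int k)) \<omega>)) \<le> e * real (Suc n)"
            using bwd[of "Suc n"] by simp
          have "e * real (Suc n) \<le> 1/2 * real (Suc n)" by (rule mult_right_mono) (use e in auto)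
          also have "\<dots> < real (Suc n)" by simp
          finally have 2: "e * real (Suc n) < real (Suc n)" .
          have "0 \<le> e * real n" using e by simp
          then show ?thesis using block[OF 1 2] by (simp add: p algebra_simps)
        qed
        then show "P e \<omega>" unfolding P_def by blast
      qed
    qed
    with le' show ?thesis by eventually_elim blast
  qed
  \<comment> \<open>Countably many rates suffice to intersect null sets, and these all satisfy the
    restriction \<open>e \<le> 1/2\<close>.\<close>
  have "AE \<omega> in M. \<forall>m::nat. P (1 / real (m + 2)) \<omega>"
    by (subst AE_all_countable) (auto intro!: main simp: field_simps)
  then show ?thesis
  proof eventually_elim
    case (elim \<omega>)
    show ?case
    proof (intro allI impI)
      fix e :: real assume e: "0 < e"
      obtain m where m: "inverse (real (Suc m)) < e / 2" using reals_Archimedean[of "e/2"] e by auto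
      have "1 / real (m + 2) \<le> inverse (real (Suc m))" by (simp add: field_simps)
      then have m': "2 * (1 / real (m + 2)) \<le> e" using m by linarith
      obtain K where K: "\<And>n::int. f (\<theta> (of_int n) \<omega>) \<le> K + 2 * (1 / real (m + 2)) * \<bar>of_int n\<bar>"
        using elim unfolding P_def by blast
      have "K + 2 * (1 / real (m + 2)) * \<bar>of_int n\<bar> \<le> K + e * \<bar>of_int n\<bar>" for n :: int
        by (intro add_left_mono mult_right_mono m') auto
      then show "\<exists>K. \<forall>n::int. f (\<theta> (of_int n) \<omega>) \<le> K + e * \<bar>of_int n\<bar>"
        using K order_trans by blast
    qed
  qed
qed

end

section \<open>Growth rates\<close>

lemma ln_ext_mono: "x \<le> y \<Longrightarrow> ln_ext x \<le> ln_ext y"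
  by (auto simp: ln_ext_def)

lemma ln_ext_cmult: "0 < c \<Longrightarrow> ln_ext (c * x) = ereal (ln c) + ln_ext x"
  by (auto simp: ln_ext_def mult_le_0_iff ln_mult_pos)

text \<open>The prefactors differ by \<open>1 + a / t\<close>. Its limit 1 is finite and nonzero, so
  the product converges in \<open>ereal\<close> for infinite \<open>l\<close> too, as clause (vi) of
  case (O1) requires.\<close>

lemma growth_rate_shift:
  assumes F: "F \<le> at_infinity" "filterlim (\<lambda>t. t + a) F F"
    and l: "(growth_rate r \<longlongrightarrow> l) F"
  shows "(growth_rate (\<lambda>t. r (t + a)) \<longlongrightarrow> l) F"
proof -
  have inv: "((\<lambda>t::real. a / t) \<longlongrightarrow> 0) F"
    by (rule tendsto_mono[OF F(1)]) (rule tendsto_divide_0[OF tendsto_const filterlim_ident])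
  have 1: "((\<lambda>t. ereal (1 + a / t)) \<longlongrightarrow> ereal (1 + 0)) F"
    by (intro tendsto_ereal tendsto_add tendsto_const inv)
  have 2: "((\<lambda>t. growth_rate r (t + a)) \<longlongrightarrow> l) F"
    by (rule filterlim_compose[OF l F(2)])
  have "((\<lambda>t. ereal (1 + a / t) * growth_rate r (t + a)) \<longlongrightarrow> ereal (1 + 0) * l) F"
    by (intro tendsto_mult_ereal 1 2) auto
  moreover have "\<forall>\<^sub>F t in at_infinity. \<bar>a\<bar> < norm (t::real)"
    by (rule eventually_at_infinityI[where c = "\<bar>a\<bar> + 1"]) simp
  then have "\<forall>\<^sub>F t in F. \<bar>a\<bar> < norm t" using F(1) by (auto simp: le_filter_def)
  then have "\<forall>\<^sub>F t in F. ereal (1 + a / t) * growth_rate r (t + a) = growth_rate (\<lambda>t. r (t + a)) t"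
  proof eventually_elim
    case (elim t)
    then have "t \<noteq> 0" "t + a \<noteq> 0" by auto
    then have "(1 + a / t) * (1 / (t + a)) = 1 / t" by (simp add: field_simps)
    then show ?case by (simp add: growth_rate_def flip: mult.assoc)
  qed
  ultimately show ?thesis by (simp add: filterlim_cong)
qed

lemma growth_rate_cmult:
  assumes F: "F \<le> at_infinity" and c: "0 < c" and l: "(growth_rate r \<longlongrightarrow> l) F"
  shows "(growth_rate (\<lambda>t. c * r t) \<longlongrightarrow> l) F"
proof -
  have inv: "((\<lambda>t::real. ln c / t) \<longlongrightarrow> 0) F"
    by (rule tendsto_mono[OF F(1)]) (rule tendsto_divide_0[OF tendsto_const filterlim_ident])
  have "((\<lambda>t. ereal (ln c / t) + growth_rate r t) \<longlongrightarrow> ereal 0 + l) F"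
    by (intro tendsto_add_ereal_general tendsto_ereal inv l) auto
  moreover have "ereal (ln c / t) + growth_rate r t = growth_rate (\<lambda>t. c * r t) t" for t
  proof -
    have "ereal (1 / t) * (ereal (ln c) + ln_ext (r t)) = ereal (1 / t) * ereal (ln c) + ereal (1 / t) * ln_ext (r t)"
      by (cases "ln_ext (r t)") (auto simp: algebra_simps)
    then show ?thesis by (simp add: growth_rate_def ln_ext_cmult[OF c])
  qed
  ultimately show ?thesis by simp
qed

text \<open>Shifts and constants account for the one time unit and the bounded factor that a
  smoothing step costs. \<open>f\<close> and \<open>g\<close> are kept apart because the two
  comparisons may start at different base points.\<close>

lemma growth_rate_sandwich_at_top:
  assumes "(growth_rate f \<longlongrightarrow> l) at_top" "(growth_rate g \<longlongrightarrow> l) at_top"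
    and c: "0 < c" "0 < d"
    and le: "\<And>t. T \<le> t \<Longrightarrow> f (t + a) \<le> c * r t" "\<And>t. T \<le> t \<Longrightarrow> r t \<le> d * g (t + b)"
  shows "(growth_rate r \<longlongrightarrow> l) at_top"
proof (rule tendsto_sandwich[where f = "growth_rate (\<lambda>t. inverse c * f (t + a))"
      and h = "growth_rate (\<lambda>t. d * g (t + b))"])
  have sh: "filterlim (\<lambda>t::real. t + a) at_top at_top" for a
    using filterlim_tendsto_add_at_top[OF tendsto_const[of a] filterlim_ident] by (simp add: add.commute)
  show "(growth_rate (\<lambda>t. d * g (t + b)) \<longlongrightarrow> l) at_top"
    by (intro growth_rate_cmult growth_rate_shift at_top_le_at_infinity assms sh)
  show "(growth_rate (\<lambda>t. inverse c * f (t + a)) \<longlongrightarrow> l) at_top"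
    by (intro growth_rate_cmult growth_rate_shift at_top_le_at_infinity assms sh) (use c in simp)
  have "\<forall>\<^sub>F t in at_top. max T 1 \<le> t" by (rule eventually_ge_at_top)
  then show "\<forall>\<^sub>F t in at_top. growth_rate r t \<le> growth_rate (\<lambda>t. d * g (t + b)) t"
    by eventually_elim (auto simp: growth_rate_def intro!: ereal_mult_left_mono ln_ext_mono le)
  have "\<forall>\<^sub>F t in at_top. max T 1 \<le> t" by (rule eventually_ge_at_top)
  then show "\<forall>\<^sub>F t in at_top. growth_rate (\<lambda>t. inverse c * f (t + a)) t \<le> growth_rate r t"
  proof eventually_elim
    case (elim t)
    then have "inverse c * f (t + a) \<le> r t" using le(1)[of t] c by (simp add: field_simps)
    then show ?case unfolding growth_rate_def
      by (intro ereal_mult_left_mono ln_ext_mono) (use elim in auto)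
  qed
qed

text \<open>For negative \<open>t\<close> the prefactor \<open>1 / t\<close> reverses inequalities,
  so the upper bound on \<open>r\<close> yields the lower bound on its rate and conversely.\<close>

lemma growth_rate_sandwich_at_bot:
  assumes "(growth_rate f \<longlongrightarrow> l) at_bot" "(growth_rate g \<longlongrightarrow> l) at_bot"
    and c: "0 < c" "0 < d"
    and le: "\<And>t. t \<le> T \<Longrightarrow> f (t + a) \<le> c * r t" "\<And>t. t \<le> T \<Longrightarrow> r t \<le> d * g (t + b)"
  shows "(growth_rate r \<longlongrightarrow> l) at_bot"
proof (rule tendsto_sandwich[where h = "growth_rate (\<lambda>t. inverse c * f (t + a))"
      and f = "growth_rate (\<lambda>t. d * g (t + b))"])
  have sh: "filterlim (\<lambda>t::real. t + a) at_bot at_bot" for a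
    using filterlim_tendsto_add_at_bot_iff[OF tendsto_const[of a], of "\<lambda>t. t" at_bot] filterlim_ident
    by (simp add: add.commute)
  have anti: "growth_rate r t \<le> growth_rate r' t" if "t < 0" "r' t \<le> r t" for r r' t
  proof -
    have "ereal (- (1 / t)) * ln_ext (r' t) \<le> ereal (- (1 / t)) * ln_ext (r t)"
      using that by (intro ereal_mult_left_mono ln_ext_mono) (auto simp: divide_nonneg_neg)
    then show ?thesis unfolding growth_rate_def
      by (cases "ln_ext (r t)"; cases "ln_ext (r' t)") (use that in \<open>auto split: if_splits\<close>)
  qed
  show "(growth_rate (\<lambda>t. d * g (t + b)) \<longlongrightarrow> l) at_bot"
    by (intro growth_rate_cmult growth_rate_shift at_bot_le_at_infinity assms sh)
  show "(growth_rate (\<lambda>t. inverse c * f (t + a)) \<longlongrightarrow> l) at_bot"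
    by (intro growth_rate_cmult growth_rate_shift at_bot_le_at_infinity assms sh) (use c in simp)
  have ev: "\<forall>\<^sub>F t in at_bot. t \<le> min T (-1)" by (rule eventually_le_at_bot)
  from ev show "\<forall>\<^sub>F t in at_bot. growth_rate (\<lambda>t. d * g (t + b)) t \<le> growth_rate r t"
    by eventually_elim (rule anti, auto intro: le)
  from ev show "\<forall>\<^sub>F t in at_bot. growth_rate r t \<le> growth_rate (\<lambda>t. inverse c * f (t + a)) t"
    by eventually_elim (rule anti, use c le(1) in \<open>auto simp: field_simps\<close>)
qed

text \<open>For negative \<open>t\<close>, a rate above \<open>m\<close> means
  \<open>ln (r t) < m * t\<close>: a lower bound on the rate is an upper bound on the size. The gap
  \<open>m < l\<close> turns the limit into an eventual inequality.\<close>

lemma growth_rate_at_bot_bound: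
  assumes "(growth_rate r \<longlongrightarrow> ereal l) at_bot" "m < l"
  obtains K where "\<And>n::nat. r (- real n) \<le> K * exp (- m * real n)" "0 \<le> K"
proof -
  have "\<forall>\<^sub>F t in at_bot. ereal m < growth_rate r t"
    using assms by (intro order_tendstoD) auto
  then obtain T where T: "\<And>t. t \<le> T \<Longrightarrow> ereal m < growth_rate r t"
    by (auto simp: eventually_at_bot_linorder)
  have far: "r t \<le> exp (m * t)" if "t \<le> min T (-1)" for t
  proof (cases "r t \<le> 0")
    case False
    then have "m < ln (r t) / t" using T[of t] that by (simp add: growth_rate_def ln_ext_def)
    then have "ln (r t) \<le> m * t" using that by (simp add: field_simps)
    then show ?thesis using False by (metis exp_le_cancel_iff exp_ln not_le)
  next
    case True
    then show ?thesis using exp_gt_zero[of "m * t"] by linarith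
  qed
  obtain N where N: "\<bar>min T (-1)\<bar> \<le> real N" using real_arch_simple by blast
  \<comment> \<open>The sum absorbs the finitely many \<open>n\<close> before the eventual bound
    starts; the summand 1 gives \<open>1 \<le> K\<close> for the others.\<close>
  define K where "K = 1 + (\<Sum>n<N. \<bar>r (- real n)\<bar> * exp (m * real n))"
  have K: "1 \<le> K" unfolding K_def by (simp add: sum_nonneg)
  have "r (- real n) \<le> K * exp (- m * real n)" for n
  proof (cases "n < N")
    case True
    have "\<bar>r (- real n)\<bar> * exp (m * real n) \<le> (\<Sum>n<N. \<bar>r (- real n)\<bar> * exp (m * real n))"
      by (rule member_le_sum) (use True in auto)
    then have "\<bar>r (- real n)\<bar> * exp (m * real n) \<le> K" by (simp add: K_def)
    then have "\<bar>r (- real n)\<bar> \<le> K * exp (- m * real n)" by (simp add: exp_minus field_simps)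
    then show ?thesis by simp
  next
    case False
    then have "r (- real n) \<le> exp (m * - real n)" using N by (intro far) auto
    also have "\<dots> \<le> K * exp (- m * real n)" using K by simp
    finally show ?thesis .
  qed
  with K show ?thesis by (intro that[of K]) auto
qed

text \<open>A zero of \<open>r\<close> at a positive time has rate \<open>-\<infinity>\<close>,
  which a finite limit excludes at late times.\<close>

lemma growth_rate_nonzero:
  assumes "(growth_rate r \<longlongrightarrow> ereal l) at_top"
  obtains T where "\<And>t. T \<le> t \<Longrightarrow> r t \<noteq> 0"
proof -
  have "\<forall>\<^sub>F t in at_top. ereal (l - 1) < growth_rate r t"
    using assms by (intro order_tendstoD) auto
  moreover have "\<forall>\<^sub>F t::real in at_top. 0 < t" by (rule eventually_gt_at_top)
  ultimately have "\<forall>\<^sub>F t in at_top. r t \<noteq> 0"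
    by eventually_elim (auto simp: growth_rate_def ln_ext_def)
  then show ?thesis using that by (auto simp: eventually_at_top_linorder)
qed

text \<open>For \<open>r \<ge> 1\<close> this says that \<open>ln (r t) / t\<close> tends to 0 in both directions.\<close>

definition subexponential :: "(real \<Rightarrow> real) \<Rightarrow> bool"
  where "subexponential r \<longleftrightarrow> (\<forall>e>0. \<forall>\<^sub>F t in at_infinity. r t \<le> exp (e * \<bar>t\<bar>))"

lemma subexponential_mono: "subexponential r \<Longrightarrow> (\<And>t. s t \<le> r t) \<Longrightarrow> subexponential s"
  unfolding subexponential_def by (fast elim!: eventually_mono intro: order_trans)

lemma subexponential_const: "subexponential (\<lambda>_. c)"
  unfolding subexponential_def
proof (intro allI impI)
  fix e :: real assume e: "0 < e"
  show "\<forall>\<^sub>F t::real in at_infinity. c \<le> exp (e * \<bar>t\<bar>)"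
  proof (rule eventually_at_infinityI[where c = "\<bar>c\<bar> / e"])
    fix t :: real assume "\<bar>c\<bar> / e \<le> norm t"
    then have "c \<le> e * \<bar>t\<bar>" using e by (simp add: field_simps abs_le_iff)
    also have "\<dots> \<le> exp (e * \<bar>t\<bar>)" using exp_ge_add_one_self[of "e * \<bar>t\<bar>"] by linarith
    finally show "c \<le> exp (e * \<bar>t\<bar>)" .
  qed
qed

lemma subexponential_mult:
  assumes "subexponential r" "subexponential s" "\<And>t. 0 \<le> r t" "\<And>t. 0 \<le> s t"
  shows "subexponential (\<lambda>t. r t * s t)"
  unfolding subexponential_def
proof (intro allI impI)
  fix e :: real assume e: "0 < e"
  have "\<forall>\<^sub>F t in at_infinity. r t \<le> exp (e/2 * \<bar>t\<bar>)" "\<forall>\<^sub>F t in at_infinity. s t \<le> exp (e/2 * \<bar>t\<bar>)"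
    using assms(1,2) half_gt_zero[OF e] unfolding subexponential_def by blast+
  then show "\<forall>\<^sub>F t in at_infinity. r t * s t \<le> exp (e * \<bar>t\<bar>)"
  proof eventually_elim
    case (elim t)
    then have "r t * s t \<le> exp (e/2 * \<bar>t\<bar>) * exp (e/2 * \<bar>t\<bar>)"
      by (intro mult_mono assms) auto
    then show ?case by (simp flip: exp_add)
  qed
qed

lemma subexponential_add:
  assumes "subexponential r" "subexponential s"
  shows "subexponential (\<lambda>t. r t + s t)"
  unfolding subexponential_def
proof (intro allI impI)
  fix e :: real assume e: "0 < e"
  have "\<forall>\<^sub>F t in at_infinity. r t \<le> exp (e/2 * \<bar>t\<bar>)" "\<forall>\<^sub>F t in at_infinity. s t \<le> exp (e/2 * \<bar>t\<bar>)"
    "\<forall>\<^sub>F t::real in at_infinity. 2 \<le> exp (e/2 * \<bar>t\<bar>)"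
    using assms subexponential_const[of 2] half_gt_zero[OF e] unfolding subexponential_def by blast+
  then show "\<forall>\<^sub>F t in at_infinity. r t + s t \<le> exp (e * \<bar>t\<bar>)"
  proof eventually_elim
    case (elim t)
    then have "r t + s t \<le> 2 * exp (e/2 * \<bar>t\<bar>)" by simp
    also have "\<dots> \<le> exp (e/2 * \<bar>t\<bar>) * exp (e/2 * \<bar>t\<bar>)"
      by (intro mult_right_mono elim) auto
    finally show ?case by (simp flip: exp_add)
  qed
qed

lemma subexponential_sum:
  "(\<And>i. i \<in> I \<Longrightarrow> subexponential (r i)) \<Longrightarrow> subexponential (\<lambda>t. \<Sum>i\<in>I. r i t)"
  by (induction I rule: infinite_finite_induct) (simp_all add: subexponential_const subexponential_add)

text \<open>Rounding \<open>t\<close> and shifting by \<open>c\<close> change the bound by a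
  constant; half of the rate \<open>e\<close> is reserved to absorb it.\<close>

lemma subexponential_floor:
  assumes "\<forall>e>0. \<exists>K. \<forall>n::int. f n \<le> K + e * \<bar>of_int n\<bar>"
  shows "subexponential (\<lambda>t. exp (f (\<lfloor>t\<rfloor> + c)))"
  unfolding subexponential_def
proof (intro allI impI)
  fix e :: real assume e: "0 < e"
  obtain K where K: "\<And>n::int. f n \<le> K + e/2 * \<bar>of_int n\<bar>" using assms e half_gt_zero by blast
  define K' where "K' = K + e/2 * (1 + \<bar>of_int c\<bar>)"
  have le: "f (\<lfloor>t\<rfloor> + c) \<le> K' + e/2 * \<bar>t\<bar>" for t :: real
  proof -
    have "\<bar>of_int (\<lfloor>t\<rfloor> + c)\<bar> \<le> \<bar>t\<bar> + 1 + \<bar>of_int c :: real\<bar>" by linarith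
    then have "e/2 * \<bar>of_int (\<lfloor>t\<rfloor> + c)\<bar> \<le> e/2 * (\<bar>t\<bar> + 1 + \<bar>of_int c :: real\<bar>)"
      using e by (intro mult_left_mono) auto
    with K[of "\<lfloor>t\<rfloor> + c"] show ?thesis by (simp add: K'_def add_divide_distrib algebra_simps)
  qed
  have "subexponential (\<lambda>_. exp K')" by (rule subexponential_const)
  then have "\<forall>\<^sub>F t in at_infinity. exp K' \<le> exp (e/2 * \<bar>t\<bar>)" using half_gt_zero[OF e] unfolding subexponential_def by blast
  then show "\<forall>\<^sub>F t in at_infinity. exp (f (\<lfloor>t\<rfloor> + c)) \<le> exp (e * \<bar>t\<bar>)"
  proof eventually_elim
    case (elim t)
    have "f (\<lfloor>t\<rfloor> + c) \<le> e * \<bar>t\<bar>" using le[of t] elim by simp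
    then show ?case by simp
  qed
qed

lemma tendsto_at_infinity_iff:
  "(f \<longlongrightarrow> l) (at_infinity :: real filter) \<longleftrightarrow> (f \<longlongrightarrow> l) at_top \<and> (f \<longlongrightarrow> l) at_bot"
  by (simp add: at_infinity_eq_at_top_bot filterlim_def filtermap_sup)

lemma subexponential_of_tempered:
  assumes "((\<lambda>t. 1 / t * ln (r t)) \<longlongrightarrow> 0) at_infinity"
  shows "subexponential r"
  unfolding subexponential_def
proof (intro allI impI)
  fix e :: real assume e: "0 < e"
  have "\<forall>\<^sub>F t in at_infinity. \<bar>1 / t * ln (r t)\<bar> < e" using assms e by (auto simp: tendsto_iff dist_real_def)
  moreover have "\<forall>\<^sub>F t::real in at_infinity. 1 \<le> norm t" by (rule eventually_at_infinityI) simp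
  ultimately show "\<forall>\<^sub>F t in at_infinity. r t \<le> exp (e * \<bar>t\<bar>)"
  proof eventually_elim
    case (elim t)
    show ?case
    proof (cases "r t \<le> 0")
      case False
      have "\<bar>ln (r t)\<bar> \<le> e * \<bar>t\<bar>" using elim by (simp add: abs_mult field_simps)
      then have "exp (ln (r t)) \<le> exp (e * \<bar>t\<bar>)" by (subst exp_le_cancel_iff) linarith
      then show ?thesis using False by simp
    next
      case True
      then show ?thesis using exp_gt_zero[of "e * \<bar>t\<bar>"] by linarith
    qed
  qed
qed

text \<open>The alternative makes the logarithm nonnegative (with \<open>ln 0 = 0\<close>), so an
  upper bound on \<open>r\<close> already determines the limit.\<close>

lemma tempered_of_subexponential:
  assumes "subexponential r" "\<And>t. r t = 0 \<or> 1 \<le> r t"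
  shows "((\<lambda>t. 1 / t * ln (r t)) \<longlongrightarrow> 0) at_infinity"
proof (rule tendstoI)
  fix e :: real assume e: "0 < e"
  have "\<forall>\<^sub>F t in at_infinity. r t \<le> exp (e/2 * \<bar>t\<bar>)" using assms(1) half_gt_zero[OF e] unfolding subexponential_def by blast
  moreover have "\<forall>\<^sub>F t::real in at_infinity. 1 \<le> norm t" by (rule eventually_at_infinityI) simp
  ultimately show "\<forall>\<^sub>F t in at_infinity. dist (1 / t * ln (r t)) 0 < e"
  proof eventually_elim
    case (elim t)
    show ?case
    proof (cases "r t = 0")
      case False
      then have 1: "1 \<le> r t" using assms(2)[of t] by simp
      then have "ln (r t) \<le> e/2 * \<bar>t\<bar>" using elim(1) by (metis exp_le_cancel_iff exp_ln less_le_trans zero_less_one)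
      moreover have "0 \<le> ln (r t)" "e/2 * \<bar>t\<bar> < e * \<bar>t\<bar>" using 1 elim(2) e by auto
      ultimately have "\<bar>ln (r t)\<bar> < e * \<bar>t\<bar>" by linarith
      then show ?thesis using elim(2) by (simp add: dist_real_def abs_mult field_simps)
    qed (use e in simp)
  qed
qed

section \<open>Finite-dimensional subspaces and bounded projections\<close>

text \<open>\<open>d\<close> is the radius of a ball around \<open>v\<close> that misses
  \<open>F\<close>; the point \<open>- f / c\<close> of \<open>F\<close> lies outside it, and
  scaling by \<open>c\<close> gives the estimate.\<close>

lemma dist_closed_subspace:
  fixes F :: "'a::real_normed_vector set"
  assumes "subspace F" "closed F" "v \<notin> F"
  obtains d where "0 < d" "\<And>f c. f \<in> F \<Longrightarrow> \<bar>c\<bar> * d \<le> norm (f + c *\<^sub>R v)"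
proof -
  from assms(2,3) obtain d where d: "0 < d" "ball v d \<subseteq> - F"
    by (meson ComplI open_Compl open_contains_ball_eq)
  have "\<bar>c\<bar> * d \<le> norm (f + c *\<^sub>R v)" if f: "f \<in> F" for f c
  proof (cases "c = 0")
    case False
    have "(- 1 / c) *\<^sub>R f \<in> F" using f assms(1) by (rule subspace_scale[rotated])
    then have "(- 1 / c) *\<^sub>R f \<notin> ball v d" using d(2) by blast
    then have "d \<le> norm (v + (1 / c) *\<^sub>R f)" by (simp add: dist_norm)
    then have "\<bar>c\<bar> * d \<le> \<bar>c\<bar> * norm (v + (1 / c) *\<^sub>R f)" by (intro mult_left_mono) auto
    also have "\<dots> = norm (c *\<^sub>R (v + (1 / c) *\<^sub>R f))" by simp
    also have "c *\<^sub>R (v + (1 / c) *\<^sub>R f) = f + c *\<^sub>R v" using False by (simp add: algebra_simps)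
    finally show ?thesis .
  qed simp
  with d(1) show ?thesis by (rule that)
qed

text \<open>The positive distance of \<open>v\<close> from \<open>F\<close> makes the
  \<open>v\<close>-coefficients of a convergent sequence Cauchy, so both summands converge
  separately.\<close>

lemma closed_span_insert:
  fixes F :: "'a::real_normed_vector set"
  assumes F: "subspace F" "closed F"
  shows "closed (span (insert v F))"
proof (cases "v \<in> F")
  case True
  then show ?thesis using F by (simp add: insert_absorb span_eq_iff[THEN iffD2])
next
  case False
  have span: "span (insert v F) = {x. \<exists>k. x - k *\<^sub>R v \<in> F}"
    using F(1) by (simp add: span_insert span_eq_iff[THEN iffD2])
  obtain d where d: "0 < d" "\<And>f c. f \<in> F \<Longrightarrow> \<bar>c\<bar> * d \<le> norm (f + c *\<^sub>R v)"
    using dist_closed_subspace[OF F False] by blast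
  show ?thesis unfolding closed_sequential_limits span
  proof clarify
    fix x l assume x: "\<forall>n. x n \<in> {x. \<exists>k. x - k *\<^sub>R v \<in> F}" and l: "x \<longlonglongrightarrow> l"
    then obtain c where c: "\<And>n. x n - c n *\<^sub>R v \<in> F" by (simp add: choice_iff) blast
    have "Cauchy c"
    proof (rule metric_CauchyI)
      fix e :: real assume "0 < e"
      then obtain N where N: "\<And>m n. N \<le> m \<Longrightarrow> N \<le> n \<Longrightarrow> dist (x m) (x n) < e * d"
        using LIMSEQ_imp_Cauchy[OF l] d(1) by (meson metric_CauchyD mult_pos_pos)
      have "dist (c m) (c n) < e" if "N \<le> m" "N \<le> n" for m n
      proof -
        have "\<bar>c m - c n\<bar> * d \<le> norm (((x m - c m *\<^sub>R v) - (x n - c n *\<^sub>R v)) + (c m - c n) *\<^sub>R v)"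
          by (intro d subspace_diff F c)
        also have "\<dots> = dist (x m) (x n)" by (simp add: dist_norm algebra_simps)
        finally have "\<bar>c m - c n\<bar> * d < e * d" using N[OF that] by linarith
        then show ?thesis using d(1) by (simp add: dist_real_def)
      qed
      then show "\<exists>N. \<forall>m\<ge>N. \<forall>n\<ge>N. dist (c m) (c n) < e" by blast
    qed
    then obtain k where k: "c \<longlonglongrightarrow> k" by (meson Cauchy_convergent_iff convergent_def)
    have "(\<lambda>n. x n - c n *\<^sub>R v) \<longlonglongrightarrow> l - k *\<^sub>R v" by (intro tendsto_intros l k)
    from closed_sequentially[OF F(2) c this] show "\<exists>k. l - k *\<^sub>R v \<in> F" ..
  qed
qed

lemma closed_span_Un_finite:
  fixes F :: "'a::real_normed_vector set"
  assumes "finite B" "subspace F" "closed F"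
  shows "closed (span (B \<union> F))"
  using assms(1)
proof (induction B)
  case empty then show ?case using assms by (simp add: span_eq_iff[THEN iffD2])
next
  case (insert b B)
  have "span (insert b (span (B \<union> F))) = span (insert b B \<union> F)"
    by (simp add: span_insert span_span)
  with closed_span_insert[OF subspace_span insert.IH, of b] show ?case by simp
qed

text \<open>Induction on \<open>B\<close> with \<open>F\<close> varying: the new vector
  \<open>b\<close> is moved to the other summand, which stays closed. The induction hypothesis
  bounds \<open>e - k b\<close>, and the distance \<open>d\<close> of \<open>b\<close> from
  \<open>F\<close> then bounds \<open>k\<close> by
  \<open>(1 + c) / d * norm (e + f)\<close>.\<close>

lemma finite_dimensional_summand_bound:
  fixes F :: "'a::real_normed_vector set"
  assumes "finite B" "subspace F" "closed F" "span B \<inter> F = {0}"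
  obtains c where "0 \<le> c" "\<And>e f. e \<in> span B \<Longrightarrow> f \<in> F \<Longrightarrow> norm e \<le> c * norm (e + f)"
proof -
  have "\<exists>c\<ge>0. \<forall>e\<in>span B. \<forall>f\<in>F. norm e \<le> c * norm (e + f)"
    using assms
  proof (induction B arbitrary: F)
    case empty
    then show ?case by (intro exI[of _ 0]) simp
  next
    case (insert b B)
    show ?case
    proof (cases "b \<in> span B")
      case True
      then have "span (insert b B) = span B" by (rule span_redundant)
      then show ?thesis using insert.IH[of F] insert.prems by simp
    next
      case False
      let ?F = "span (insert b F)"
      have sF: "x \<in> ?F \<longleftrightarrow> (\<exists>k. x - k *\<^sub>R b \<in> F)" for x
        using insert.prems(1) by (simp add: span_insert span_eq_iff[THEN iffD2])
      have sB: "x \<in> span (insert b B) \<longleftrightarrow> (\<exists>k. x - k *\<^sub>R b \<in> span B)" for x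
        by (simp add: span_insert)
      have b: "b \<in> span (insert b B)" by (simp add: span_base)
      have "b \<notin> F"
      proof
        assume "b \<in> F"
        with b insert.prems(3) have "b = 0" by auto
        with False show False by (simp add: span_zero)
      qed
      then obtain d where d: "0 < d" "\<And>f c. f \<in> F \<Longrightarrow> \<bar>c\<bar> * d \<le> norm (f + c *\<^sub>R b)"
        using dist_closed_subspace[OF insert.prems(1,2)] by blast
      have "span B \<inter> ?F = {0}"
      proof (intro equalityI subsetI)
        fix x assume x: "x \<in> span B \<inter> ?F"
        then obtain k where k: "x - k *\<^sub>R b \<in> F" using sF by auto
        have "x \<in> span (insert b B)" using x span_mono[of B "insert b B"] by blast
        then have "x - k *\<^sub>R b \<in> span (insert b B)" by (intro span_diff span_scale b)
        with k insert.prems(3) have "x - k *\<^sub>R b \<in> {0}" by blast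
        then have xk: "x = k *\<^sub>R b" by simp
        have "k = 0"
        proof (rule ccontr)
          assume k0: "k \<noteq> 0"
          have "(1 / k) *\<^sub>R x \<in> span B" using x by (intro span_scale) auto
          with xk k0 False show False by simp
        qed
        with xk show "x \<in> {0}" by simp
      qed (auto simp: span_zero)
      from insert.IH[OF subspace_span closed_span_insert[OF insert.prems(1,2)] this]
      obtain c where c: "0 \<le> c" "\<forall>e\<in>span B. \<forall>f\<in>?F. norm e \<le> c * norm (e + f)"
        by (elim exE conjE)
      define K where "K = (1 + c) / d * norm b + c"
      have K: "0 \<le> K" using c(1) d(1) by (simp add: K_def)
      have "norm e \<le> K * norm (e + f)" if e: "e \<in> span (insert b B)" and f: "f \<in> F" for e f
      proof -
        obtain k where k: "e - k *\<^sub>R b \<in> span B" using e sB by auto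
        have "f + k *\<^sub>R b \<in> ?F" using f by (intro span_add span_scale span_base) auto
        from c(2)[rule_format, OF k this] have 1: "norm (e - k *\<^sub>R b) \<le> c * norm (e + f)"
          by (simp add: algebra_simps)
        have "\<bar>k\<bar> * d \<le> norm (f + k *\<^sub>R b)" by (rule d(2)[OF f])
        also have "\<dots> = norm ((e + f) - (e - k *\<^sub>R b))" by (simp add: algebra_simps)
        also have "\<dots> \<le> norm (e + f) + norm (e - k *\<^sub>R b)" by (rule norm_triangle_ineq4)
        also have "\<dots> \<le> (1 + c) * norm (e + f)" using 1 by (simp add: algebra_simps)
        finally have "\<bar>k\<bar> \<le> (1 + c) / d * norm (e + f)" using d(1) by (simp add: field_simps)
        then have "\<bar>k\<bar> * norm b \<le> (1 + c) / d * norm (e + f) * norm b" by (rule mult_right_mono) simp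
        moreover have "norm e \<le> \<bar>k\<bar> * norm b + norm (e - k *\<^sub>R b)"
          using norm_triangle_ineq[of "k *\<^sub>R b" "e - k *\<^sub>R b"] by simp
        ultimately have "norm e \<le> (1 + c) / d * norm (e + f) * norm b + c * norm (e + f)"
          using 1 by linarith
        then show ?thesis by (simp add: K_def algebra_simps)
      qed
      with K show ?thesis by blast
    qed
  qed
  with that show ?thesis by blast
qed

text \<open>Each basis vector has positive distance from the span of the others, which is closed by
  finite dimension; the reciprocal of that distance bounds its coordinate.\<close>

lemma coefficients_bounded:
  fixes B :: "'a::real_normed_vector set"
  assumes "finite B" "independent B"
  obtains c where "0 \<le> c" "\<And>a b. b \<in> B \<Longrightarrow> \<bar>a b\<bar> \<le> c * norm (\<Sum>b\<in>B. a b *\<^sub>R b)"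
proof -
  have "\<exists>d\<ge>0. \<forall>a. \<bar>a b\<bar> \<le> d * norm (\<Sum>b\<in>B. a b *\<^sub>R b)" if b: "b \<in> B" for b
  proof -
    let ?F = "span (B - {b})"
    have "closed (span ((B - {b}) \<union> {0}))"
      by (rule closed_span_Un_finite) (use assms in \<open>auto simp: subspace_single_0\<close>)
    then have cl: "closed ?F" by (simp add: span_insert_0)
    have "b \<notin> ?F" using assms(2) b by (auto simp: dependent_def)
    then obtain d where d: "0 < d" "\<And>f c. f \<in> ?F \<Longrightarrow> \<bar>c\<bar> * d \<le> norm (f + c *\<^sub>R b)"
      using dist_closed_subspace[OF subspace_span cl] by blast
    have "\<bar>a b\<bar> \<le> (1 / d) * norm (\<Sum>b\<in>B. a b *\<^sub>R b)" for a
    proof -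
      have "(\<Sum>b\<in>B - {b}. a b *\<^sub>R b) \<in> ?F" by (intro span_sum span_scale span_base)
      from d(2)[OF this, of "a b"] show ?thesis
        using d(1) sum.remove[OF assms(1) b, of "\<lambda>b. a b *\<^sub>R b"] by (simp add: field_simps)
    qed
    with d(1) show ?thesis by (intro exI[of _ "1 / d"]) auto
  qed
  then obtain d where d: "\<And>b. b \<in> B \<Longrightarrow> 0 \<le> d b"
      "\<And>b a. b \<in> B \<Longrightarrow> \<bar>a b\<bar> \<le> d b * norm (\<Sum>b\<in>B. a b *\<^sub>R b)" by metis
  show ?thesis
  proof (rule that[of "\<Sum>b\<in>B. d b"])
    show "0 \<le> (\<Sum>b\<in>B. d b)" by (intro sum_nonneg d)
    fix a b assume b: "b \<in> B"
    have "d b \<le> (\<Sum>b\<in>B. d b)" by (rule member_le_sum[OF b]) (use d assms in auto)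
    then show "\<bar>a b\<bar> \<le> (\<Sum>b\<in>B. d b) * norm (\<Sum>b\<in>B. a b *\<^sub>R b)"
      by (intro order_trans[OF d(2)[OF b]] mult_right_mono) auto
  qed
qed

section \<open>Sums of subspaces and projections along them\<close>

lemma mem_set_plus: "x \<in> A + B \<longleftrightarrow> (\<exists>a\<in>A. \<exists>b\<in>B. x = a + b)"
  by (auto simp: set_plus_def)

lemma span_plus_subspace:
  assumes "subspace F"
  shows "span B + F = span (B \<union> F)"
proof -
  have "span F = F" using assms by (simp add: span_eq_iff)
  then show ?thesis unfolding span_Un set_plus_def by blast
qed

lemma mem_set_sum:
  "finite I \<Longrightarrow> x \<in> (\<Sum>n\<in>I. S n) \<longleftrightarrow> (\<exists>s. (\<forall>n\<in>I. s n \<in> S n) \<and> x = (\<Sum>n\<in>I. s n))"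
  by (auto simp: set_sum_alt)

lemma sum_mem_set_sum:
  "finite I \<Longrightarrow> (\<And>n. n \<in> I \<Longrightarrow> s n \<in> S n) \<Longrightarrow> (\<Sum>n\<in>I. s n) \<in> (\<Sum>n\<in>I. S n)"
  by (subst mem_set_sum) blast+

lemma set_sum_finite_dimensional:
  assumes "\<And>n. n \<in> I \<Longrightarrow> \<exists>B. finite B \<and> S n = span B"
  shows "\<exists>B. finite B \<and> (\<Sum>n\<in>I. S n) = span B"
  using assms
proof (induction I rule: infinite_finite_induct)
  case (insert x I)
  obtain A where A: "finite A" "S x = span A" using insert.prems by blast
  obtain B where B: "finite B" "(\<Sum>n\<in>I. S n) = span B" using insert by blast
  have "(\<Sum>n\<in>insert x I. S n) = span (A \<union> B)"
    unfolding sum.insert[OF insert.hyps] A(2) B(2) span_Un set_plus_def by blast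
  then show ?case using A B by blast
qed (auto simp: set_zero intro!: exI[of _ "{}"])

lemma projection_along:
  assumes E: "subspace E" and F: "subspace F" and dir: "is_direct_sum E F UNIV"
  shows "projection_along E F u \<in> F" "u - projection_along E F u \<in> E"
    and "\<And>v. v \<in> F \<Longrightarrow> u - v \<in> E \<Longrightarrow> projection_along E F u = v"
proof -
  have uniq: "v = w" if "v \<in> F" "u - v \<in> E" "w \<in> F" "u - w \<in> E" for v w
  proof -
    have "(u - w) - (u - v) \<in> E" by (intro subspace_diff E that)
    moreover have "v - w \<in> F" by (intro subspace_diff F that)
    ultimately have "v - w \<in> E \<inter> F" by simp
    then have "v - w \<in> {0}" using dir unfolding is_direct_sum_def by blast
    then show ?thesis by simp
  qed
  have "u \<in> E + F" using dir by (simp add: is_direct_sum_def)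
  then obtain e f where ef: "e \<in> E" "f \<in> F" "u = e + f" by (auto simp: mem_set_plus)
  have ex1: "\<exists>!v. v \<in> F \<and> u - v \<in> E"
    by (rule ex1I[of _ f]) (use ef uniq in auto)
  from theI'[OF ex1] show "projection_along E F u \<in> F" "u - projection_along E F u \<in> E"
    by (simp_all add: projection_along_def)
  then show "\<And>v. v \<in> F \<Longrightarrow> u - v \<in> E \<Longrightarrow> projection_along E F u = v" using uniq by blast
qed

lemma bounded_linear_projection_along:
  fixes E F :: "'a::real_normed_vector set"
  assumes E: "\<exists>B. finite B \<and> E = span B" and F: "subspace F" "closed F" and dir: "is_direct_sum E F UNIV"
  shows "bounded_linear (projection_along E F)"
proof -
  obtain B where B: "finite B" "E = span B" using E by blast
  have sE: "subspace E" by (simp add: B)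
  note P = projection_along[OF sE F(1) dir]
  have "E \<inter> F = {0}" using dir by (simp add: is_direct_sum_def)
  then obtain c where c: "0 \<le> c" "\<And>e f. e \<in> E \<Longrightarrow> f \<in> F \<Longrightarrow> norm e \<le> c * norm (e + f)"
    by (rule finite_dimensional_summand_bound[OF B(1) F, folded B(2)]) blast
  show ?thesis
  proof (rule bounded_linear_intro[where K = "1 + c"])
    fix x y r
    have "(x - projection_along E F x) + (y - projection_along E F y) \<in> E" by (intro subspace_add sE P)
    then show "projection_along E F (x + y) = projection_along E F x + projection_along E F y"
      by (intro P(3) subspace_add F P(1)) (simp add: algebra_simps)
    have "r *\<^sub>R (x - projection_along E F x) \<in> E" by (intro subspace_scale sE P)
    then show "projection_along E F (r *\<^sub>R x) = r *\<^sub>R projection_along E F x"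
      by (intro P(3) subspace_scale F P(1)) (simp add: algebra_simps)
    have "norm (x - projection_along E F x) \<le> c * norm x"
      using c(2)[OF P(2)[of x] P(1)[of x]] by simp
    then show "norm (projection_along E F x) \<le> norm x * (1 + c)"
      using norm_triangle_ineq4[of x "x - projection_along E F x"] by (simp add: algebra_simps)
  qed
qed

text \<open>A nonzero projection fixes a nonzero vector. This is the alternative that
  \<open>tempered_of_subexponential\<close> asks for.\<close>

lemma onorm_projection_along:
  fixes E F :: "'a::real_normed_vector set"
  assumes E: "\<exists>B. finite B \<and> E = span B" and F: "subspace F" "closed F" and dir: "is_direct_sum E F UNIV"
  shows "onorm (projection_along E F) = 0 \<or> 1 \<le> onorm (projection_along E F)"
proof (cases "F = {0}")
  case True
  have "projection_along E F = (\<lambda>_. 0)"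
    using projection_along(1)[OF _ F(1) dir] E True by (auto simp: fun_eq_iff)
  then show ?thesis by (simp add: onorm_zero)
next
  case False
  then obtain f where f: "f \<in> F" "f \<noteq> 0" using subspace_0[OF F(1)] by auto
  have sE: "subspace E" using E by auto
  have "projection_along E F f = f"
    using f by (intro projection_along(3)[OF sE F(1) dir]) (simp_all add: subspace_0[OF sE])
  then have "norm f \<le> onorm (projection_along E F) * norm f"
    using onorm[OF bounded_linear_projection_along[OF assms], of f] by simp
  then show ?thesis using f by simp
qed

section \<open>Backward bounds on the Oseledets subspaces\<close>

text \<open>The library proves this under \<open>second_countable_topology\<close>, which is a class constraint and
  not available for a type that is merely assumed to be separable.\<close>

lemma borel_measurable_diff_separable:
  fixes f g :: "'w \<Rightarrow> 'a::real_normed_vector"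
  assumes "separable_space (euclidean :: 'a topology)"
    and [measurable]: "f \<in> borel_measurable M" "g \<in> borel_measurable M"
  shows "(\<lambda>x. f x - g x) \<in> borel_measurable M"
proof (rule borel_measurableI)
  fix S :: "'a set" assume S: "open S"
  obtain D :: "'a set" where D: "countable D" "closure D = UNIV"
    using assms(1) by (auto simp: separable_space_def)
  define r :: "nat \<Rightarrow> real" where "r n = 1 / real (Suc n)" for n
  \<comment> \<open>Indices of the products of balls that subtraction maps into \<open>S\<close>.
    Four distances below \<open>r n < e / 4\<close> add up to less than \<open>e\<close>, so
    countably many such products cover the preimage of \<open>S\<close>.\<close>
  define I where "I = {(c, d, n). c \<in> D \<and> d \<in> D \<and> (\<forall>x\<in>ball c (r n). \<forall>y\<in>ball d (r n). x - y \<in> S)}"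
  have "countable (D \<times> D \<times> (UNIV :: nat set))" using D(1) by (intro countable_SIGMA) auto
  then have I: "countable I" by (rule countable_subset[rotated]) (auto simp: I_def)
  have "(\<lambda>x. f x - g x) -` S \<inter> space M =
      (\<Union>(c, d, n)\<in>I. (f -` ball c (r n) \<inter> space M) \<inter> (g -` ball d (r n) \<inter> space M))" (is "?L = ?R")
  proof (intro equalityI subsetI)
    fix x assume x: "x \<in> ?L"
    then obtain e where e: "0 < e" "ball (f x - g x) e \<subseteq> S"
      using S by (auto simp: open_contains_ball)
    obtain n where n: "r n < e / 4" using reals_Archimedean[of "e / 4"] e(1)
      by (auto simp: r_def inverse_eq_divide)
    have rn: "0 < r n" by (simp add: r_def)
    have dense: "\<exists>d\<in>D. dist d z < r n" for z
      using D(2) closure_approachable[of z D] rn by auto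
    obtain c where c: "c \<in> D" "dist c (f x) < r n" using dense by blast
    obtain d where d: "d \<in> D" "dist d (g x) < r n" using dense by blast
    have "u - v \<in> S" if "u \<in> ball c (r n)" "v \<in> ball d (r n)" for u v
    proof -
      have "dist (f x - g x) (u - v) \<le> dist (f x) u + dist (g x) v"
        using norm_triangle_ineq4[of "f x - u" "g x - v"] by (simp add: dist_norm algebra_simps)
      also have "\<dots> \<le> (dist c (f x) + dist c u) + (dist d (g x) + dist d v)"
        by (intro add_mono dist_triangle3)
      also have "\<dots> < e" using c d that n by simp
      finally show ?thesis using e(2) by auto
    qed
    then have "(c, d, n) \<in> I" using c d by (auto simp: I_def)
    then show "x \<in> ?R" using x c d by (intro UN_I[of "(c, d, n)"]) auto
  next
    fix x assume "x \<in> ?R"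
    then show "x \<in> ?L" by (auto simp: I_def)
  qed
  also have "\<dots> \<in> sets M"
    by (intro sets.countable_UN'[OF I]) (auto intro!: measurable_sets)
  finally show "(\<lambda>x. f x - g x) -` S \<inter> space M \<in> sets M" .
qed

text \<open>A finite integral makes the supremum finite almost everywhere, and there
  \<open>enn2real\<close> is faithful. At infinity it returns 0, so the norm bound holds only almost
  everywhere. \<open>N\<close> is abstract in order to serve both halves of (E1).\<close>

lemma integrable_log_bound:
  fixes N :: "'w \<Rightarrow> real \<Rightarrow> 'v::real_normed_vector"
  assumes [measurable]: "(\<lambda>\<omega>. SUP s\<in>{0..1}. ennreal (max (ln (norm (N \<omega> s))) 0)) \<in> borel_measurable M"
    and fin: "(\<integral>\<^sup>+\<omega>. (SUP s\<in>{0..1}. ennreal (max (ln (norm (N \<omega> s))) 0)) \<partial>M) < \<infinity>"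
  obtains a where "integrable M a" "\<And>\<omega>. 0 \<le> a \<omega>"
    "AE \<omega> in M. \<forall>s\<in>{0..1}. norm (N \<omega> s) \<le> exp (a \<omega>)"
proof
  define F where "F \<omega> = (SUP s\<in>{0..1}. ennreal (max (ln (norm (N \<omega> s))) 0))" for \<omega>
  have [measurable]: "F \<in> borel_measurable M" unfolding F_def by (rule assms(1))
  have "(\<integral>\<^sup>+\<omega>. ennreal (norm (enn2real (F \<omega>))) \<partial>M) \<le> (\<integral>\<^sup>+\<omega>. F \<omega> \<partial>M)"
    by (intro nn_integral_mono) (simp add: ennreal_enn2real_if)
  also have "\<dots> < \<infinity>" using fin by (simp add: F_def)
  finally show "integrable M (\<lambda>\<omega>. enn2real (F \<omega>))" by (intro integrableI_bounded) auto
  show "0 \<le> enn2real (F \<omega>)" for \<omega> by simp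
  have "(\<integral>\<^sup>+\<omega>. F \<omega> \<partial>M) \<noteq> \<infinity>" unfolding F_def using fin by (rule less_imp_neq)
  then have "AE \<omega> in M. F \<omega> \<noteq> \<infinity>" by (rule nn_integral_PInf_AE[rotated]) measurable
  then show "AE \<omega> in M. \<forall>s\<in>{0..1}. norm (N \<omega> s) \<le> exp (enn2real (F \<omega>))"
  proof eventually_elim
    case (elim \<omega>)
    show ?case
    proof
      fix s :: real assume s: "s \<in> {0..1}"
      have "ennreal (max (ln (norm (N \<omega> s))) 0) \<le> F \<omega>" unfolding F_def by (rule SUP_upper[OF s])
      then have "max (ln (norm (N \<omega> s))) 0 \<le> enn2real (F \<omega>)"
        using elim by (metis enn2real_ennreal enn2real_mono max.cobounded2 less_top infinity_ennreal_def)
      then have "ln (norm (N \<omega> s)) \<le> enn2real (F \<omega>)" by simp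
      then show "norm (N \<omega> s) \<le> exp (enn2real (F \<omega>))"
        by (metis exp_ge_zero exp_le_cancel_iff exp_ln less_eq_real_def norm_ge_zero)
    qed
  qed
qed

lemma measurable_subspaces_span:
  assumes "measurable_subspaces M W l E" "\<omega> \<in> W"
  obtains B where "finite B" "independent B" "E \<omega> = span B"
proof -
  obtain v :: "nat \<Rightarrow> _" where v: "\<forall>\<omega>\<in>W. inj_on (\<lambda>n. v n \<omega>) {..<l} \<and> independent ((\<lambda>n. v n \<omega>) ` {..<l}) \<and>
               span ((\<lambda>n. v n \<omega>) ` {..<l}) = E \<omega>"
    using assms(1) unfolding measurable_subspaces_def by blast
  show ?thesis by (rule that[of "(\<lambda>n. v n \<omega>) ` {..<l}"]) (use v assms(2) in auto)
qed

context semiflow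
begin

lemma U_add:
  assumes "\<omega> \<in> space M" "0 \<le> t" "0 \<le> s"
  shows "U (\<theta> s \<omega>) t (U \<omega> s u) = U \<omega> (t + s) u"
proof -
  have "U (\<theta> s \<omega>) t (U \<omega> s u) = (U (\<theta> s \<omega>) t o\<^sub>L U \<omega> s) u" by simp
  then show ?thesis by (simp only: semiflow_add[OF assms])
qed

lemma flow_inverse:
  assumes "\<omega> \<in> space M" shows "\<theta> t (\<theta> (- t) \<omega>) = \<omega>" "\<theta> (- t) (\<theta> t \<omega>) = \<omega>"
  using flow_add[OF assms, of t "- t"] flow_add[OF assms, of "- t" t] flow_zero[OF assms] by simp_all

lemma measurable_U:
  assumes t: "0 \<le> t" and y: "y \<in> restrict_space M W \<rightarrow>\<^sub>M borel"
  shows "(\<lambda>\<omega>. U \<omega> t (y \<omega>)) \<in> restrict_space M W \<rightarrow>\<^sub>M borel"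
proof -
  have "(\<lambda>\<omega>. (t, \<omega>, y \<omega>)) \<in> restrict_space M W \<rightarrow>\<^sub>M restrict_space borel {0..} \<Otimes>\<^sub>M (M \<Otimes>\<^sub>M borel)"
    using t measurable_restrict_space1[OF measurable_id, of M W]
    by (intro measurable_Pair measurable_const y) (auto simp: space_restrict_space id_def)
  from measurable_compose[OF this semiflow_measurable] show ?thesis by simp
qed

end

text \<open>Both cases of the decomposition have this form: \<open>J = {1..k}\<close> and \<open>G j\<close> the tail sum in
  case (O1), \<open>J = {1..}\<close> and \<open>G j = F j\<close> in case (O2).\<close>

locale oseledets_splitting = semiflow M \<theta> U
  for M :: "'w measure" and \<theta> :: "real \<Rightarrow> 'w \<Rightarrow> 'w" and U :: "'w \<Rightarrow> real \<Rightarrow> ('a::banach \<Rightarrow>\<^sub>L 'a)" +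
  fixes W :: "'w set" and J :: "nat set" and lam :: "nat \<Rightarrow> real"
    and E G :: "nat \<Rightarrow> 'w \<Rightarrow> 'a set"
  assumes W_sets: "W \<in> sets M" and W_invariant: "flow_invariant M \<theta> W" and W_full: "measure M W = 1"
    and J_pos: "\<And>j. j \<in> J \<Longrightarrow> 1 \<le> j"
    and J_down: "\<And>i j. j \<in> J \<Longrightarrow> 1 \<le> i \<Longrightarrow> i \<le> j \<Longrightarrow> i \<in> J"
    and E_measurable: "\<And>j. j \<in> J \<Longrightarrow> \<exists>l. measurable_subspaces M W l (E j)"
    and G_subspace: "\<And>j \<omega>. j \<in> J \<Longrightarrow> \<omega> \<in> W \<Longrightarrow> subspace (G j \<omega>)"
    and G_closed: "\<And>j \<omega>. j \<in> J \<Longrightarrow> \<omega> \<in> W \<Longrightarrow> closed (G j \<omega>)"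
    and G_0: "\<And>\<omega>. \<omega> \<in> W \<Longrightarrow> G 0 \<omega> = UNIV"
    and U_E: "\<And>j \<omega> t. j \<in> J \<Longrightarrow> \<omega> \<in> W \<Longrightarrow> 0 \<le> t \<Longrightarrow> U \<omega> t ` E j \<omega> = E j (\<theta> t \<omega>)"
    and U_G: "\<And>j \<omega> t. j \<in> J \<Longrightarrow> \<omega> \<in> W \<Longrightarrow> 0 \<le> t \<Longrightarrow> U \<omega> t ` G j \<omega> \<subseteq> G j (\<theta> t \<omega>)"
    and indep: "\<And>j \<omega>. j \<in> J \<Longrightarrow> \<omega> \<in> W \<Longrightarrow> independent_subspaces {1..j} (\<lambda>n. E n \<omega>)"
    and direct: "\<And>j \<omega>. j \<in> J \<Longrightarrow> \<omega> \<in> W \<Longrightarrow> is_direct_sum (\<Sum>n=1..j. E n \<omega>) (G j \<omega>) UNIV"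
    and split: "\<And>j \<omega>. j \<in> J \<Longrightarrow> \<omega> \<in> W \<Longrightarrow> is_direct_sum (E j \<omega>) (G j \<omega>) (G (j - 1) \<omega>)"
    and proj_measurable: "\<And>j. j \<in> J \<Longrightarrow>
      strongly_measurable M W (\<lambda>\<omega>. projection_along (\<Sum>n=1..j. E n \<omega>) (G j \<omega>))"
    and proj_tempered: "\<And>j. j \<in> J \<Longrightarrow>
      tempered M \<theta> W (\<lambda>\<omega>. projection_along (\<Sum>n=1..j. E n \<omega>) (G j \<omega>))"
    and growth: "\<And>j \<omega> u. j \<in> J \<Longrightarrow> \<omega> \<in> W \<Longrightarrow> u \<in> E j \<omega> \<Longrightarrow> u \<noteq> 0 \<Longrightarrow>
      (growth_rate (\<lambda>t. norm (U \<omega> t u)) \<longlongrightarrow> ereal (lam j)) at_top"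
    and semiorbit: "\<And>j \<omega> u. j \<in> J \<Longrightarrow> \<omega> \<in> W \<Longrightarrow> u \<in> G (j - 1) \<omega> \<Longrightarrow> u \<noteq> 0 \<Longrightarrow>
      u \<in> E j \<omega> \<longleftrightarrow> (\<exists>v. negative_semiorbit \<theta> U \<omega> u v \<and>
        (growth_rate (\<lambda>s. norm (v s)) \<longlongrightarrow> ereal (lam j)) at_bot)"
begin

lemma W_space: "\<omega> \<in> W \<Longrightarrow> \<omega> \<in> space M"
  using W_invariant by (auto simp: flow_invariant_def)

lemma flow_W: "\<omega> \<in> W \<Longrightarrow> \<theta> t \<omega> \<in> W"
  using W_invariant by (auto simp: flow_invariant_def)

lemma AE_W: "AE \<omega> in M. \<omega> \<in> W"
  using prob_eq_1[OF W_sets] W_full by simp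

lemma E_span:
  assumes "j \<in> J" "\<omega> \<in> W"
  obtains B where "finite B" "independent B" "E j \<omega> = span B"
  using E_measurable[OF assms(1)] measurable_subspaces_span[OF _ assms(2)] by metis

lemma E_subspace: "j \<in> J \<Longrightarrow> \<omega> \<in> W \<Longrightarrow> subspace (E j \<omega>)"
  by (rule E_span[of j \<omega>]) auto

lemma sum_E_span:
  assumes "j \<in> insert 0 J" "\<omega> \<in> W"
  shows "\<exists>B. finite B \<and> (\<Sum>n=1..j. E n \<omega>) = span B"
proof (rule set_sum_finite_dimensional)
  fix n assume "n \<in> {1..j}"
  then have "n \<in> J" using assms(1) J_down by auto
  from E_span[OF this assms(2)] show "\<exists>B. finite B \<and> E n \<omega> = span B" by metis
qed

lemma G_closed_subspace:
  assumes "j \<in> insert 0 J" "\<omega> \<in> W"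
  shows "subspace (G j \<omega>)" "closed (G j \<omega>)" "is_direct_sum (\<Sum>n=1..j. E n \<omega>) (G j \<omega>) UNIV"
proof -
  have "subspace (G j \<omega>) \<and> closed (G j \<omega>) \<and> is_direct_sum (\<Sum>n=1..j. E n \<omega>) (G j \<omega>) UNIV"
  proof (cases "j = 0")
    case True
    then show ?thesis using G_0[OF assms(2)] by (simp add: subspace_UNIV is_direct_sum_def set_plus_def)
  next
    case False
    then have "j \<in> J" using assms(1) by simp
    then show ?thesis using assms(2) by (intro conjI G_subspace G_closed direct)
  qed
  then show "subspace (G j \<omega>)" "closed (G j \<omega>)" "is_direct_sum (\<Sum>n=1..j. E n \<omega>) (G j \<omega>) UNIV"
    by blast+
qed

lemma pred_J: "j \<in> J \<Longrightarrow> j - 1 \<in> insert 0 J"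
  using J_down[of j "j - 1"] J_pos[of j] by (cases "j = 1") auto

section \<open>Projections and components of the splitting\<close>

abbreviation proj :: "nat \<Rightarrow> 'w \<Rightarrow> 'a \<Rightarrow> 'a"
  where "proj j \<omega> \<equiv> projection_along (\<Sum>n=1..j. E n \<omega>) (G j \<omega>)"

lemma
  assumes "j \<in> insert 0 J" "\<omega> \<in> W"
  shows proj_in: "proj j \<omega> u \<in> G j \<omega>"
    and proj_diff: "u - proj j \<omega> u \<in> (\<Sum>n=1..j. E n \<omega>)"
    and proj_eq: "\<And>v. v \<in> G j \<omega> \<Longrightarrow> u - v \<in> (\<Sum>n=1..j. E n \<omega>) \<Longrightarrow> proj j \<omega> u = v"
    and bounded_linear_proj: "bounded_linear (proj j \<omega>)"
proof -
  have s: "subspace (\<Sum>n=1..j. E n \<omega>)" using sum_E_span[OF assms] by auto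
  note g = G_closed_subspace[OF assms]
  from projection_along[OF s g(1,3)]
  show "proj j \<omega> u \<in> G j \<omega>" "u - proj j \<omega> u \<in> (\<Sum>n=1..j. E n \<omega>)"
    "\<And>v. v \<in> G j \<omega> \<Longrightarrow> u - v \<in> (\<Sum>n=1..j. E n \<omega>) \<Longrightarrow> proj j \<omega> u = v" by blast+
  show "bounded_linear (proj j \<omega>)" by (rule bounded_linear_projection_along[OF sum_E_span[OF assms] g])
qed

lemma proj_0: "\<omega> \<in> W \<Longrightarrow> proj 0 \<omega> u = u"
  by (rule proj_eq) (auto simp: G_0 set_zero)

text \<open>This is the projection onto \<open>E j\<close> along the other summands. As a difference
  of consecutive projections it inherits strong measurability and norm bounds from clause
  (iii).\<close>

definition component :: "nat \<Rightarrow> 'w \<Rightarrow> 'a \<Rightarrow> 'a"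
  where "component j \<omega> u = proj (j - 1) \<omega> u - proj j \<omega> u"

lemma sum_E_Suc:
  assumes "j \<in> J" shows "(\<Sum>n=1..j. E n \<omega>) = (\<Sum>n=1..j - 1. E n \<omega>) + E j \<omega>"
  using J_pos[OF assms] by (cases j) auto

text \<open>If \<open>e + g\<close> splits \<open>proj (j - 1) \<omega> u\<close> along
  \<open>E j\<close> and \<open>G j\<close>, uniqueness identifies \<open>g\<close> with
  \<open>proj j \<omega> u\<close>, which leaves \<open>e\<close>.\<close>

lemma component_in:
  assumes j: "j \<in> J" and w: "\<omega> \<in> W"
  shows "component j \<omega> u \<in> E j \<omega>"
proof -
  have "proj (j - 1) \<omega> u \<in> E j \<omega> + G j \<omega>"
    using proj_in[OF pred_J[OF j] w] split[OF j w] by (simp add: is_direct_sum_def)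
  then obtain e g where eg: "e \<in> E j \<omega>" "g \<in> G j \<omega>" "proj (j - 1) \<omega> u = e + g"
    by (auto simp: mem_set_plus)
  have "u - g = (u - proj (j - 1) \<omega> u) + e"
    using eg(3) by (simp add: algebra_simps)
  also have "\<dots> \<in> (\<Sum>n=1..j. E n \<omega>)"
    unfolding sum_E_Suc[OF j] by (intro set_plus_intro proj_diff pred_J j w eg)
  finally have "proj j \<omega> u = g" using eg(2) j by (intro proj_eq w) auto
  then show ?thesis using eg by (simp add: component_def)
qed

lemma component_id:
  assumes j: "j \<in> J" and w: "\<omega> \<in> W" and e: "e \<in> E j \<omega>"
  shows "component j \<omega> e = e"
proof -
  have "0 \<in> G j \<omega>" by (rule subspace_0[OF G_subspace[OF j w]])
  then have "e \<in> G (j - 1) \<omega>"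
    using split[OF j w] e unfolding is_direct_sum_def by (metis add_0_right set_plus_intro)
  moreover have 0: "0 \<in> (\<Sum>n=1..j - 1. E n \<omega>)"
    using sum_E_span[OF pred_J[OF j] w] span_zero by metis
  ultimately have "proj (j - 1) \<omega> e = e"
    by (intro proj_eq[OF pred_J[OF j] w]) simp_all
  moreover from 0 have "e \<in> (\<Sum>n=1..j. E n \<omega>)"
    unfolding sum_E_Suc[OF j] using e by (metis add_0 set_plus_intro)
  then have "proj j \<omega> e = 0" using j \<open>0 \<in> G j \<omega>\<close> by (intro proj_eq w) simp_all
  ultimately show ?thesis by (simp add: component_def)
qed

lemma bounded_linear_component:
  assumes "j \<in> J" "\<omega> \<in> W" shows "bounded_linear (component j \<omega>)"
  unfolding component_def[abs_def]
  using assms by (intro bounded_linear_sub bounded_linear_proj pred_J) auto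

lemma norm_component_le:
  assumes "j \<in> J" "\<omega> \<in> W"
  shows "norm (component j \<omega> u) \<le> (onorm (proj (j - 1) \<omega>) + onorm (proj j \<omega>)) * norm u"
proof -
  have "norm (component j \<omega> u) \<le> norm (proj (j - 1) \<omega> u) + norm (proj j \<omega> u)"
    unfolding component_def by (rule norm_triangle_ineq4)
  also have "\<dots> \<le> onorm (proj (j - 1) \<omega>) * norm u + onorm (proj j \<omega>) * norm u"
    using assms by (intro add_mono onorm bounded_linear_proj pred_J) auto
  finally show ?thesis by (simp add: distrib_right)
qed

lemma component_sum:
  assumes w: "\<omega> \<in> W"
  shows "j \<in> insert 0 J \<Longrightarrow> (\<Sum>n=1..j. component n \<omega> u) = u - proj j \<omega> u"
proof (induction j)
  case 0 then show ?case using proj_0[OF w, of u] by simp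
next
  case (Suc j)
  then have "j \<in> insert 0 J" using pred_J[of "Suc j"] by auto
  then show ?case using Suc.IH by (simp add: component_def)
qed

lemma component_measurable:
  assumes sep: "separable_space (euclidean :: 'a topology)" and j: "j \<in> J"
  shows "(\<lambda>\<omega>. component j \<omega> u) \<in> restrict_space M W \<rightarrow>\<^sub>M borel"
proof -
  have *: "(\<lambda>\<omega>. proj i \<omega> u) \<in> restrict_space M W \<rightarrow>\<^sub>M borel" if i: "i \<in> insert 0 J" for i
  proof (cases "i = 0")
    case True
    have "(\<lambda>\<omega>. proj i \<omega> u) \<in> restrict_space M W \<rightarrow>\<^sub>M borel \<longleftrightarrow>
        (\<lambda>_. u) \<in> restrict_space M W \<rightarrow>\<^sub>M (borel :: 'a measure)"
      unfolding True by (rule measurable_cong) (rule proj_0, simp add: space_restrict_space)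
    then show ?thesis by simp
  next
    case False
    then show ?thesis using i proj_measurable[of i] by (auto simp: strongly_measurable_def)
  qed
  show ?thesis unfolding component_def
    using j by (intro borel_measurable_diff_separable[OF sep] * pred_J) auto
qed

section \<open>Injectivity and backward growth on the subspaces\<close>

lemma U_injective:
  assumes j: "j \<in> J" and w: "\<omega> \<in> W" and x: "x \<in> E j \<omega>" and t: "0 \<le> t" and 0: "U \<omega> t x = 0"
  shows "x = 0"
proof (rule ccontr)
  assume "x \<noteq> 0"
  \<comment> \<open>A vector that reaches 0 stays there, whereas the finite exponent keeps it
    nonzero at late times.\<close>
  then obtain T where T: "\<And>t. T \<le> t \<Longrightarrow> norm (U \<omega> t x) \<noteq> 0"
    using growth_rate_nonzero[OF growth[OF j w x]] by blast
  have "U \<omega> (max T t) x = U (\<theta> t \<omega>) (max T t - t) (U \<omega> t x)"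
    using U_add[OF W_space[OF w], of "max T t - t" t] t by simp
  with T[of "max T t"] show False by (simp add: 0 blinfun.zero_right)
qed

text \<open>The \<open>E\<close>-part of \<open>x\<close> is mapped both into the sum of the
  \<open>E n\<close> and into \<open>G i\<close>, hence to 0; injectivity on each \<open>E n\<close>
  then makes it vanish. Clause (v) can only be applied to vectors of \<open>G (j - 1)\<close>, so
  this is needed before using it at earlier base points.\<close>

lemma G_pullback:
  assumes i: "i \<in> insert 0 J" and w: "\<omega> \<in> W" and t: "0 \<le> t" and x: "U \<omega> t x \<in> G i (\<theta> t \<omega>)"
  shows "x \<in> G i \<omega>"
proof (cases "i = 0")
  case True
  then show ?thesis using G_0[OF w] by simp
next
  case False
  then have i: "i \<in> J" using i by simp
  define y where "y = x - proj i \<omega> x"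
  have "y \<in> (\<Sum>n=1..i. E n \<omega>)" unfolding y_def using i by (intro proj_diff w) auto
  then obtain s where s: "\<And>n. n \<in> {1..i} \<Longrightarrow> s n \<in> E n \<omega>" "y = (\<Sum>n=1..i. s n)"
    by (subst (asm) mem_set_sum) blast+
  have nJ: "n \<in> J" if "n \<in> {1..i}" for n using J_down[OF i] that by auto
  have Us: "U \<omega> t (s n) \<in> E n (\<theta> t \<omega>)" if "n \<in> {1..i}" for n
    using U_E[OF nJ[OF that] w t] s(1)[OF that] by auto
  have Uy: "U \<omega> t y = (\<Sum>n=1..i. U \<omega> t (s n))" by (simp add: s(2) blinfun.sum_right)
  have "U \<omega> t (proj i \<omega> x) \<in> G i (\<theta> t \<omega>)"
    using U_G[OF i w t] proj_in[of i \<omega> x] i w by auto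
  then have "U \<omega> t y \<in> G i (\<theta> t \<omega>)" unfolding y_def blinfun.diff_right
    by (intro subspace_diff G_subspace i flow_W w x)
  moreover have "U \<omega> t y \<in> (\<Sum>n=1..i. E n (\<theta> t \<omega>))"
    unfolding Uy using Us by (intro sum_mem_set_sum) auto
  ultimately have "U \<omega> t y \<in> {0}"
    using direct[OF i flow_W[OF w], of t] unfolding is_direct_sum_def by blast
  then have "(\<Sum>n=1..i. U \<omega> t (s n)) = 0" using Uy by simp
  then have U0: "\<And>n. n \<in> {1..i} \<Longrightarrow> U \<omega> t (s n) = 0"
    using indep[OF i flow_W[OF w], of t] Us unfolding independent_subspaces_def
    by (metis (no_types, lifting))
  have "s n = 0" if "n \<in> {1..i}" for n
    by (rule U_injective[OF nJ[OF that] w s(1)[OF that] t U0[OF that]])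
  then have "y = 0" using s(2) by simp
  then have "x = proj i \<omega> x" by (simp add: y_def)
  then show ?thesis using proj_in[of i \<omega> x] i w by simp
qed

lemma E_subset_G:
  assumes "j \<in> J" "\<omega> \<in> W" shows "E j \<omega> \<subseteq> G (j - 1) \<omega>"
proof
  fix e assume "e \<in> E j \<omega>"
  then have "e + 0 \<in> E j \<omega> + G j \<omega>"
    by (intro set_plus_intro subspace_0 G_subspace assms)
  then show "e \<in> G (j - 1) \<omega>" using split[OF assms] by (simp add: is_direct_sum_def)
qed

text \<open>Clause (v) yields a semiorbit but does not place its values. \<open>G_pullback\<close>
  puts \<open>v s\<close> into \<open>G (j - 1)\<close>, and the shifted semiorbit passes through
  \<open>v s\<close> with the same rate, so clause (v) at \<open>\<theta> s \<omega>\<close> puts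
  \<open>v s\<close> into \<open>E j\<close>.\<close>

lemma semiorbit_in_E:
  assumes j: "j \<in> J" and w: "\<omega> \<in> W" and e: "e \<in> E j \<omega>" "e \<noteq> 0"
  obtains v where "\<And>s. s \<le> 0 \<Longrightarrow> v s \<in> E j (\<theta> s \<omega>)" "\<And>s. s \<le> 0 \<Longrightarrow> U (\<theta> s \<omega>) (- s) (v s) = e"
    "(growth_rate (\<lambda>s. norm (v s)) \<longlongrightarrow> ereal (lam j)) at_bot"
proof -
  have sp: "\<omega> \<in> space M" by (rule W_space[OF w])
  have "e \<in> G (j - 1) \<omega>" using E_subset_G[OF j w] e by blast
  with semiorbit[OF j w this e(2)] e(1) obtain v
    where v: "negative_semiorbit \<theta> U \<omega> e v" "(growth_rate (\<lambda>s. norm (v s)) \<longlongrightarrow> ereal (lam j)) at_bot"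
    by blast
  have step: "v (s + t) = U (\<theta> s \<omega>) t (v s)" if "s \<le> 0" "0 \<le> t" "s + t \<le> 0" for s t
    using v(1) that unfolding negative_semiorbit_def by blast
  have Uv: "U (\<theta> s \<omega>) (- s) (v s) = e" if "s \<le> 0" for s
    using step[of s "- s"] that v(1) by (simp add: negative_semiorbit_def)
  have "v s \<in> E j (\<theta> s \<omega>)" if s: "s \<le> 0" for s
  proof -
    have w': "\<theta> s \<omega> \<in> W" by (rule flow_W[OF w])
    have "\<theta> (- s) (\<theta> s \<omega>) = \<omega>" using flow_inverse[OF sp] by simp
    then have "v s \<in> G (j - 1) (\<theta> s \<omega>)"
      using Uv[OF s] \<open>e \<in> G (j - 1) \<omega>\<close> s by (intro G_pullback[OF pred_J[OF j] w', of "- s"]) auto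
    moreover have "v s \<noteq> 0" using Uv[OF s] e(2) by (auto simp: blinfun.zero_right)
    moreover have "negative_semiorbit \<theta> U (\<theta> s \<omega>) (v s) (\<lambda>a. v (a + s))"
      unfolding negative_semiorbit_def
    proof (intro conjI allI impI)
      have "(\<lambda>a. a + s) \<in> restrict_space borel {..0} \<rightarrow>\<^sub>M restrict_space borel {..0}"
        using s by (intro measurable_restrict_space3) auto
      moreover have "v \<in> restrict_space borel {..0} \<rightarrow>\<^sub>M borel"
        using v(1) by (simp add: negative_semiorbit_def)
      ultimately show "(\<lambda>a. v (a + s)) \<in> restrict_space borel {..0} \<rightarrow>\<^sub>M borel"
        by (rule measurable_compose)
      fix a t :: real assume a: "a \<le> 0 \<and> 0 \<le> t \<and> a + t \<le> 0"
      have "v ((a + s) + t) = U (\<theta> (a + s) \<omega>) t (v (a + s))" using a s by (intro step) auto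
      then show "v (a + t + s) = U (\<theta> a (\<theta> s \<omega>)) t (v (a + s))"
        by (simp add: flow_add[OF sp] algebra_simps)
    qed simp
    moreover have "(growth_rate (\<lambda>a. norm (v (a + s))) \<longlongrightarrow> ereal (lam j)) at_bot"
      using growth_rate_shift[OF at_bot_le_at_infinity _ v(2), of s]
        filterlim_tendsto_add_at_bot_iff[OF tendsto_const[of s], of "\<lambda>t. t" at_bot]
      by (simp add: add.commute filterlim_ident)
    ultimately show ?thesis using semiorbit[OF j w'] by blast
  qed
  with Uv v(2) show ?thesis using that by blast
qed

text \<open>One semiorbit is taken through each vector of a basis of \<open>E j \<omega>\<close>. By
  injectivity \<open>e\<close> is the combination of their values at time \<open>-n\<close> with the
  coordinates of its image, so \<open>K\<close> depends on \<open>\<omega>\<close> but not on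
  \<open>n\<close>.\<close>

lemma backward_bound:
  assumes j: "j \<in> J" and w: "\<omega> \<in> W"
  obtains K where "\<And>n e. e \<in> E j (\<theta> (- real n) \<omega>) \<Longrightarrow>
    norm e \<le> K * exp ((\<bar>lam j\<bar> + 1) * real n) * norm (U (\<theta> (- real n) \<omega>) n e)"
proof -
  \<comment> \<open>At least \<open>- (lam j - 1)\<close>, the rate that
    \<open>growth_rate_at_bot_bound\<close> yields for \<open>m = lam j - 1\<close>; the 1 provides
    the strict gap.\<close>
  let ?k = "\<bar>lam j\<bar> + 1"
  obtain B where B: "finite B" "independent B" "E j \<omega> = span B" by (rule E_span[OF j w])
  have "\<exists>v K. (\<forall>n::nat. v n \<in> E j (\<theta> (- real n) \<omega>) \<and> U (\<theta> (- real n) \<omega>) n (v n) = b \<and>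
      norm (v n) \<le> K * exp (?k * real n)) \<and> 0 \<le> K" if b: "b \<in> B" for b
  proof -
    have "b \<in> E j \<omega>" "b \<noteq> 0" using b B dependent_zero[of B] by (auto simp: span_base)
    from semiorbit_in_E[OF j w this] obtain v where v: "\<And>s. s \<le> 0 \<Longrightarrow> v s \<in> E j (\<theta> s \<omega>)"
        "\<And>s. s \<le> 0 \<Longrightarrow> U (\<theta> s \<omega>) (- s) (v s) = b"
        "(growth_rate (\<lambda>s. norm (v s)) \<longlongrightarrow> ereal (lam j)) at_bot" by metis
    obtain K where K: "\<And>n::nat. norm (v (- real n)) \<le> K * exp (- (lam j - 1) * real n)" "0 \<le> K"
      using growth_rate_at_bot_bound[OF v(3), of "lam j - 1"] by auto
    have "norm (v (- real n)) \<le> K * exp (?k * real n)" for n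
    proof -
      have "- (lam j - 1) * real n \<le> ?k * real n" by (intro mult_right_mono) auto
      then have "K * exp (- (lam j - 1) * real n) \<le> K * exp (?k * real n)"
        using K(2) by (intro mult_left_mono) auto
      with K(1)[of n] show ?thesis by linarith
    qed
    with v(1,2)[of "- real _"] K(2) show ?thesis
      by (intro exI[of _ "\<lambda>n. v (- real n)"] exI[of _ K]) auto
  qed
  then obtain v K where vK: "\<And>b n. b \<in> B \<Longrightarrow> v b n \<in> E j (\<theta> (- real n) \<omega>)"
      "\<And>b n. b \<in> B \<Longrightarrow> U (\<theta> (- real n) \<omega>) (real n) (v b n) = b"
      "\<And>b n. b \<in> B \<Longrightarrow> norm (v b n) \<le> K b * exp (?k * real n)" "\<And>b. b \<in> B \<Longrightarrow> 0 \<le> K b" by metis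
  obtain c where c: "0 \<le> c" "\<And>a b. b \<in> B \<Longrightarrow> \<bar>a b\<bar> \<le> c * norm (\<Sum>b\<in>B. a b *\<^sub>R b)"
    using coefficients_bounded[OF B(1,2)] by blast
  show ?thesis
  proof (rule that[of "c * (\<Sum>b\<in>B. K b)"])
    fix n e assume e: "e \<in> E j (\<theta> (- real n) \<omega>)"
    let ?w = "\<theta> (- real n) \<omega>"
    have w': "?w \<in> W" by (rule flow_W[OF w])
    have "U ?w n e \<in> E j (\<theta> (real n) ?w)" using U_E[OF j w', of "real n"] e by auto
    then have "U ?w n e \<in> span B" by (simp add: flow_inverse[OF W_space[OF w]] B(3))
    then obtain a where a: "U ?w n e = (\<Sum>b\<in>B. a b *\<^sub>R b)"
      unfolding span_finite[OF B(1)] by auto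
    define z where "z = (\<Sum>b\<in>B. a b *\<^sub>R v b n)"
    have z: "z \<in> E j ?w" unfolding z_def
      by (intro subspace_sum subspace_scale E_subspace j w' vK(1))
    have "U ?w n z = U ?w n e" unfolding z_def a
      by (simp add: blinfun.sum_right blinfun.scaleR_right vK(2) cong: sum.cong)
    then have "U ?w n (e - z) = 0" by (simp add: blinfun.diff_right)
    moreover have "e - z \<in> E j ?w" by (rule subspace_diff[OF E_subspace[OF j w'] e z])
    ultimately have "e - z = 0" by (rule U_injective[OF j w', rotated 2]) simp
    then have "norm e = norm z" by simp
    also have "\<dots> \<le> (\<Sum>b\<in>B. norm (a b *\<^sub>R v b n))" unfolding z_def by (rule norm_sum)
    also have "\<dots> \<le> (\<Sum>b\<in>B. (c * norm (U ?w n e)) * (K b * exp (?k * real n)))"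
    proof (rule sum_mono)
      fix b assume b: "b \<in> B"
      have "\<bar>a b\<bar> * norm (v b n) \<le> (c * norm (U ?w n e)) * (K b * exp (?k * real n))"
        unfolding a using c b vK(3)[OF b] by (intro mult_mono) auto
      then show "norm (a b *\<^sub>R v b n) \<le> (c * norm (U ?w n e)) * (K b * exp (?k * real n))" by simp
    qed
    also have "\<dots> = c * (\<Sum>b\<in>B. K b) * exp (?k * real n) * norm (U ?w n e)"
      by (simp add: sum_distrib_left sum_distrib_right algebra_simps)
    finally show "norm e \<le> c * (\<Sum>b\<in>B. K b) * exp (?k * real n) * norm (U ?w n e)" .
  qed
qed

text \<open>The logarithm \<open>l\<close> of the best constant is finite by \<open>backward_bound\<close>, and along the flow it
  can decrease by at most an integrable amount, so \<open>sublinear_along_orbits\<close> applies to it.\<close>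

lemma tempered_backward_bound:
  assumes sep: "separable_space (euclidean :: 'a topology)" and j: "j \<in> J"
    and a: "integrable M a" "\<And>\<omega>. 0 \<le> a \<omega>" "AE \<omega> in M. norm (U \<omega> 1) \<le> exp (a \<omega>)"
  obtains l where "AE \<omega> in M. \<forall>e>0. \<exists>K. \<forall>n::int. l (\<theta> (of_int n) \<omega>) \<le> K + e * \<bar>of_int n\<bar>"
    "\<And>\<omega> n e. \<omega> \<in> W \<Longrightarrow> e \<in> E j (\<theta> (- real n) \<omega>) \<Longrightarrow>
      norm e \<le> exp ((\<bar>lam j\<bar> + 1) * real n + l \<omega>) * norm (U (\<theta> (- real n) \<omega>) n e)"
proof -
  obtain D :: "'a set" where D: "countable D" "closure D = UNIV"
    using sep by (auto simp: separable_space_def)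
  let ?k = "\<bar>lam j\<bar> + 1"
  define h where "h n x \<omega> = (if \<omega> \<in> W then
    exp (- ?k * real n) * norm (component j \<omega> x) / norm (U \<omega> n (component j \<omega> x)) else 0)"
    for n :: nat and x \<omega>
  define L where "L \<omega> = (SUP n. SUP x\<in>D. ennreal (h n x (\<theta> (- real n) \<omega>)))" for \<omega>
  \<comment> \<open>Truncation at 1 makes \<open>l\<close> nonnegative. On \<open>W\<close> the
    value \<open>L\<close> is finite by \<open>backward_bound\<close>, so \<open>enn2real\<close>
    loses nothing there.\<close>
  define l where "l \<omega> = ln (max 1 (enn2real (L \<omega>)))" for \<omega>
  have h_meas [measurable]: "h n x \<in> borel_measurable M" for n x
  proof -
    have c: "(\<lambda>\<omega>. component j \<omega> x) \<in> restrict_space M W \<rightarrow>\<^sub>M borel" by (rule component_measurable[OF sep j])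
    have nb: "norm \<in> (borel :: 'a measure) \<rightarrow>\<^sub>M borel"
      by (intro borel_measurable_continuous_onI continuous_intros)
    have "(\<lambda>\<omega>. norm (component j \<omega> x)) \<in> borel_measurable (restrict_space M W)"
      by (rule measurable_compose[OF c nb])
    moreover have "(\<lambda>\<omega>. norm (U \<omega> (real n) (component j \<omega> x))) \<in> borel_measurable (restrict_space M W)"
      by (rule measurable_compose[OF measurable_U[OF _ c] nb]) simp
    ultimately have "(\<lambda>\<omega>. exp (- ?k * real n) * norm (component j \<omega> x) / norm (U \<omega> n (component j \<omega> x)))
        \<in> borel_measurable (restrict_space M W)" by measurable
    then show ?thesis unfolding h_def[abs_def]
      by (subst (asm) measurable_restrict_space_iff[where c = 0]) (use W_sets sets.sets_into_space in auto)
  qed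
  have "L \<in> borel_measurable M" unfolding L_def
    by (intro borel_measurable_SUP D(1)) (auto intro!: measurable_compose[OF measurable_flow])
  then have l_meas: "l \<in> borel_measurable M" unfolding l_def by measurable
  have h_le: "h n x (\<theta> (- real n) \<omega>) \<le> exp (l \<omega>)" if w: "\<omega> \<in> W" and x: "x \<in> D" for n x \<omega>
  proof -
    obtain K where K: "\<And>n e. e \<in> E j (\<theta> (- real n) \<omega>) \<Longrightarrow>
        norm e \<le> K * exp (?k * real n) * norm (U (\<theta> (- real n) \<omega>) n e)"
      using backward_bound[OF j w] by metis
    have "h m y (\<theta> (- real m) \<omega>) \<le> max K 0" for m y
    proof -
      let ?w = "\<theta> (- real m) \<omega>"
      have "norm (component j ?w y) \<le> K * exp (?k * real m) * norm (U ?w m (component j ?w y))"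
        by (intro K component_in j flow_W w)
      then have "exp (- ?k * real m) * norm (component j ?w y) \<le>
          exp (- ?k * real m) * (K * exp (?k * real m) * norm (U ?w m (component j ?w y)))"
        by (intro mult_left_mono) auto
      also have "\<dots> = K * norm (U ?w m (component j ?w y))"
        by (simp add: algebra_simps flip: exp_add)
      also have "\<dots> \<le> max K 0 * norm (U ?w m (component j ?w y))" by (intro mult_right_mono) auto
      finally have "exp (- ?k * real m) * norm (component j ?w y) \<le>
        max K 0 * norm (U ?w m (component j ?w y))" .
      then show ?thesis
        by (cases "U ?w m (component j ?w y) = 0") (simp_all add: h_def divide_le_eq)
    qed
    then have "L \<omega> \<le> ennreal (max K 0)" unfolding L_def
      by (intro SUP_least ennreal_leI)
    then have fin: "L \<omega> < \<infinity>" by (rule le_less_trans) simp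
    have "ennreal (h n x (\<theta> (- real n) \<omega>)) \<le> L \<omega>" unfolding L_def
      by (intro SUP_upper2[where i = n] SUP_upper2[where i = x] x UNIV_I order_refl)
    with fin have "h n x (\<theta> (- real n) \<omega>) \<le> enn2real (L \<omega>)"
      by (metis ennreal_le_iff ennreal_enn2real enn2real_nonneg infinity_ennreal_def)
    also have "\<dots> \<le> max 1 (enn2real (L \<omega>))" by simp
    finally show ?thesis by (simp add: l_def)
  qed
  have bound: "norm e \<le> exp (?k * real n + l \<omega>) * norm (U (\<theta> (- real n) \<omega>) n e)"
    if w: "\<omega> \<in> W" and e: "e \<in> E j (\<theta> (- real n) \<omega>)" for \<omega> n e
  proof -
    let ?w = "\<theta> (- real n) \<omega>"
    have w': "?w \<in> W" by (rule flow_W[OF w])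
    \<comment> \<open>The inequality is closed in \<open>x\<close>, so it passes from
      \<open>D\<close> to the whole space; at \<open>x = e\<close> the component is \<open>e\<close>
      itself.\<close>
    let ?S = "{x. norm (component j ?w x) \<le> exp (?k * real n + l \<omega>) * norm (U ?w n (component j ?w x))}"
    have cont: "continuous_on UNIV (component j ?w)"
      by (rule linear_continuous_on[OF bounded_linear_component[OF j w']])
    have "closed ?S" by (intro closed_Collect_le continuous_intros cont)
    moreover have "D \<subseteq> ?S"
    proof
      fix x assume x: "x \<in> D"
      let ?p = "component j ?w x"
      show "x \<in> ?S"
      proof (cases "U ?w n ?p = 0")
        case True
        then have "?p = 0" using U_injective[OF j w' component_in[OF j w'], of "real n" x] by simp
        then show ?thesis by simp
      next
        case False
        then have "exp (- ?k * real n) * norm ?p \<le> exp (l \<omega>) * norm (U ?w n ?p)"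
          using h_le[OF w x, of n] w' by (simp add: h_def divide_le_eq)
        then have "exp (?k * real n) * (exp (- ?k * real n) * norm ?p) \<le>
            exp (?k * real n) * (exp (l \<omega>) * norm (U ?w n ?p))" by (intro mult_left_mono) auto
        moreover have "exp (?k * real n) * (exp (- ?k * real n) * norm ?p) = norm ?p"
        proof -
          have "exp (?k * real n) * exp (- ?k * real n) = 1"
            by (simp add: algebra_simps flip: exp_add)
          then show ?thesis by (simp only: mult.assoc[symmetric] mult_1)
        qed
        ultimately have "norm ?p \<le> exp (?k * real n + l \<omega>) * norm (U ?w n ?p)"
          by (simp only: exp_add mult.assoc)
        then show ?thesis by simp
      qed
    qed
    ultimately have "?S = UNIV" using D(2) closure_minimal by blast
    then have "e \<in> ?S" by simp
    then show ?thesis by (simp add: component_id[OF j w' e])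
  qed
  \<comment> \<open>Each \<open>h n x\<close> at \<open>\<omega>\<close> is compared with
    \<open>h (n + 1) x\<close> at \<open>\<theta> 1 \<omega>\<close>: same starting vector, one more
    step. The step contributes \<open>a\<close>, the change of discount contributes
    \<open>?k\<close>.\<close>
  have "AE \<omega> in M. l \<omega> \<le> l (\<theta> 1 \<omega>) + (a \<omega> + ?k)"
    using AE_W a(3)
  proof eventually_elim
    case (elim \<omega>)
    let ?c = "exp (l (\<theta> 1 \<omega>) + (a \<omega> + ?k))"
    have "0 \<le> l \<omega>" for \<omega> by (simp add: l_def)
    then have c1: "1 \<le> ?c" using a(2)[of \<omega>] by simp
    have "h n x (\<theta> (- real n) \<omega>) \<le> ?c" if x: "x \<in> D" for n x
    proof -
      let ?w = "\<theta> (- real n) \<omega>"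
      let ?p = "component j ?w x"
      have sp: "\<omega> \<in> space M" by (rule W_space[OF elim(1)])
      have w': "?w \<in> W" by (rule flow_W[OF elim(1)])
      have w1: "\<theta> (- real (Suc n)) (\<theta> 1 \<omega>) = ?w"
        using flow_add[OF sp, of "- real (Suc n)" 1] by simp
      show ?thesis
      proof (cases "U ?w n ?p = 0")
        case True
        then show ?thesis using c1 by (simp add: h_def)
      next
        case False
        have U: "U ?w (real (Suc n)) ?p = U \<omega> 1 (U ?w n ?p)"
          using U_add[OF W_space[OF w'], of 1 "real n" ?p] flow_inverse(1)[OF sp, of "real n"]
          by (simp add: add.commute)
        have U0: "U ?w (real (Suc n)) ?p \<noteq> 0"
          using U_injective[OF j w' component_in[OF j w'], of "real (Suc n)" x] False
          by (auto simp: blinfun.zero_right)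
        have "norm (U ?w (real (Suc n)) ?p) \<le> exp (a \<omega>) * norm (U ?w n ?p)"
          unfolding U using norm_blinfun[of "U \<omega> 1" "U ?w n ?p"] elim(2)
          by (meson mult_right_mono norm_ge_zero order_trans)
        moreover have "exp (- ?k * real (Suc n)) * norm ?p \<le> exp (l (\<theta> 1 \<omega>)) * norm (U ?w (real (Suc n)) ?p)"
          using h_le[OF flow_W[OF elim(1), of 1] x, of "Suc n"] w' U0 unfolding w1
          by (simp add: h_def divide_le_eq)
        ultimately have "exp (- ?k * real (Suc n)) * norm ?p \<le>
            exp (l (\<theta> 1 \<omega>)) * (exp (a \<omega>) * norm (U ?w n ?p))"
          by (meson exp_ge_zero mult_left_mono order_trans)
        then have "exp ?k * (exp (- ?k * real (Suc n)) * norm ?p) \<le>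
            exp ?k * (exp (l (\<theta> 1 \<omega>)) * (exp (a \<omega>) * norm (U ?w n ?p)))"
          by (rule mult_left_mono) simp
        moreover have "exp ?k * (exp (- ?k * real (Suc n)) * norm ?p) = exp (- ?k * real n) * norm ?p"
        proof -
          have "exp ?k * exp (- ?k * real (Suc n)) = exp (- ?k * real n)"
            by (simp add: algebra_simps flip: exp_add)
          then show ?thesis by (simp only: mult.assoc[symmetric])
        qed
        ultimately have "exp (- ?k * real n) * norm ?p \<le> ?c * norm (U ?w n ?p)"
          by (simp only: exp_add mult_ac)
        then show ?thesis using False w' by (simp add: h_def divide_le_eq)
      qed
    qed
    then have "L \<omega> \<le> ennreal ?c" unfolding L_def by (intro SUP_least ennreal_leI)
    then have "enn2real (L \<omega>) \<le> ?c" by (intro enn2real_leI) auto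
    with c1 have "max 1 (enn2real (L \<omega>)) \<le> ?c" by simp
    then have "ln (max 1 (enn2real (L \<omega>))) \<le> ln ?c" by (intro ln_mono) auto
    then show ?case by (simp add: l_def)
  qed
  then have "AE \<omega> in M. \<forall>e>0. \<exists>K. \<forall>n::int. l (\<theta> (of_int n) \<omega>) \<le> K + e * \<bar>of_int n\<bar>"
    by (intro sublinear_along_orbits[where g = "\<lambda>\<omega>. a \<omega> + ?k"] l_meas) (use a in auto)
  then show ?thesis using bound by (rule that)
qed

end

section \<open>Transfer along a smoothing embedding\<close>

lemma norm_le_onorm_on:
  assumes f: "bounded_linear f" and x: "x \<in> S"
  shows "norm (f x) \<le> onorm_on S f * norm x"
proof (cases "x = 0")
  case True
  then show ?thesis using f by (simp add: linear_simps)
next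
  case False
  obtain K where K: "\<And>x. norm (f x) \<le> norm x * K" "0 \<le> K" using bounded_linear.nonneg_bounded[OF f] by blast
  have "bdd_above ((\<lambda>x. norm (f x) / norm x) ` S)"
    by (rule bdd_aboveI2[where M = K]) (use K in \<open>simp add: divide_le_eq mult.commute\<close>)
  then have "norm (f x) / norm x \<le> onorm_on S f"
    unfolding onorm_on_def by (intro cSUP_upper x)
  then show ?thesis using False by (simp add: divide_le_eq)
qed

lemma onorm_on_le:
  assumes "S \<noteq> {}" "0 \<le> b" "\<And>x. x \<in> S \<Longrightarrow> norm (f x) \<le> b * norm x"
  shows "onorm_on S f \<le> b"
  unfolding onorm_on_def using assms by (intro cSUP_least) (auto simp: divide_le_eq)

lemma onorm_on_nonneg:
  assumes "bounded_linear f" "subspace S"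
  shows "0 \<le> onorm_on S f"
proof (cases "S \<subseteq> {0}")
  case True
  then have "S = {0}" using subspace_0[OF assms(2)] by auto
  then show ?thesis by (simp add: onorm_on_def)
next
  case False
  then obtain x where x: "x \<in> S" "x \<noteq> 0" by auto
  have "0 \<le> onorm_on S f * norm x"
    using norm_le_onorm_on[OF assms(1) x(1)] norm_ge_zero order_trans by blast
  then show ?thesis using x(2) by (simp add: zero_le_mult_iff)
qed

text \<open>A sum may lie in the range although its terms do not; with \<open>S n\<close> inside the
  range every term can be pulled back separately.\<close>

lemma set_sum_vimage:
  assumes f: "linear f" "inj f" and I: "finite I" and S: "\<And>n. n \<in> I \<Longrightarrow> S n \<subseteq> range f"
  shows "(\<Sum>n\<in>I. f -` S n) = f -` (\<Sum>n\<in>I. S n)"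
proof (intro equalityI subsetI)
  fix x assume "x \<in> (\<Sum>n\<in>I. f -` S n)"
  then obtain s where s: "\<forall>n\<in>I. s n \<in> f -` S n" "x = (\<Sum>n\<in>I. s n)"
    unfolding mem_set_sum[OF I] by blast
  have "(\<Sum>n\<in>I. f (s n)) \<in> (\<Sum>n\<in>I. S n)"
    by (rule sum_mem_set_sum[OF I]) (use s(1) in blast)
  then show "x \<in> f -` (\<Sum>n\<in>I. S n)" unfolding s(2) vimage_eq linear_sum[OF f(1)] .
next
  fix x assume "x \<in> f -` (\<Sum>n\<in>I. S n)"
  then have "f x \<in> (\<Sum>n\<in>I. S n)" by (rule vimageD)
  then obtain s where s: "\<forall>n\<in>I. s n \<in> S n" "f x = (\<Sum>n\<in>I. s n)"
    unfolding mem_set_sum[OF I] by blast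
  have fs: "f (inv f (s n)) = s n" if "n \<in> I" for n
    using S[OF that] s(1) that by (intro f_inv_into_f) blast
  have "f (\<Sum>n\<in>I. inv f (s n)) = f x" by (simp add: linear_sum[OF f(1)] fs s(2))
  then have "x = (\<Sum>n\<in>I. inv f (s n))" using injD[OF f(2)] by metis
  moreover have "(\<Sum>n\<in>I. inv f (s n)) \<in> (\<Sum>n\<in>I. f -` S n)"
    using I fs s(1) by (intro sum_mem_set_sum) auto
  ultimately show "x \<in> (\<Sum>n\<in>I. f -` S n)" by simp
qed

text \<open>Once the \<open>A\<close>-part of \<open>f x\<close> is pulled back to \<open>y\<close>,
  the \<open>B\<close>-part is \<open>f (x - y)\<close>. So \<open>B\<close> may leave the range, as
  the spaces \<open>G j\<close> can.\<close>

lemma is_direct_sum_vimage: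
  assumes f: "linear f" "inj f" and A: "A \<subseteq> range f" and dir: "is_direct_sum A B V"
  shows "is_direct_sum (f -` A) (f -` B) (f -` V)"
proof -
  have V: "A + B = V" and AB: "A \<inter> B = {0}" using dir by (simp_all add: is_direct_sum_def)
  have "f -` A + f -` B = f -` V"
  proof (intro equalityI subsetI)
    fix x assume "x \<in> f -` A + f -` B"
    then obtain a b where "f a \<in> A" "f b \<in> B" "x = a + b" by (auto simp: mem_set_plus)
    then have "f x \<in> A + B" using f(1) by (simp add: linear_add set_plus_intro)
    then show "x \<in> f -` V" by (simp add: V)
  next
    fix x assume "x \<in> f -` V"
    then have "f x \<in> A + B" by (simp add: V)
    then obtain a b where ab: "a \<in> A" "b \<in> B" "f x = a + b" by (auto simp: mem_set_plus)
    then obtain y where y: "a = f y" using A by auto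
    have "f (x - y) = b" using ab(3) y by (simp add: linear_diff[OF f(1)])
    then have "y \<in> f -` A" "x - y \<in> f -` B" using ab y by auto
    then have "y + (x - y) \<in> f -` A + f -` B" by (rule set_plus_intro)
    then show "x \<in> f -` A + f -` B" by simp
  qed
  moreover have "f -` A \<inter> f -` B = {0}"
  proof -
    have "f -` A \<inter> f -` B = f -` {0}" using AB by (metis vimage_Int)
    also have "\<dots> = {0}" using linear_0[OF f(1)] injD[OF f(2)] by force
    finally show ?thesis .
  qed
  ultimately show ?thesis by (simp add: is_direct_sum_def)
qed

section \<open>Comparison of the two semiflows\<close>

locale smoothing_pair = S1: semiflow M \<theta> U1 + S2: semiflow M \<theta> U2
  for M :: "'w measure" and \<theta> :: "real \<Rightarrow> 'w \<Rightarrow> 'w"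
    and U1 :: "'w \<Rightarrow> real \<Rightarrow> ('a::banach \<Rightarrow>\<^sub>L 'a)"
    and U2 :: "'w \<Rightarrow> real \<Rightarrow> ('b::banach \<Rightarrow>\<^sub>L 'b)" +
  fixes i :: "'b \<Rightarrow>\<^sub>L 'a" and U12 :: "'w \<Rightarrow> ('a \<Rightarrow>\<^sub>L 'b)" and C :: real
  assumes inj_i: "inj (blinfun_apply i)"
    and intertwine: "\<And>\<omega> t. \<omega> \<in> space M \<Longrightarrow> 0 \<le> t \<Longrightarrow> U1 \<omega> t o\<^sub>L i = i o\<^sub>L U2 \<omega> t"
    and factor1: "\<And>\<omega>. \<omega> \<in> space M \<Longrightarrow> U1 \<omega> 1 = i o\<^sub>L U12 \<omega>"
    and factor2: "\<And>\<omega>. \<omega> \<in> space M \<Longrightarrow> U2 \<omega> 1 = U12 \<omega> o\<^sub>L i"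
    and C_pos: "C > 0" and U12_norm: "\<And>\<omega>. \<omega> \<in> space M \<Longrightarrow> norm (U12 \<omega>) \<le> C"
    and borel_vimage: "\<And>A. A \<in> sets borel \<Longrightarrow> \<exists>B\<in>sets borel. A = blinfun_apply i -` B"
begin

lemma i_U2: "\<omega> \<in> space M \<Longrightarrow> 0 \<le> t \<Longrightarrow> i (U2 \<omega> t y) = U1 \<omega> t (i y)"
  using intertwine[of \<omega> t] by (metis blinfun_apply_blinfun_compose)

lemma i_U12: "\<omega> \<in> space M \<Longrightarrow> i (U12 \<omega> x) = U1 \<omega> 1 x"
  using factor1[of \<omega>] by simp

lemma U12_i: "\<omega> \<in> space M \<Longrightarrow> U12 \<omega> (i y) = U2 \<omega> 1 y"
  using factor2[of \<omega>] by simp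

lemma i_eq_iff: "i x = i y \<longleftrightarrow> x = y"
  using inj_i by (auto dest: injD)

lemma linear_i: "linear (blinfun_apply i)"
  using bounded_linear.linear blinfun.bounded_linear_right by blast

text \<open>The added 1 keeps the constant positive, as the growth-rate sandwiches require, even
  when \<open>norm i\<close> is 0.\<close>

definition I :: real where "I = norm i + 1"

lemma I_pos: "0 < I"
  by (simp add: I_def add_nonneg_pos)

lemma norm_i_le: "norm (i y) \<le> I * norm y"
  using norm_blinfun[of i y] norm_ge_zero[of y] unfolding I_def distrib_right by linarith

lemma norm_U12_le: "\<omega> \<in> space M \<Longrightarrow> norm (U12 \<omega> x) \<le> C * norm x"
  using norm_blinfun[of "U12 \<omega>" x] U12_norm[of \<omega>] by (meson mult_right_mono norm_ge_zero order_trans)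

lemma U2_Suc:
  assumes w: "\<omega> \<in> space M" and t: "0 \<le> t"
  shows "U2 \<omega> (t + 1) y = U12 (\<theta> t \<omega>) (U1 \<omega> t (i y))"
proof -
  have "U2 \<omega> (t + 1) y = U2 (\<theta> t \<omega>) 1 (U2 \<omega> t y)"
    using S2.U_add[OF w, of 1 t y] t by (simp add: add.commute)
  then show ?thesis using S1.flow_in_space[OF w, of t] by (simp add: i_U2[OF w t, symmetric] U12_i)
qed

text \<open>Smoothing acts in the first time unit here and in the last one in \<open>U2_Suc\<close>.
  Hence \<open>U1\<close> from \<open>\<omega>\<close> is compared with \<open>U2\<close> from
  \<open>\<theta> 1 \<omega>\<close>, and the norm comparisons involve two base points.\<close>

lemma U1_Suc:
  assumes w: "\<omega> \<in> space M" and t: "0 \<le> t"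
  shows "U1 \<omega> (t + 1) x = i (U2 (\<theta> 1 \<omega>) t (U12 \<omega> x))"
  using S1.U_add[OF w, of t 1 x] t by (simp add: i_U2 S1.flow_in_space[OF w] i_U12[OF w])

lemma norm_U2_Suc_le:
  assumes "\<omega> \<in> space M" "0 \<le> t"
  shows "norm (U2 \<omega> (t + 1) y) \<le> C * norm (U1 \<omega> t (i y))"
  unfolding U2_Suc[OF assms] by (rule norm_U12_le[OF S1.flow_in_space[OF assms(1)]])

lemma onorm_U2_Suc_le:
  assumes "\<omega> \<in> space M" "0 \<le> t"
  shows "norm (U2 \<omega> (t + 1)) \<le> C * I * norm (U1 \<omega> t)"
proof (rule norm_blinfun_bound)
  fix y
  have "norm (U1 \<omega> t (i y)) \<le> norm (U1 \<omega> t) * (I * norm y)"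
    using norm_blinfun[of "U1 \<omega> t" "i y"] norm_i_le[of y] by (meson mult_left_mono norm_ge_zero order_trans)
  then have "C * norm (U1 \<omega> t (i y)) \<le> C * (norm (U1 \<omega> t) * (I * norm y))"
    using C_pos by (intro mult_left_mono) auto
  with norm_U2_Suc_le[OF assms, of y] show "norm (U2 \<omega> (t + 1) y) \<le> C * I * norm (U1 \<omega> t) * norm y"
    by (simp add: mult_ac)
qed (use C_pos I_pos in simp)

lemma onorm_U1_Suc_le:
  assumes w: "\<omega> \<in> space M" and t: "0 \<le> t"
  shows "norm (U1 \<omega> (t + 1)) \<le> I * C * norm (U2 (\<theta> 1 \<omega>) t)"
proof (rule norm_blinfun_bound)
  fix x
  have "norm (U1 \<omega> (t + 1) x) \<le> I * norm (U2 (\<theta> 1 \<omega>) t (U12 \<omega> x))"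
    unfolding U1_Suc[OF assms] by (rule norm_i_le)
  also have "\<dots> \<le> I * (norm (U2 (\<theta> 1 \<omega>) t) * (C * norm x))"
    using I_pos by (intro mult_left_mono order_trans[OF norm_blinfun mult_left_mono[OF norm_U12_le[OF w]]]) auto
  finally show "norm (U1 \<omega> (t + 1) x) \<le> I * C * norm (U2 (\<theta> 1 \<omega>) t) * norm x"
    by (simp add: mult_ac)
qed (use C_pos I_pos in simp)

text \<open>One of the two norm bounds moves the base point by a time unit, so the limit is needed
  at \<open>\<omega>\<close> and at a translate of it; measure preservation supplies both almost
  everywhere.\<close>

lemma AE_growth_rate_iff:
  "(AE \<omega> in M. (growth_rate (\<lambda>t. norm (U1 \<omega> t)) \<longlongrightarrow> l) at_top) \<longleftrightarrow>
   (AE \<omega> in M. (growth_rate (\<lambda>t. norm (U2 \<omega> t)) \<longlongrightarrow> l) at_top)"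
proof
  assume 1: "AE \<omega> in M. (growth_rate (\<lambda>t. norm (U1 \<omega> t)) \<longlongrightarrow> l) at_top"
  from 1 S1.AE_flow[OF 1, of "- 1"] show "AE \<omega> in M. (growth_rate (\<lambda>t. norm (U2 \<omega> t)) \<longlongrightarrow> l) at_top"
    using AE_space
  proof eventually_elim
    case (elim \<omega>)
    show ?case
    proof (rule growth_rate_sandwich_at_top[OF elim(2,1), where T = 1 and a = 1 and b = "- 1"])
      show "0 < I * C" "0 < C * I" using I_pos C_pos by simp_all
      show "norm (U1 (\<theta> (- 1) \<omega>) (t + 1)) \<le> I * C * norm (U2 \<omega> t)" if "1 \<le> t" for t
        using onorm_U1_Suc_le[OF S1.flow_in_space[OF elim(3)], of t "- 1"] that
          S1.flow_inverse(1)[OF elim(3), of 1] by simp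
      show "norm (U2 \<omega> t) \<le> C * I * norm (U1 \<omega> (t + - 1))" if "1 \<le> t" for t
        using onorm_U2_Suc_le[OF elim(3), of "t - 1"] that by simp
    qed
  qed
next
  assume 1: "AE \<omega> in M. (growth_rate (\<lambda>t. norm (U2 \<omega> t)) \<longlongrightarrow> l) at_top"
  from 1 S1.AE_flow[OF 1, of 1] show "AE \<omega> in M. (growth_rate (\<lambda>t. norm (U1 \<omega> t)) \<longlongrightarrow> l) at_top"
    using AE_space
  proof eventually_elim
    case (elim \<omega>)
    show ?case
    proof (rule growth_rate_sandwich_at_top[OF elim(1,2), where T = 1 and a = 1 and b = "- 1"])
      show "0 < C * I" "0 < I * C" using I_pos C_pos by simp_all
      show "norm (U2 \<omega> (t + 1)) \<le> C * I * norm (U1 \<omega> t)" if "1 \<le> t" for t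
        using onorm_U2_Suc_le[OF elim(3), of t] that by simp
      show "norm (U1 \<omega> t) \<le> I * C * norm (U2 (\<theta> 1 \<omega>) (t + - 1))" if "1 \<le> t" for t
        using onorm_U1_Suc_le[OF elim(3), of "t - 1"] that by simp
    qed
  qed
qed

lemma top_exponent_eq: "top_exponent M U2 = top_exponent M U1"
  unfolding top_exponent_def AE_growth_rate_iff ..

lemma growth_rate_i:
  assumes w: "\<omega> \<in> space M" and l: "(growth_rate (\<lambda>t. norm (U1 \<omega> t (i u))) \<longlongrightarrow> l) at_top"
  shows "(growth_rate (\<lambda>t. norm (U2 \<omega> t u)) \<longlongrightarrow> l) at_top"
proof (rule growth_rate_sandwich_at_top[OF l l I_pos C_pos, where T = 1 and a = 0 and b = "- 1"])
  show "norm (U1 \<omega> (t + 0) (i u)) \<le> I * norm (U2 \<omega> t u)" if "1 \<le> t" for t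
    using norm_i_le[of "U2 \<omega> t u"] i_U2[OF w, of t u] that by simp
  show "norm (U2 \<omega> t u) \<le> C * norm (U1 \<omega> (t + - 1) (i u))" if "1 \<le> t" for t
    using norm_U2_Suc_le[OF w, of "t - 1" u] that by simp
qed

lemma measurable_i: "blinfun_apply i \<in> borel \<rightarrow>\<^sub>M borel"
  by (intro borel_measurable_continuous_onI continuous_intros)

lemma measurable_lift:
  assumes "g \<in> N \<rightarrow>\<^sub>M borel" "\<And>x. x \<in> space N \<Longrightarrow> i (f x) = g x"
  shows "f \<in> N \<rightarrow>\<^sub>M borel"
proof (rule measurableI)
  fix A :: "'b set" assume "A \<in> sets borel"
  then obtain B where B: "B \<in> sets borel" "A = blinfun_apply i -` B" using borel_vimage by blast
  have "f -` A \<inter> space N = g -` B \<inter> space N" using assms(2) by (auto simp: B(2))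
  then show "f -` A \<inter> space N \<in> sets N" using measurable_sets[OF assms(1) B(1)] by simp
qed simp

lemma semiorbit_i:
  assumes w: "\<omega> \<in> space M" and v: "negative_semiorbit \<theta> U2 \<omega> u v"
  shows "negative_semiorbit \<theta> U1 \<omega> (i u) (\<lambda>s. i (v s))"
  using v measurable_compose[OF _ measurable_i, of v] S1.flow_in_space[OF w]
  by (auto simp: negative_semiorbit_def i_U2)

text \<open>\<open>U12\<close> over the preceding time unit defines the lift at \<open>s\<close>.
  The value at \<open>s - 1\<close> is available because a negative semiorbit reaches back
  indefinitely.\<close>

lemma semiorbit_lift:
  assumes w: "\<omega> \<in> space M" and v: "negative_semiorbit \<theta> U1 \<omega> (i u) v"
  obtains v' where "negative_semiorbit \<theta> U2 \<omega> u v'" "\<And>s. s \<le> 0 \<Longrightarrow> i (v' s) = v s"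
proof -
  define v' where "v' s = U12 (\<theta> (s - 1) \<omega>) (v (s - 1))" for s
  have step: "v (s + t) = U1 (\<theta> s \<omega>) t (v s)" if "s \<le> 0" "0 \<le> t" "s + t \<le> 0" for s t
    using v that unfolding negative_semiorbit_def by blast
  have iv: "i (v' s) = v s" if "s \<le> 0" for s
    using step[of "s - 1" 1] that by (simp add: v'_def i_U12 S1.flow_in_space[OF w])
  have "negative_semiorbit \<theta> U2 \<omega> u v'" unfolding negative_semiorbit_def
  proof (intro conjI allI impI)
    show "v' \<in> restrict_space borel {..0} \<rightarrow>\<^sub>M borel"
      by (rule measurable_lift[where g = v]) (use v iv in \<open>auto simp: negative_semiorbit_def space_restrict_space\<close>)
    have "i (v' 0) = i u" using iv[of 0] v by (simp add: negative_semiorbit_def)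
    then show "v' 0 = u" by (simp add: i_eq_iff)
    fix s t :: real assume st: "s \<le> 0 \<and> 0 \<le> t \<and> s + t \<le> 0"
    then have "i (v' (s + t)) = U1 (\<theta> s \<omega>) t (i (v' s))" using iv step by simp
    also have "\<dots> = i (U2 (\<theta> s \<omega>) t (v' s))" using st by (simp add: i_U2 S1.flow_in_space[OF w])
    finally show "v' (s + t) = U2 (\<theta> s \<omega>) t (v' s)" by (simp add: i_eq_iff)
  qed
  with iv show ?thesis using that by blast
qed

lemma semiorbit_growth_rate:
  assumes w: "\<omega> \<in> space M" and v: "negative_semiorbit \<theta> U2 \<omega> u v"
  shows "(growth_rate (\<lambda>s. norm (i (v s))) \<longlongrightarrow> l) at_bot \<longleftrightarrow> (growth_rate (\<lambda>s. norm (v s)) \<longlongrightarrow> l) at_bot"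
proof -
  have step: "norm (v (s + 1)) \<le> C * norm (i (v s))" if "s \<le> - 1" for s
  proof -
    have "v (s + 1) = U2 (\<theta> s \<omega>) 1 (v s)" using v that unfolding negative_semiorbit_def by auto
    also have "\<dots> = U12 (\<theta> s \<omega>) (i (v s))" by (simp add: U12_i S1.flow_in_space[OF w])
    finally show ?thesis using norm_U12_le[OF S1.flow_in_space[OF w]] by simp
  qed
  show ?thesis
  proof
    assume l: "(growth_rate (\<lambda>s. norm (i (v s))) \<longlongrightarrow> l) at_bot"
    show "(growth_rate (\<lambda>s. norm (v s)) \<longlongrightarrow> l) at_bot"
    proof (rule growth_rate_sandwich_at_bot[OF l l I_pos C_pos, where T = 0 and a = 0 and b = "- 1"])
      show "norm (v t) \<le> C * norm (i (v (t + - 1)))" if "t \<le> 0" for t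
        using step[of "t - 1"] that by simp
    qed (simp add: norm_i_le)
  next
    assume l: "(growth_rate (\<lambda>s. norm (v s)) \<longlongrightarrow> l) at_bot"
    show "(growth_rate (\<lambda>s. norm (i (v s))) \<longlongrightarrow> l) at_bot"
      by (rule growth_rate_sandwich_at_bot[OF l l C_pos I_pos, where T = "- 1" and a = 1 and b = 0])
        (simp_all add: norm_i_le step)
  qed
qed

text \<open>\<open>F'\<close> is the subspace one time unit earlier. \<open>U12\<close> carries it
  into the preimage of \<open>F\<close>, so \<open>U1\<close> on \<open>F'\<close> factors through
  \<open>U2\<close> on that preimage, which bounds the restricted norm from below.\<close>

lemma growth_rate_onorm_on:
  assumes w: "\<omega> \<in> space M" and F: "subspace F" "subspace F'"
    and F': "U1 (\<theta> (- 1) \<omega>) 1 ` F' \<subseteq> F"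
    and l: "(growth_rate (\<lambda>t. onorm_on F (U1 \<omega> t)) \<longlongrightarrow> l) at_top"
      "(growth_rate (\<lambda>t. onorm_on F' (U1 (\<theta> (- 1) \<omega>) t)) \<longlongrightarrow> l) at_top"
  shows "(growth_rate (\<lambda>t. onorm_on (blinfun_apply i -` F) (U2 \<omega> t)) \<longlongrightarrow> l) at_top"
proof (rule growth_rate_sandwich_at_top[OF l(2,1), where T = 1 and a = 1 and b = "- 1"])
  show "0 < I * C" "0 < C * I" using I_pos C_pos by simp_all
  let ?w = "\<theta> (- 1) \<omega>"
  let ?F = "blinfun_apply i -` F"
  have w': "?w \<in> space M" by (rule S1.flow_in_space[OF w])
  have \<theta>1: "\<theta> 1 ?w = \<omega>" using S1.flow_inverse(1)[OF w, of 1] by simp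
  have bl: "bounded_linear (blinfun_apply A)" for A :: "'x::real_normed_vector \<Rightarrow>\<^sub>L 'y::real_normed_vector"
    by (rule blinfun.bounded_linear_right)
  have sF: "subspace ?F" by (rule linear_subspace_vimage[OF linear_i F(1)])
  fix t :: real assume t: "1 \<le> t"
  show "onorm_on F' (U1 ?w (t + 1)) \<le> I * C * onorm_on ?F (U2 \<omega> t)"
  proof (rule onorm_on_le)
    show "0 \<le> I * C * onorm_on ?F (U2 \<omega> t)"
      using I_pos C_pos onorm_on_nonneg[OF bl sF, of "U2 \<omega> t"] by simp
    fix x assume x: "x \<in> F'"
    have "U12 ?w x \<in> ?F" using F' x i_U12[OF w', of x] by auto
    then have 1: "norm (U2 \<omega> t (U12 ?w x)) \<le> onorm_on ?F (U2 \<omega> t) * norm (U12 ?w x)"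
      by (rule norm_le_onorm_on[OF bl])
    have "norm (U1 ?w (t + 1) x) \<le> I * norm (U2 \<omega> t (U12 ?w x))"
      using U1_Suc[OF w', of t x] t norm_i_le by (simp add: \<theta>1)
    also have "\<dots> \<le> I * (onorm_on ?F (U2 \<omega> t) * (C * norm x))"
      using I_pos norm_U12_le[OF w', of x] onorm_on_nonneg[OF bl sF, of "U2 \<omega> t"]
      by (intro mult_left_mono order_trans[OF 1]) auto
    finally show "norm (U1 ?w (t + 1) x) \<le> I * C * onorm_on ?F (U2 \<omega> t) * norm x"
      by (simp add: mult_ac)
  qed (use subspace_0[OF F(2)] in auto)
  show "onorm_on ?F (U2 \<omega> t) \<le> C * I * onorm_on F (U1 \<omega> (t + - 1))"
  proof (rule onorm_on_le)
    show "0 \<le> C * I * onorm_on F (U1 \<omega> (t + - 1))"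
      using I_pos C_pos onorm_on_nonneg[OF bl F(1), of "U1 \<omega> (t + - 1)"] by simp
    fix y assume y: "y \<in> ?F"
    have "norm (U2 \<omega> t y) \<le> C * norm (U1 \<omega> (t + - 1) (i y))"
      using norm_U2_Suc_le[OF w, of "t - 1" y] t by simp
    also have "norm (U1 \<omega> (t + - 1) (i y)) \<le> onorm_on F (U1 \<omega> (t + - 1)) * norm (i y)"
      by (rule norm_le_onorm_on[OF bl]) (use y in simp)
    also have "\<dots> \<le> onorm_on F (U1 \<omega> (t + - 1)) * (I * norm y)"
      by (intro mult_left_mono norm_i_le onorm_on_nonneg[OF bl F(1)])
    finally show "norm (U2 \<omega> t y) \<le> C * I * onorm_on F (U1 \<omega> (t + - 1)) * norm y"
      using C_pos by (simp add: mult_ac)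
  qed (use subspace_0[OF sF] in blast)
qed

end

section \<open>The preimage splitting and its temperedness\<close>

locale smoothing_transfer =
  smoothing_pair M \<theta> U1 U2 i U12 C + O: oseledets_splitting M \<theta> U1 W J lam E G
  for M :: "'w measure" and \<theta> :: "real \<Rightarrow> 'w \<Rightarrow> 'w"
    and U1 :: "'w \<Rightarrow> real \<Rightarrow> ('a::banach \<Rightarrow>\<^sub>L 'a)"
    and U2 :: "'w \<Rightarrow> real \<Rightarrow> ('b::banach \<Rightarrow>\<^sub>L 'b)"
    and i :: "'b \<Rightarrow>\<^sub>L 'a" and U12 :: "'w \<Rightarrow> ('a \<Rightarrow>\<^sub>L 'b)" and C :: real
    and W :: "'w set" and J :: "nat set" and lam :: "nat \<Rightarrow> real"
    and E G :: "nat \<Rightarrow> 'w \<Rightarrow> 'a set" +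
  assumes separable: "separable_space (euclidean :: 'a topology)"
    and E1: "standing_E1 M \<theta> U1"
begin

abbreviation E2 :: "nat \<Rightarrow> 'w \<Rightarrow> 'b set" where "E2 j \<omega> \<equiv> blinfun_apply i -` E j \<omega>"
abbreviation G2 :: "nat \<Rightarrow> 'w \<Rightarrow> 'b set" where "G2 j \<omega> \<equiv> blinfun_apply i -` G j \<omega>"

abbreviation proj2 :: "nat \<Rightarrow> 'w \<Rightarrow> 'b \<Rightarrow> 'b"
  where "proj2 j \<omega> \<equiv> projection_along (\<Sum>n=1..j. E2 n \<omega>) (G2 j \<omega>)"

lemma E_range:
  assumes j: "j \<in> J" and w: "\<omega> \<in> W"
  shows "E j \<omega> \<subseteq> range i"
proof
  fix e assume e: "e \<in> E j \<omega>"
  have w': "\<theta> (- 1) \<omega> \<in> W" by (rule O.flow_W[OF w])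
  have "U1 (\<theta> (- 1) \<omega>) 1 ` E j (\<theta> (- 1) \<omega>) = E j \<omega>"
    using O.U_E[OF j w', of 1] S1.flow_inverse(1)[OF O.W_space[OF w], of 1] by simp
  with e obtain x where "e = U1 (\<theta> (- 1) \<omega>) 1 x" by blast
  then have "e = i (U12 (\<theta> (- 1) \<omega>) x)" by (simp add: i_U12 O.W_space[OF w'])
  then show "e \<in> range i" by blast
qed

lemma E_lower_range: "j \<in> J \<Longrightarrow> \<omega> \<in> W \<Longrightarrow> n \<in> {1..j} \<Longrightarrow> E n \<omega> \<subseteq> range i"
  using O.J_down by (intro E_range) auto

lemma sum_E2: "j \<in> J \<Longrightarrow> \<omega> \<in> W \<Longrightarrow> (\<Sum>n=1..j. E2 n \<omega>) = blinfun_apply i -` (\<Sum>n=1..j. E n \<omega>)"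
  by (intro set_sum_vimage linear_i inj_i E_lower_range) auto

lemma sum_E_range:
  assumes "j \<in> J" "\<omega> \<in> W" shows "(\<Sum>n=1..j. E n \<omega>) \<subseteq> range i"
proof
  fix x assume "x \<in> (\<Sum>n=1..j. E n \<omega>)"
  then have "\<exists>s. (\<forall>n\<in>{1..j}. s n \<in> E n \<omega>) \<and> x = (\<Sum>n=1..j. s n)"
    by (subst (asm) mem_set_sum) simp_all
  then obtain s where s: "\<forall>n\<in>{1..j}. s n \<in> E n \<omega>" "x = (\<Sum>n=1..j. s n)" by blast
  have "subspace (range i)" by (rule linear_subspace_image[OF linear_i subspace_UNIV])
  then show "x \<in> range i" unfolding s(2)
    using s(1) E_lower_range[OF assms] by (intro subspace_sum) blast+
qed

lemma vimage_subspace: "subspace S \<Longrightarrow> subspace (blinfun_apply i -` S)"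
  by (rule linear_subspace_vimage[OF linear_i])

lemma vimage_closed: "closed S \<Longrightarrow> closed (blinfun_apply i -` S)"
  by (intro closed_vimage continuous_intros)

lemma direct2:
  assumes "j \<in> J" "\<omega> \<in> W"
  shows "is_direct_sum (\<Sum>n=1..j. E2 n \<omega>) (G2 j \<omega>) UNIV"
  using is_direct_sum_vimage[OF linear_i inj_i sum_E_range[OF assms] O.direct[OF assms]]
  by (simp only: sum_E2[OF assms] vimage_UNIV)

lemma span_vimage:
  assumes "S = span B" "B \<subseteq> range i"
  shows "blinfun_apply i -` S = span (inv (blinfun_apply i) ` B)"
proof -
  have "(\<lambda>x. i (inv (blinfun_apply i) x)) ` B = (\<lambda>x. x) ` B"
    using assms(2) by (intro image_cong refl f_inv_into_f) blast
  then have "i ` inv (blinfun_apply i) ` B = B" by (simp add: image_image)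
  then have "S = i ` span (inv (blinfun_apply i) ` B)"
    by (simp add: assms(1) flip: linear_span_image[OF linear_i])
  then show ?thesis by (simp add: inj_vimage_image_eq[OF inj_i])
qed

lemma independent_of_image:
  assumes "independent (i ` S)" shows "independent S"
proof
  assume "dependent S"
  then obtain a where a: "a \<in> S" "a \<in> span (S - {a})" unfolding dependent_def by blast
  have "i a \<in> span (i ` (S - {a}))" using a(2) linear_span_image[OF linear_i] by blast
  moreover have "i ` (S - {a}) = i ` S - {i a}" by (simp add: image_set_diff[OF inj_i])
  ultimately show False using assms a(1) unfolding dependent_def by auto
qed

lemma E2_measurable:
  assumes j: "j \<in> J"
  shows "\<exists>l. measurable_subspaces M W l (E2 j)"
proof -
  obtain l and v :: "nat \<Rightarrow> 'w \<Rightarrow> 'a" where v: "\<And>n. n < l \<Longrightarrow> v n \<in> restrict_space M W \<rightarrow>\<^sub>M borel"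
      "\<And>\<omega>. \<omega> \<in> W \<Longrightarrow> inj_on (\<lambda>n. v n \<omega>) {..<l}" "\<And>\<omega>. \<omega> \<in> W \<Longrightarrow> independent ((\<lambda>n. v n \<omega>) ` {..<l})"
      "\<And>\<omega>. \<omega> \<in> W \<Longrightarrow> span ((\<lambda>n. v n \<omega>) ` {..<l}) = E j \<omega>"
    using O.E_measurable[OF j] unfolding measurable_subspaces_def by blast
  define v' where "v' n \<omega> = inv (blinfun_apply i) (v n \<omega>)" for n \<omega>
  have range: "v n \<omega> \<in> range i" if "\<omega> \<in> W" "n < l" for n \<omega>
  proof -
    have "v n \<omega> \<in> span ((\<lambda>n. v n \<omega>) ` {..<l})" by (rule span_base) (use that(2) in blast)
    then show ?thesis unfolding v(4)[OF that(1)] using E_range[OF j that(1)] by blast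
  qed
  have iv': "i (v' n \<omega>) = v n \<omega>" if "\<omega> \<in> W" "n < l" for n \<omega>
    unfolding v'_def by (rule f_inv_into_f[OF range[OF that]])
  show ?thesis unfolding measurable_subspaces_def
  proof (intro exI[of _ l] exI[of _ v'] conjI allI impI ballI)
    fix n assume n: "n < l"
    show "v' n \<in> restrict_space M W \<rightarrow>\<^sub>M borel"
      by (rule measurable_lift[OF v(1)[OF n]]) (use n iv' in \<open>simp add: space_restrict_space\<close>)
  next
    fix \<omega> assume w: "\<omega> \<in> W"
    have im: "i ` (\<lambda>n. v' n \<omega>) ` {..<l} = (\<lambda>n. v n \<omega>) ` {..<l}"
      unfolding image_image by (rule image_cong) (use iv'[OF w] in auto)
    show "inj_on (\<lambda>n. v' n \<omega>) {..<l}"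
    proof (rule inj_onI)
      fix m n assume "m \<in> {..<l}" "n \<in> {..<l}" "v' m \<omega> = v' n \<omega>"
      moreover from this have "v m \<omega> = v n \<omega>" using iv'[OF w] by (metis lessThan_iff)
      ultimately show "m = n" using v(2)[OF w] by (auto dest: inj_onD)
    qed
    show "independent ((\<lambda>n. v' n \<omega>) ` {..<l})"
    proof (rule independent_of_image)
      show "independent (i ` (\<lambda>n. v' n \<omega>) ` {..<l})" unfolding im by (rule v(3)[OF w])
    qed
    have "E2 j \<omega> = span (inv (blinfun_apply i) ` (\<lambda>n. v n \<omega>) ` {..<l})"
      by (rule span_vimage[OF v(4)[OF w, symmetric]]) (use range[OF w] in auto)
    then show "span ((\<lambda>n. v' n \<omega>) ` {..<l}) = E2 j \<omega>" by (simp add: v'_def image_image)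
  qed
qed

lemma E2_span:
  assumes "j \<in> J" "\<omega> \<in> W"
  shows "\<exists>B. finite B \<and> E2 j \<omega> = span B"
  using E2_measurable[OF assms(1)] measurable_subspaces_span[OF _ assms(2)] by metis

lemma sum_E2_span:
  assumes "j \<in> J" "\<omega> \<in> W"
  shows "\<exists>B. finite B \<and> (\<Sum>n=1..j. E2 n \<omega>) = span B"
  using O.J_down[OF assms(1)] by (intro set_sum_finite_dimensional E2_span assms(2)) auto

text \<open>\<open>i\<close> maps the splitting of \<open>u\<close> to a splitting of
  \<open>i u\<close>, and the latter is unique. Strong measurability of \<open>proj2\<close> follows
  from this identity by \<open>measurable_lift\<close>.\<close>

lemma i_proj2:
  assumes j: "j \<in> J" and w: "\<omega> \<in> W"
  shows "i (proj2 j \<omega> u) = O.proj j \<omega> (i u)"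
proof -
  have E: "subspace (\<Sum>n=1..j. E2 n \<omega>)" using sum_E2_span[OF j w] by auto
  have G: "subspace (G2 j \<omega>)" by (rule vimage_subspace[OF O.G_subspace[OF j w]])
  note P = projection_along(1,2)[OF E G direct2[OF j w], of u]
  have "i u - i (proj2 j \<omega> u) \<in> (\<Sum>n=1..j. E n \<omega>)"
    using P(2) unfolding sum_E2[OF j w] by (simp add: blinfun.diff_right)
  moreover have "i (proj2 j \<omega> u) \<in> G j \<omega>" using P(1) by simp
  ultimately show ?thesis using j by (intro O.proj_eq[OF _ w, symmetric]) auto
qed

lemma proj2_measurable:
  assumes "j \<in> J" shows "strongly_measurable M W (proj2 j)"
  unfolding strongly_measurable_def
proof
  fix u
  show "(\<lambda>\<omega>. proj2 j \<omega> u) \<in> restrict_space M W \<rightarrow>\<^sub>M borel"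
  proof (rule measurable_lift)
    show "(\<lambda>\<omega>. O.proj j \<omega> (i u)) \<in> restrict_space M W \<rightarrow>\<^sub>M borel"
      using O.proj_measurable[OF assms] by (simp add: strongly_measurable_def)
    show "i (proj2 j \<omega> u) = O.proj j \<omega> (i u)" if "\<omega> \<in> space (restrict_space M W)" for \<omega>
      using that by (intro i_proj2 assms) (auto simp: space_restrict_space)
  qed
qed

text \<open>Write \<open>e = U(1) e'\<close> with \<open>e'\<close> one time unit earlier, so that \<open>i\<^sup>-\<^sup>1 e = U\<^sup>(\<^sup>1\<^sup>,\<^sup>2\<^sup>) e'\<close>, and compare
  \<open>e'\<close> with \<open>e\<close> through the integer times \<open>\<lfloor>t\<rfloor> - 1\<close> and \<open>\<lfloor>t\<rfloor> + 1\<close> enclosing \<open>t - 1\<close> and \<open>t\<close>.\<close>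

lemma norm_lift_le:
  assumes j: "j \<in> J" and w: "\<omega> \<in> W" and y: "i y \<in> E j (\<theta> t \<omega>)"
    and m: "m = \<lfloor>t\<rfloor> - 1"
    and a: "\<forall>s\<in>{0..1}. norm (U1 (\<theta> (of_int m) \<omega>) s) \<le> exp a"
    and b: "\<forall>s\<in>{0..1}. norm (U1 (\<theta> s (\<theta> (of_int (m + 1)) \<omega>)) (1 - s)) \<le> exp b"
    and c: "\<And>e. e \<in> E j (\<theta> (of_int m) \<omega>) \<Longrightarrow> norm e \<le> c * norm (U1 (\<theta> (of_int m) \<omega>) 2 e)" "0 \<le> c"
  shows "norm y \<le> C * (exp a * (c * exp b)) * norm (i y)"
proof -
  have sp: "\<omega> \<in> space M" by (rule O.W_space[OF w])
  have m01: "of_int m + 1 \<le> t" "t \<le> of_int m + 2" using m by linarith+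
  let ?\<tau> = "\<theta> (t - 1) \<omega>" and ?\<sigma> = "\<theta> (of_int m) \<omega>"
  have W': "\<theta> s \<omega> \<in> W" "\<theta> s \<omega> \<in> space M" for s using O.flow_W[OF w] O.W_space by blast+
  have \<theta>: "\<theta> r (\<theta> s \<omega>) = \<theta> (r + s) \<omega>" for r s using S1.flow_add[OF sp, of r s] by simp
  have "U1 ?\<tau> 1 ` E j ?\<tau> = E j (\<theta> t \<omega>)" using O.U_E[OF j W'(1), of 1 "t - 1"] by (simp add: \<theta>)
  with y obtain e1 where e1: "e1 \<in> E j ?\<tau>" "i y = U1 ?\<tau> 1 e1" by blast
  have "U1 ?\<sigma> (t - 1 - of_int m) ` E j ?\<sigma> = E j ?\<tau>"
    using O.U_E[OF j W'(1), of "t - 1 - of_int m" "of_int m"] m01 by (simp add: \<theta>)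
  with e1(1) obtain e2 where e2: "e2 \<in> E j ?\<sigma>" "e1 = U1 ?\<sigma> (t - 1 - of_int m) e2" by blast
  have "i y = i (U12 ?\<tau> e1)" using e1(2) by (simp add: i_U12 W')
  then have "y = U12 ?\<tau> e1" by (simp add: i_eq_iff)
  then have 1: "norm y \<le> C * norm e1" using norm_U12_le[OF W'(2)] by simp
  have "norm e1 \<le> norm (U1 ?\<sigma> (t - 1 - of_int m)) * norm e2" unfolding e2(2) by (rule norm_blinfun)
  also have "\<dots> \<le> exp a * norm e2" using a m01 by (intro mult_right_mono) auto
  finally have 2: "norm e1 \<le> exp a * norm e2" .
  have "i y = U1 ?\<sigma> (t - of_int m) e2"
    using S1.U_add[OF W'(2), of 1 "t - 1 - of_int m" "of_int m" e2] m01 e1(2) e2(2) by (simp add: \<theta>)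
  \<comment> \<open>The stretch from \<open>t\<close> to \<open>of_int m + 2\<close> is a final
    piece of the unit interval from \<open>of_int m + 1\<close>, which is what \<open>b\<close>
    bounds.\<close>
  then have "U1 ?\<sigma> 2 e2 = U1 (\<theta> t \<omega>) (of_int m + 2 - t) (i y)"
    using S1.U_add[OF W'(2), of "of_int m + 2 - t" "t - of_int m" "of_int m" e2] m01 by (simp add: \<theta>)
  then have "norm (U1 ?\<sigma> 2 e2) \<le> norm (U1 (\<theta> t \<omega>) (of_int m + 2 - t)) * norm (i y)"
    by (simp add: norm_blinfun)
  also have "norm (U1 (\<theta> t \<omega>) (of_int m + 2 - t)) \<le> exp b"
    using bspec[OF b, of "t - of_int m - 1"] m01 by (simp add: \<theta> algebra_simps)
  finally have "norm (U1 ?\<sigma> 2 e2) \<le> exp b * norm (i y)" by (simp add: mult_right_mono)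
  then have "c * norm (U1 ?\<sigma> 2 e2) \<le> c * (exp b * norm (i y))" by (rule mult_left_mono) (rule c)
  with c(1)[OF e2(1)] have "norm e2 \<le> c * (exp b * norm (i y))" by linarith
  then have "exp a * norm e2 \<le> exp a * (c * (exp b * norm (i y)))" by (rule mult_left_mono) simp
  with 2 have "norm e1 \<le> exp a * (c * (exp b * norm (i y)))" by linarith
  then have "C * norm e1 \<le> C * (exp a * (c * (exp b * norm (i y))))"
    by (rule mult_left_mono) (use C_pos in simp)
  with 1 show ?thesis by (simp add: mult_ac)
qed

text \<open>\<open>proj2 j\<close> is the identity minus the lifted components of
  \<open>i u\<close>. \<open>R n\<close> bounds the inverse of \<open>i\<close> on
  \<open>E n\<close>, and consecutive projections bound the components.\<close>

lemma norm_proj2_le: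
  assumes j: "j \<in> J" and w: "\<omega> \<in> W"
    and R: "\<And>n y. n \<in> {1..j} \<Longrightarrow> i y \<in> E n \<omega> \<Longrightarrow> norm y \<le> R n * norm (i y)" "\<And>n. 0 \<le> R n"
  shows "onorm (proj2 j \<omega>) \<le>
    1 + (\<Sum>n=1..j. R n * (onorm (O.proj (n - 1) \<omega>) + onorm (O.proj n \<omega>)) * I)"
proof (rule onorm_bound)
  let ?Q = "\<lambda>n. onorm (O.proj (n - 1) \<omega>) + onorm (O.proj n \<omega>)"
  have nJ: "n \<in> J" if "n \<in> {1..j}" for n using O.J_down[OF j] that by auto
  have Q: "0 \<le> ?Q n" if "n \<in> {1..j}" for n
    using nJ[OF that] O.pred_J[OF nJ[OF that]] by (intro add_nonneg_nonneg onorm_pos_le O.bounded_linear_proj w) auto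
  show "0 \<le> 1 + (\<Sum>n=1..j. R n * ?Q n * I)"
    by (intro add_nonneg_nonneg[OF zero_le_one] sum_nonneg mult_nonneg_nonneg[OF mult_nonneg_nonneg] R(2) Q
        less_imp_le[OF I_pos])
  fix u
  define z where "z n = inv (blinfun_apply i) (O.component n \<omega> (i u))" for n
  have iz: "i (z n) = O.component n \<omega> (i u)" if "n \<in> {1..j}" for n
    unfolding z_def using E_range[OF nJ[OF that] w] O.component_in[OF nJ[OF that] w]
    by (intro f_inv_into_f) blast
  have "i (u - proj2 j \<omega> u) = i u - O.proj j \<omega> (i u)" by (simp only: blinfun.diff_right i_proj2[OF j w])
  also have "\<dots> = (\<Sum>n=1..j. O.component n \<omega> (i u))" using j by (intro O.component_sum[OF w, symmetric]) simp
  also have "\<dots> = i (\<Sum>n=1..j. z n)" by (simp add: blinfun.sum_right iz)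
  finally have "u - proj2 j \<omega> u = (\<Sum>n=1..j. z n)" by (simp add: i_eq_iff)
  then have "proj2 j \<omega> u = u - (\<Sum>n=1..j. z n)" by (simp add: algebra_simps)
  then have "norm (proj2 j \<omega> u) \<le> norm u + norm (\<Sum>n=1..j. z n)" by (simp add: norm_triangle_ineq4)
  also have "norm (\<Sum>n=1..j. z n) \<le> (\<Sum>n=1..j. norm (z n))" by (rule norm_sum)
  also have "\<dots> \<le> (\<Sum>n=1..j. R n * ?Q n * I * norm u)"
  proof (rule sum_mono)
    fix n assume n: "n \<in> {1..j}"
    have "norm (z n) \<le> R n * norm (O.component n \<omega> (i u))"
      using R(1)[OF n, of "z n"] O.component_in[OF nJ[OF n] w] by (simp add: iz[OF n])
    also have "\<dots> \<le> R n * (?Q n * norm (i u))"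
      by (intro mult_left_mono O.norm_component_le nJ[OF n] w R)
    also have "\<dots> \<le> R n * (?Q n * (I * norm u))"
      by (intro mult_left_mono norm_i_le R Q n)
    finally show "norm (z n) \<le> R n * ?Q n * I * norm u" by (simp add: mult_ac)
  qed
  finally show "norm (proj2 j \<omega> u) \<le> (1 + (\<Sum>n=1..j. R n * ?Q n * I)) * norm u"
    by (simp add: distrib_right sum_distrib_right)
qed

text \<open>Index 0 occurs in the first component. Its projection is the identity and is not covered
  by clause (iii), hence the separate case.\<close>

lemma subexponential_onorm_proj:
  assumes w: "\<omega> \<in> W" and n: "n \<in> insert 0 J"
    and t: "n \<in> J \<Longrightarrow> ((\<lambda>t. 1 / t * ln (onorm (O.proj n (\<theta> t \<omega>)))) \<longlongrightarrow> 0) at_top \<and>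
       ((\<lambda>t. 1 / t * ln (onorm (O.proj n (\<theta> t \<omega>)))) \<longlongrightarrow> 0) at_bot"
  shows "subexponential (\<lambda>t. onorm (O.proj n (\<theta> t \<omega>)))"
proof (cases "n = 0")
  case True
  have "O.proj n (\<theta> t \<omega>) = (\<lambda>u. u)" for t
    unfolding True by (rule ext) (rule O.proj_0[OF O.flow_W[OF w]])
  moreover have "onorm (\<lambda>u::'a. u) \<le> 1" by (rule onorm_bound) simp_all
  ultimately have "onorm (O.proj n (\<theta> t \<omega>)) \<le> 1" for t by simp
  then show ?thesis by (rule subexponential_mono[OF subexponential_const])
next
  case False
  then show ?thesis using n t by (intro subexponential_of_tempered) (simp add: tendsto_at_infinity_iff)
qed

text \<open>\<open>norm_proj2_le\<close> at each \<open>\<theta> t \<omega>\<close> bounds the norm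
  by finite sums and products of subexponential functions of \<open>t\<close>. An upper bound is
  enough because a nonzero projection has norm at least 1.\<close>

lemma proj2_tempered:
  assumes j: "j \<in> J" shows "tempered M \<theta> W (proj2 j)"
proof -
  have nJ: "n \<in> J" if "n \<in> {1..j}" for n using O.J_down[OF j] that by auto
  note e1 = E1[unfolded standing_E1_def Let_def]
  obtain a where a: "integrable M a" "\<And>\<omega>. 0 \<le> a \<omega>" "AE \<omega> in M. \<forall>s\<in>{0..1}. norm (U1 \<omega> s) \<le> exp (a \<omega>)"
    by (rule integrable_log_bound[OF conjunct1[OF e1] conjunct1[OF conjunct2[OF e1]]]) blast
  note e2 = conjunct2[OF conjunct2[OF e1]]
  obtain b where b: "integrable M b" "\<And>\<omega>. 0 \<le> b \<omega>"
      "AE \<omega> in M. \<forall>s\<in>{0..1}. norm (U1 (\<theta> s \<omega>) (1 - s)) \<le> exp (b \<omega>)"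
    by (rule integrable_log_bound[OF conjunct1[OF e2] conjunct2[OF e2]]) blast
  have a1: "AE \<omega> in M. norm (U1 \<omega> 1) \<le> exp (a \<omega>)" using a(3) by eventually_elim simp
  \<comment> \<open>The backward rate over the two time units used in
    \<open>norm_lift_le\<close>.\<close>
  let ?k = "\<lambda>n. 2 * (\<bar>lam n\<bar> + 1)"
  have "\<exists>l. (AE \<omega> in M. \<forall>e>0. \<exists>K. \<forall>m::int. l (\<theta> (of_int m) \<omega>) \<le> K + e * \<bar>of_int m\<bar>) \<and>
      (\<forall>\<omega>\<in>W. \<forall>e\<in>E n (\<theta> (- 2) \<omega>). norm e \<le> exp (?k n + l \<omega>) * norm (U1 (\<theta> (- 2) \<omega>) 2 e))"
    if n: "n \<in> {1..j}" for n
  proof -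
    obtain l where "AE \<omega> in M. \<forall>e>0. \<exists>K. \<forall>m::int. l (\<theta> (of_int m) \<omega>) \<le> K + e * \<bar>of_int m\<bar>"
      and l: "\<And>\<omega> m e. \<omega> \<in> W \<Longrightarrow> e \<in> E n (\<theta> (- real m) \<omega>) \<Longrightarrow>
        norm e \<le> exp ((\<bar>lam n\<bar> + 1) * real m + l \<omega>) * norm (U1 (\<theta> (- real m) \<omega>) m e)"
      by (rule O.tempered_backward_bound[OF separable nJ[OF n] a(1,2) a1]) (rule that)
    moreover have "norm e \<le> exp (?k n + l \<omega>) * norm (U1 (\<theta> (- 2) \<omega>) 2 e)"
      if "\<omega> \<in> W" "e \<in> E n (\<theta> (- 2) \<omega>)" for \<omega> e
      using l[of \<omega> e 2] that by (simp add: mult.commute)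
    ultimately show ?thesis by blast
  qed
  then have "\<forall>n\<in>{1..j}. \<exists>l. (AE \<omega> in M. \<forall>e>0. \<exists>K. \<forall>m::int. l (\<theta> (of_int m) \<omega>) \<le> K + e * \<bar>of_int m\<bar>) \<and>
      (\<forall>\<omega>\<in>W. \<forall>e\<in>E n (\<theta> (- 2) \<omega>). norm e \<le> exp (?k n + l \<omega>) * norm (U1 (\<theta> (- 2) \<omega>) 2 e))" ..
  from bchoice[OF this] obtain l where l':
    "\<forall>n\<in>{1..j}. (AE \<omega> in M. \<forall>e>0. \<exists>K. \<forall>m::int. l n (\<theta> (of_int m) \<omega>) \<le> K + e * \<bar>of_int m\<bar>) \<and>
      (\<forall>\<omega>\<in>W. \<forall>e\<in>E n (\<theta> (- 2) \<omega>). norm e \<le> exp (?k n + l n \<omega>) * norm (U1 (\<theta> (- 2) \<omega>) 2 e))" ..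
  have l: "AE \<omega> in M. \<forall>e>0. \<exists>K. \<forall>m::int. l n (\<theta> (of_int m) \<omega>) \<le> K + e * \<bar>of_int m\<bar>"
      "\<And>\<omega> e. \<omega> \<in> W \<Longrightarrow> e \<in> E n (\<theta> (- 2) \<omega>) \<Longrightarrow>
        norm e \<le> exp (?k n + l n \<omega>) * norm (U1 (\<theta> (- 2) \<omega>) 2 e)" if "n \<in> {1..j}" for n
    using bspec[OF l' that] by blast+
  have "AE \<omega> in M. \<forall>n\<in>{1..j}. \<forall>e>0. \<exists>K. \<forall>m::int. l n (\<theta> (of_int m) \<omega>) \<le> K + e * \<bar>of_int m\<bar>"
    by (rule AE_finite_allI) (simp_all only: finite_atLeastAtMost l(1))
  moreover have "AE \<omega> in M. \<forall>n\<in>{1..j}. \<omega> \<in> W \<longrightarrow>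
      ((\<lambda>t. 1 / t * ln (onorm (O.proj n (\<theta> t \<omega>)))) \<longlongrightarrow> 0) at_top \<and>
      ((\<lambda>t. 1 / t * ln (onorm (O.proj n (\<theta> t \<omega>)))) \<longlongrightarrow> 0) at_bot"
    by (rule AE_finite_allI) (use O.proj_tempered nJ in \<open>auto simp: tempered_def\<close>)
  \<comment> \<open>With \<open>f = g = a\<close> the hypothesis of the criterion holds because
    \<open>a\<close> is nonnegative; likewise for \<open>b\<close>.\<close>
  moreover have "AE \<omega> in M. \<forall>e>0. \<exists>K. \<forall>m::int. a (\<theta> (of_int m) \<omega>) \<le> K + e * \<bar>of_int m\<bar>"
    by (rule S1.sublinear_along_orbits[where g = a]) (use a in auto)
  moreover have "AE \<omega> in M. \<forall>e>0. \<exists>K. \<forall>m::int. b (\<theta> (of_int m) \<omega>) \<le> K + e * \<bar>of_int m\<bar>"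
    by (rule S1.sublinear_along_orbits[where g = b]) (use b in auto)
  moreover note S1.AE_flow_int[OF a(3)] S1.AE_flow_int[OF b(3)]
  ultimately show ?thesis unfolding tempered_def
  proof eventually_elim
    case (elim \<omega>)
    show ?case
    proof
      assume w: "\<omega> \<in> W"
      have sp: "\<omega> \<in> space M" by (rule O.W_space[OF w])
      \<comment> \<open>For \<open>m = \<lfloor>t\<rfloor> - 1\<close> as in
        \<open>norm_lift_le\<close>, the samples are at \<open>m\<close>, \<open>m + 1\<close> and
        \<open>m + 2\<close>: where \<open>a\<close> starts, where \<open>b\<close> starts, and
        where the backward bound of length 2 ends.\<close>
      define A where "A t = exp (a (\<theta> (of_int (\<lfloor>t\<rfloor> + (- 1))) \<omega>))" for t :: real
      define B where "B t = exp (b (\<theta> (of_int (\<lfloor>t\<rfloor> + 0)) \<omega>))" for t :: real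
      define L where "L n t = exp (l n (\<theta> (of_int (\<lfloor>t\<rfloor> + 1)) \<omega>))" for n and t :: real
      define R where "R n t = C * (A t * (exp (?k n) * L n t * B t))" for n t
      define Q where "Q n t = onorm (O.proj (n - 1) (\<theta> t \<omega>)) + onorm (O.proj n (\<theta> t \<omega>))" for n t
      have R0: "0 \<le> R n t" for n t using C_pos by (simp add: R_def A_def B_def L_def)
      have Q0: "0 \<le> Q n t" if "n \<in> {1..j}" for n t
        unfolding Q_def using nJ[OF that] O.pred_J[OF nJ[OF that]]
        by (intro add_nonneg_nonneg onorm_pos_le O.bounded_linear_proj O.flow_W[OF w]) auto
      have A: "subexponential A" unfolding A_def by (rule subexponential_floor[OF elim(3)])
      have B: "subexponential B" unfolding B_def by (rule subexponential_floor[OF elim(4)])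
      have L: "subexponential (L n)" if "n \<in> {1..j}" for n
        unfolding L_def by (rule subexponential_floor) (use elim(1) that in blast)
      have R: "subexponential (R n)" if "n \<in> {1..j}" for n
        unfolding R_def using C_pos
        by (intro subexponential_mult subexponential_const A B L that) (simp_all add: A_def B_def L_def)
      have P: "subexponential (\<lambda>t. onorm (O.proj n (\<theta> t \<omega>)))" if "n \<in> insert 0 {1..j}" for n
        using that elim(2) w nJ by (intro subexponential_onorm_proj[OF w]) (auto dest: O.J_pos)
      have Q: "subexponential (Q n)" if "n \<in> {1..j}" for n
        unfolding Q_def by (intro subexponential_add P) (use that in auto)
      have "subexponential (\<lambda>t. 1 + (\<Sum>n=1..j. R n t * Q n t * I))"
        using I_pos by (intro subexponential_add subexponential_const subexponential_sum subexponential_mult R Q)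
          (auto intro!: R0 Q0 mult_nonneg_nonneg)
      moreover have "onorm (proj2 j (\<theta> t \<omega>)) \<le> 1 + (\<Sum>n=1..j. R n t * Q n t * I)" for t
        unfolding Q_def
      proof (rule norm_proj2_le[OF j O.flow_W[OF w]])
        fix n y assume n: "n \<in> {1..j}" and y: "i y \<in> E n (\<theta> t \<omega>)"
        let ?m = "\<lfloor>t\<rfloor> - 1"
        have W2: "\<theta> (of_int (?m + 2)) \<omega> \<in> W" by (rule O.flow_W[OF w])
        have m2: "\<theta> (- 2) (\<theta> (of_int (?m + 2)) \<omega>) = \<theta> (of_int ?m) \<omega>"
          using S1.flow_add[OF sp, of "- 2" "of_int (?m + 2)"] by simp
        have "norm y \<le> C * (exp (a (\<theta> (of_int ?m) \<omega>)) *
            ((exp (?k n) * exp (l n (\<theta> (of_int (?m + 2)) \<omega>))) * exp (b (\<theta> (of_int (?m + 1)) \<omega>)))) * norm (i y)"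
        proof (rule norm_lift_le[OF nJ[OF n] w y refl])
          show "\<forall>s\<in>{0..1}. norm (U1 (\<theta> (of_int ?m) \<omega>) s) \<le> exp (a (\<theta> (of_int ?m) \<omega>))"
            using elim(5) by blast
          show "\<forall>s\<in>{0..1}. norm (U1 (\<theta> s (\<theta> (of_int (?m + 1)) \<omega>)) (1 - s)) \<le> exp (b (\<theta> (of_int (?m + 1)) \<omega>))"
            using elim(6) by blast
          show "norm e \<le> exp (?k n) * exp (l n (\<theta> (of_int (?m + 2)) \<omega>)) * norm (U1 (\<theta> (of_int ?m) \<omega>) 2 e)"
            if "e \<in> E n (\<theta> (of_int ?m) \<omega>)" for e
            using l(2)[OF n W2, unfolded m2, OF that] by (simp only: exp_add)
        qed simp
        moreover have "?m = \<lfloor>t\<rfloor> + (- 1)" "?m + 2 = \<lfloor>t\<rfloor> + 1" "?m + 1 = \<lfloor>t\<rfloor> + 0" by simp_all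
        ultimately show "norm y \<le> R n t * norm (i y)"
          unfolding R_def A_def B_def L_def by metis
      qed (rule R0)
      ultimately have "subexponential (\<lambda>t. onorm (proj2 j (\<theta> t \<omega>)))" by (rule subexponential_mono)
      moreover have "onorm (proj2 j (\<theta> t \<omega>)) = 0 \<or> 1 \<le> onorm (proj2 j (\<theta> t \<omega>))" for t
        by (intro onorm_projection_along sum_E2_span j O.flow_W[OF w] vimage_subspace vimage_closed
            O.G_subspace O.G_closed direct2)
      ultimately have "((\<lambda>t. 1 / t * ln (onorm (proj2 j (\<theta> t \<omega>)))) \<longlongrightarrow> 0) at_infinity"
        by (rule tempered_of_subexponential)
      then show "((\<lambda>t. 1 / t * ln (onorm (proj2 j (\<theta> t \<omega>)))) \<longlongrightarrow> 0) at_top \<and>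
          ((\<lambda>t. 1 / t * ln (onorm (proj2 j (\<theta> t \<omega>)))) \<longlongrightarrow> 0) at_bot"
        by (simp add: tendsto_at_infinity_iff)
    qed
  qed
qed

theorem splitting2: "oseledets_splitting M \<theta> U2 W J lam E2 G2"
proof
  show "W \<in> sets M" "flow_invariant M \<theta> W" "measure M W = 1"
    by (fact O.W_sets O.W_invariant O.W_full)+
  show "G2 0 \<omega> = UNIV" if "\<omega> \<in> W" for \<omega> by (simp add: O.G_0[OF that])
  fix j assume j: "j \<in> J"
  show "1 \<le> j" by (rule O.J_pos[OF j])
  show "k \<in> J" if "1 \<le> k" "k \<le> j" for k by (rule O.J_down[OF j that])
  show "\<exists>l. measurable_subspaces M W l (E2 j)" by (rule E2_measurable[OF j])
  show "strongly_measurable M W (proj2 j)" by (rule proj2_measurable[OF j])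
  show "tempered M \<theta> W (proj2 j)" by (rule proj2_tempered[OF j])
  fix \<omega> assume w: "\<omega> \<in> W"
  have sp: "\<omega> \<in> space M" by (rule O.W_space[OF w])
  show "subspace (G2 j \<omega>)" by (rule vimage_subspace[OF O.G_subspace[OF j w]])
  show "closed (G2 j \<omega>)" by (rule vimage_closed[OF O.G_closed[OF j w]])
  show "is_direct_sum (\<Sum>n=1..j. E2 n \<omega>) (G2 j \<omega>) UNIV" by (rule direct2[OF j w])
  show "is_direct_sum (E2 j \<omega>) (G2 j \<omega>) (G2 (j - 1) \<omega>)"
    by (rule is_direct_sum_vimage[OF linear_i inj_i E_range[OF j w] O.split[OF j w]])
  show "independent_subspaces {1..j} (\<lambda>n. E2 n \<omega>)"
    unfolding independent_subspaces_def
  proof (intro allI impI, elim conjE)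
    fix x assume x: "\<forall>n\<in>{1..j}. x n \<in> E2 n \<omega>" "(\<Sum>n=1..j. x n) = 0"
    have "(\<Sum>n=1..j. i (x n)) = 0" using x(2) by (simp add: blinfun.zero_right flip: blinfun.sum_right)
    then have "\<forall>n\<in>{1..j}. i (x n) = 0"
      using O.indep[OF j w] x(1) unfolding independent_subspaces_def by auto
    then show "\<forall>n\<in>{1..j}. x n = 0" using i_eq_iff[of _ 0] by (simp add: blinfun.zero_right)
  qed
  show "U2 \<omega> t ` E2 j \<omega> = E2 j (\<theta> t \<omega>)" if t: "0 \<le> t" for t
  proof (intro equalityI subsetI)
    fix y assume "y \<in> U2 \<omega> t ` E2 j \<omega>"
    then show "y \<in> E2 j (\<theta> t \<omega>)" using O.U_E[OF j w t] by (auto simp: i_U2[OF sp t])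
  next
    fix y assume "y \<in> E2 j (\<theta> t \<omega>)"
    then have "i y \<in> U1 \<omega> t ` E j \<omega>" using O.U_E[OF j w t] by simp
    then obtain e where e: "e \<in> E j \<omega>" "i y = U1 \<omega> t e" by blast
    then obtain x where x: "e = i x" using E_range[OF j w] by blast
    then have "i y = i (U2 \<omega> t x)" using e by (simp add: i_U2[OF sp t])
    then show "y \<in> U2 \<omega> t ` E2 j \<omega>" using e(1) x by (auto simp: i_eq_iff)
  qed
  show "U2 \<omega> t ` G2 j \<omega> \<subseteq> G2 j (\<theta> t \<omega>)" if t: "0 \<le> t" for t
    using O.U_G[OF j w t] by (auto simp: i_U2[OF sp t])
  fix u :: 'b assume u: "u \<noteq> 0"
  then have iu: "i u \<noteq> 0" using i_eq_iff[of u 0] by (simp add: blinfun.zero_right)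
  show "(growth_rate (\<lambda>t. norm (U2 \<omega> t u)) \<longlongrightarrow> ereal (lam j)) at_top" if "u \<in> E2 j \<omega>"
    using that by (intro growth_rate_i[OF sp] O.growth[OF j w _ iu]) simp
  show "u \<in> E2 j \<omega> \<longleftrightarrow> (\<exists>v. negative_semiorbit \<theta> U2 \<omega> u v \<and>
      (growth_rate (\<lambda>s. norm (v s)) \<longlongrightarrow> ereal (lam j)) at_bot)" if "u \<in> G2 (j - 1) \<omega>"
  proof -
    have iff: "i u \<in> E j \<omega> \<longleftrightarrow> (\<exists>v. negative_semiorbit \<theta> U1 \<omega> (i u) v \<and>
        (growth_rate (\<lambda>s. norm (v s)) \<longlongrightarrow> ereal (lam j)) at_bot)"
      using that by (intro O.semiorbit[OF j w _ iu]) simp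
    show ?thesis
    proof
      assume "u \<in> E2 j \<omega>"
      then obtain v where v: "negative_semiorbit \<theta> U1 \<omega> (i u) v"
          "(growth_rate (\<lambda>s. norm (v s)) \<longlongrightarrow> ereal (lam j)) at_bot" using iff by auto
      obtain v' where v': "negative_semiorbit \<theta> U2 \<omega> u v'" "\<And>s. s \<le> 0 \<Longrightarrow> i (v' s) = v s"
        using semiorbit_lift[OF sp v(1)] by blast
      have "\<forall>\<^sub>F s in at_bot. growth_rate (\<lambda>s. norm (v s)) s = growth_rate (\<lambda>s. norm (i (v' s))) s"
        using eventually_le_at_bot[of 0] by eventually_elim (simp add: growth_rate_def v'(2))
      then have "(growth_rate (\<lambda>s. norm (i (v' s))) \<longlongrightarrow> ereal (lam j)) at_bot"
        using v(2) by (simp add: filterlim_cong)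
      then show "\<exists>v. negative_semiorbit \<theta> U2 \<omega> u v \<and>
          (growth_rate (\<lambda>s. norm (v s)) \<longlongrightarrow> ereal (lam j)) at_bot"
        using v'(1) semiorbit_growth_rate[OF sp v'(1)] by blast
    next
      assume "\<exists>v. negative_semiorbit \<theta> U2 \<omega> u v \<and>
          (growth_rate (\<lambda>s. norm (v s)) \<longlongrightarrow> ereal (lam j)) at_bot"
      then obtain v where v: "negative_semiorbit \<theta> U2 \<omega> u v"
          "(growth_rate (\<lambda>s. norm (v s)) \<longlongrightarrow> ereal (lam j)) at_bot" by blast
      then have "(growth_rate (\<lambda>s. norm (i (v s))) \<longlongrightarrow> ereal (lam j)) at_bot"
        using semiorbit_growth_rate[OF sp v(1)] by blast
      then show "u \<in> E2 j \<omega>" using iff semiorbit_i[OF sp v(1)] by auto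
    qed
  qed
qed

end

section \<open>Reduction of both cases to the common splitting\<close>

lemma tail_sum_self: "tail_sum k E F k \<omega> = F \<omega>"
  by (simp add: tail_sum_def flip: set_zero)

lemma tail_sum_pred:
  assumes "1 \<le> j" "j \<le> k"
  shows "tail_sum k E F (j - 1) \<omega> = E j \<omega> + tail_sum k E F j \<omega>"
  using assms sum.atLeast_Suc_atMost[of j k "\<lambda>m. E m \<omega>"] by (simp add: tail_sum_def add.assoc)

lemma sum_plus_tail_sum:
  assumes "j \<le> k"
  shows "(\<Sum>n=1..j. E n \<omega>) + tail_sum k E F j \<omega> = (\<Sum>n=1..k. E n \<omega>) + F \<omega>"
  using assms sum.ub_add_nat[of 1 j "\<lambda>m. E m \<omega>" "k - j"] by (simp add: tail_sum_def flip: add.assoc)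

text \<open>Case (O1) gives directness only for the complete sum with \<open>Finf\<close>. The
  intermediate splittings come from regrouping, and the tail sums are closed as finite-dimensional
  extensions of the closed \<open>Finf\<close>.\<close>

lemma splitting_of_O1:
  fixes U :: "'w \<Rightarrow> real \<Rightarrow> ('a::banach \<Rightarrow>\<^sub>L 'a)"
  assumes "semiflow M \<theta> U" and W: "W \<in> sets M" "flow_invariant M \<theta> W" "measure M W = 1"
    and O1: "oseledets_decomposition_O1 M \<theta> U W k lam E Finf"
  shows "oseledets_splitting M \<theta> U W {1..k} lam E (tail_sum k E Finf)"
proof -
  interpret semiflow M \<theta> U by fact
  note O1' = O1[unfolded oseledets_decomposition_O1_def Let_def]
  have meas [rule_format]: "\<forall>j\<in>{1..k}. \<exists>l. measurable_subspaces M W l (E j)"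
    using O1' by (elim conjE)
  have Fcl [rule_format]: "\<forall>\<omega>\<in>W. closed_finite_codim_subspace (Finf \<omega>)" using O1' by (elim conjE)
  have inv [rule_format]: "\<forall>j\<in>{1..k}. \<forall>\<omega>\<in>W. \<forall>t\<ge>0. U \<omega> t ` E j \<omega> = E j (\<theta> t \<omega>) \<and>
      U \<omega> t ` Finf \<omega> \<subseteq> Finf (\<theta> t \<omega>)" using O1' by (elim conjE)
  have dir [rule_format]: "\<forall>\<omega>\<in>W. independent_subspaces {1..k} (\<lambda>n. E n \<omega>) \<and>
      is_direct_sum (\<Sum>n=1..k. E n \<omega>) (Finf \<omega>) UNIV" using O1' by (elim conjE)
  have proj [rule_format]: "\<forall>j\<in>{1..k}.
      strongly_measurable M W (\<lambda>\<omega>. projection_along (\<Sum>n=1..j. E n \<omega>) (tail_sum k E Finf j \<omega>)) \<and>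
      tempered M \<theta> W (\<lambda>\<omega>. projection_along (\<Sum>n=1..j. E n \<omega>) (tail_sum k E Finf j \<omega>))"
    using O1' by (elim conjE)
  have growth [rule_format]: "\<forall>j\<in>{1..k}. \<forall>\<omega>\<in>W. \<forall>u\<in>E j \<omega>. u \<noteq> 0 \<longrightarrow>
      (growth_rate (\<lambda>t. norm (U \<omega> t u)) \<longlongrightarrow> ereal (lam j)) at_top" using O1' by (elim conjE)
  have semiorbit [rule_format]: "\<forall>j\<in>{1..k}. \<forall>\<omega>\<in>W. \<forall>u\<in>tail_sum k E Finf (j - 1) \<omega>. u \<noteq> 0 \<longrightarrow>
      (u \<in> E j \<omega> \<longleftrightarrow> (\<exists>v. negative_semiorbit \<theta> U \<omega> u v \<and>
        (growth_rate (\<lambda>s. norm (v s)) \<longlongrightarrow> ereal (lam j)) at_bot))" using O1' by (elim conjE)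
  have span: "\<exists>B. finite B \<and> E j \<omega> = span B" if "j \<in> {1..k}" "\<omega> \<in> W" for j \<omega>
    using meas[OF that(1)] measurable_subspaces_span[OF _ that(2)] by metis
  have E0: "0 \<in> E j \<omega>" if "j \<in> {1..k}" "\<omega> \<in> W" for j \<omega>
    using span[OF that] span_zero by metis
  have F: "subspace (Finf \<omega>)" "closed (Finf \<omega>)" if "\<omega> \<in> W" for \<omega>
    using Fcl[OF that] by (simp_all add: closed_finite_codim_subspace_def)
  have tail: "subspace (tail_sum k E Finf j \<omega>) \<and> closed (tail_sum k E Finf j \<omega>)"
    if j: "j \<in> {1..k}" and w: "\<omega> \<in> W" for j \<omega>
  proof -
    have "\<exists>B. finite B \<and> (\<Sum>m=j+1..k. E m \<omega>) = span B"
      by (intro set_sum_finite_dimensional span w) auto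
    then obtain B where B: "finite B" "(\<Sum>m=j+1..k. E m \<omega>) = span B" by blast
    have "tail_sum k E Finf j \<omega> = span (B \<union> Finf \<omega>)"
      unfolding tail_sum_def B(2) by (rule span_plus_subspace[OF F(1)[OF w]])
    then show ?thesis using closed_span_Un_finite[OF B(1) F(1,2)[OF w]] by simp
  qed
  have direct: "is_direct_sum (\<Sum>n=1..j. E n \<omega>) (tail_sum k E Finf j \<omega>) UNIV"
    if j: "j \<in> {1..k}" and w: "\<omega> \<in> W" for j \<omega>
    unfolding is_direct_sum_def
  proof
    show "(\<Sum>n=1..j. E n \<omega>) + tail_sum k E Finf j \<omega> = UNIV"
      using sum_plus_tail_sum[of j k E \<omega> Finf] dir[OF w] j by (simp add: is_direct_sum_def)
    have "x = 0" if x: "x \<in> (\<Sum>n=1..j. E n \<omega>)" "x \<in> tail_sum k E Finf j \<omega>" for x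
    proof -
      have "\<exists>s. (\<forall>n\<in>{1..j}. s n \<in> E n \<omega>) \<and> x = (\<Sum>n=1..j. s n)"
        using x(1) by (subst (asm) mem_set_sum) simp_all
      then obtain s where s: "\<forall>n\<in>{1..j}. s n \<in> E n \<omega>" "x = (\<Sum>n=1..j. s n)" by blast
      obtain y f where y: "y \<in> (\<Sum>m=j+1..k. E m \<omega>)" and f: "f \<in> Finf \<omega>" "x = y + f"
        using x(2) unfolding tail_sum_def mem_set_plus by blast
      have "\<exists>r. (\<forall>n\<in>{j+1..k}. r n \<in> E n \<omega>) \<and> y = (\<Sum>n=j+1..k. r n)"
        using y by (subst (asm) mem_set_sum) simp_all
      then obtain r where r: "\<forall>n\<in>{j+1..k}. r n \<in> E n \<omega>" "y = (\<Sum>n=j+1..k. r n)" by blast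
      \<comment> \<open>The sign is chosen so that the \<open>c n\<close> sum to
        \<open>x - y = f\<close>, an element of \<open>Finf\<close>. Directness and independence of
        the complete sum then force all of them to vanish.\<close>
      define c where "c n = (if n \<le> j then s n else - r n)" for n
      have c: "c n \<in> E n \<omega>" if n: "n \<in> {1..k}" for n
      proof -
        obtain B where "E n \<omega> = span B" using span[OF n w] by blast
        then show ?thesis using s(1) r(1) n by (auto simp: c_def intro: span_neg)
      qed
      have "(\<Sum>n=1..k. c n) = (\<Sum>n=1..j. c n) + (\<Sum>n=j+1..k. c n)"
        using sum.ub_add_nat[of 1 j c "k - j"] j by simp
      also have "\<dots> = x - y" by (simp add: c_def s(2) r(2) sum_negf)
      also have "\<dots> = f" using f(2) by simp
      finally have cf: "(\<Sum>n=1..k. c n) = f" .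
      have "(\<Sum>n=1..k. c n) \<in> (\<Sum>n=1..k. E n \<omega>)" using c by (intro sum_mem_set_sum) auto
      then have "f \<in> (\<Sum>n=1..k. E n \<omega>) \<inter> Finf \<omega>" using cf f(1) by simp
      then have "f \<in> {0}" using dir[OF w] unfolding is_direct_sum_def by blast
      then have "\<forall>n\<in>{1..k}. c n = 0"
        using dir[OF w] c cf unfolding independent_subspaces_def by blast
      then have "\<forall>n\<in>{1..j}. s n = 0" using j by (force simp: c_def)
      then show ?thesis by (simp add: s(2))
    qed
    moreover have "0 \<in> (\<Sum>n=1..j. E n \<omega>)"
      using sum_mem_set_sum[of "{1..j}" "\<lambda>_. 0" "\<lambda>n. E n \<omega>"] E0 j w by simp
    ultimately show "(\<Sum>n=1..j. E n \<omega>) \<inter> tail_sum k E Finf j \<omega> = {0}"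
      using subspace_0 tail[OF j w] by blast
  qed
  show ?thesis
  proof
    show "W \<in> sets M" "flow_invariant M \<theta> W" "measure M W = 1" by (fact W)+
    show "tail_sum k E Finf 0 \<omega> = UNIV" if "\<omega> \<in> W" for \<omega>
      using dir[OF that] by (simp add: tail_sum_def is_direct_sum_def)
    fix j assume j: "j \<in> {1..k}"
    show "1 \<le> j" using j by simp
    show "n \<in> {1..k}" if "1 \<le> n" "n \<le> j" for n using that j by simp
    show "\<exists>l. measurable_subspaces M W l (E j)" by (rule meas[OF j])
    show "strongly_measurable M W (\<lambda>\<omega>. projection_along (\<Sum>n=1..j. E n \<omega>) (tail_sum k E Finf j \<omega>))"
      "tempered M \<theta> W (\<lambda>\<omega>. projection_along (\<Sum>n=1..j. E n \<omega>) (tail_sum k E Finf j \<omega>))"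
      using proj[OF j] by blast+
    fix \<omega> assume w: "\<omega> \<in> W"
    show "subspace (tail_sum k E Finf j \<omega>)" "closed (tail_sum k E Finf j \<omega>)"
      using tail[OF j w] by blast+
    show "independent_subspaces {1..j} (\<lambda>n. E n \<omega>)"
      unfolding independent_subspaces_def
    proof (intro allI impI, elim conjE)
      fix x assume x: "\<forall>n\<in>{1..j}. x n \<in> E n \<omega>" "(\<Sum>n=1..j. x n) = 0"
      define c where "c n = (if n \<le> j then x n else 0)" for n
      have "(\<Sum>n=1..k. c n) = (\<Sum>n=1..j. c n) + (\<Sum>n=j+1..k. c n)"
        using sum.ub_add_nat[of 1 j c "k - j"] j by simp
      also have "\<dots> = 0" using x(2) by (simp add: c_def)
      finally have "(\<Sum>n=1..k. c n) = 0" .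
      moreover have "\<forall>n\<in>{1..k}. c n \<in> E n \<omega>" using x(1) E0 w by (simp add: c_def)
      ultimately have "\<forall>n\<in>{1..k}. c n = 0"
        using dir[OF w] unfolding independent_subspaces_def by blast
      then show "\<forall>n\<in>{1..j}. x n = 0" using j by (force simp: c_def)
    qed
    show "is_direct_sum (\<Sum>n=1..j. E n \<omega>) (tail_sum k E Finf j \<omega>) UNIV" by (rule direct[OF j w])
    have "E j \<omega> \<subseteq> (\<Sum>n=1..j. E n \<omega>)"
    proof
      fix e assume e: "e \<in> E j \<omega>"
      have "(\<Sum>n=1..j. if n = j then e else 0) \<in> (\<Sum>n=1..j. E n \<omega>)"
        by (rule sum_mem_set_sum) (use e E0 j w in auto)
      then show "e \<in> (\<Sum>n=1..j. E n \<omega>)" using j by simp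
    qed
    then have "E j \<omega> \<inter> tail_sum k E Finf j \<omega> = {0}"
      using direct[OF j w] E0[OF j w] subspace_0 tail[OF j w] unfolding is_direct_sum_def by blast
    then show "is_direct_sum (E j \<omega>) (tail_sum k E Finf j \<omega>) (tail_sum k E Finf (j - 1) \<omega>)"
      using tail_sum_pred[of j k E Finf \<omega>] j by (simp add: is_direct_sum_def)
    show "U \<omega> t ` E j \<omega> = E j (\<theta> t \<omega>)" if "0 \<le> t" for t using inv[OF j w that] by blast
    show "U \<omega> t ` tail_sum k E Finf j \<omega> \<subseteq> tail_sum k E Finf j (\<theta> t \<omega>)" if t: "0 \<le> t" for t
    proof
      fix z assume "z \<in> U \<omega> t ` tail_sum k E Finf j \<omega>"
      then obtain x where x: "z = U \<omega> t x" "x \<in> tail_sum k E Finf j \<omega>" by blast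
      from x(2) obtain y f where xyf: "x = y + f" and y: "y \<in> (\<Sum>m=j+1..k. E m \<omega>)" and f: "f \<in> Finf \<omega>"
        unfolding tail_sum_def mem_set_plus by blast
      have "\<exists>r. (\<forall>n\<in>{j+1..k}. r n \<in> E n \<omega>) \<and> y = (\<Sum>n=j+1..k. r n)"
        using y by (subst (asm) mem_set_sum) simp_all
      then obtain r where r: "\<forall>n\<in>{j+1..k}. r n \<in> E n \<omega>" "y = (\<Sum>n=j+1..k. r n)" by blast
      have "U \<omega> t (r n) \<in> E n (\<theta> t \<omega>)" if n: "n \<in> {j+1..k}" for n
        using inv[OF _ w t, of n] r(1) n by auto
      then have "U \<omega> t y \<in> (\<Sum>m=j+1..k. E m (\<theta> t \<omega>))"
        unfolding r(2) blinfun.sum_right by (intro sum_mem_set_sum) auto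
      moreover have "U \<omega> t f \<in> Finf (\<theta> t \<omega>)" using inv[OF j w t] f by blast
      ultimately show "z \<in> tail_sum k E Finf j (\<theta> t \<omega>)"
        unfolding x(1) xyf tail_sum_def blinfun.add_right by (rule set_plus_intro)
    qed
    fix u :: 'a assume u: "u \<noteq> 0"
    show "(growth_rate (\<lambda>t. norm (U \<omega> t u)) \<longlongrightarrow> ereal (lam j)) at_top" if "u \<in> E j \<omega>"
      by (rule growth[OF j w that u])
    show "u \<in> E j \<omega> \<longleftrightarrow> (\<exists>v. negative_semiorbit \<theta> U \<omega> u v \<and>
          (growth_rate (\<lambda>s. norm (v s)) \<longlongrightarrow> ereal (lam j)) at_bot)"
      if "u \<in> tail_sum k E Finf (j - 1) \<omega>"
      by (rule semiorbit[OF j w that u])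
  qed
qed

lemma splitting_of_O2:
  fixes U :: "'w \<Rightarrow> real \<Rightarrow> ('a::banach \<Rightarrow>\<^sub>L 'a)"
  assumes "semiflow M \<theta> U" and W: "W \<in> sets M" "flow_invariant M \<theta> W" "measure M W = 1"
    and O2: "oseledets_decomposition_O2 M \<theta> U W lam E F"
  shows "oseledets_splitting M \<theta> U W {1..} lam E F"
proof -
  interpret semiflow M \<theta> U by fact
  note O2' = O2[unfolded oseledets_decomposition_O2_def Let_def]
  have meas [rule_format]: "\<forall>j\<ge>1. \<exists>l. measurable_subspaces M W l (E j)" using O2' by (elim conjE)
  have Fcl [rule_format]: "\<forall>j\<ge>1. \<forall>\<omega>\<in>W. closed_finite_codim_subspace (F j \<omega>)" using O2' by (elim conjE)
  have F0 [rule_format]: "\<forall>\<omega>\<in>W. F 0 \<omega> = UNIV" using O2' by (elim conjE)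
  have inv [rule_format]: "\<forall>j\<ge>1. \<forall>\<omega>\<in>W. \<forall>t\<ge>0. U \<omega> t ` E j \<omega> = E j (\<theta> t \<omega>) \<and>
      U \<omega> t ` F j \<omega> \<subseteq> F j (\<theta> t \<omega>)" using O2' by (elim conjE)
  have dir [rule_format]: "\<forall>j\<ge>1. \<forall>\<omega>\<in>W. independent_subspaces {1..j} (\<lambda>n. E n \<omega>) \<and>
      is_direct_sum (\<Sum>n=1..j. E n \<omega>) (F j \<omega>) UNIV \<and>
      is_direct_sum (E (Suc j) \<omega>) (F (Suc j) \<omega>) (F j \<omega>)" using O2' by (elim conjE)
  have proj [rule_format]: "\<forall>j\<ge>1.
      strongly_measurable M W (\<lambda>\<omega>. projection_along (\<Sum>n=1..j. E n \<omega>) (F j \<omega>)) \<and>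
      tempered M \<theta> W (\<lambda>\<omega>. projection_along (\<Sum>n=1..j. E n \<omega>) (F j \<omega>))" using O2' by (elim conjE)
  have growth [rule_format]: "\<forall>j\<ge>1. \<forall>\<omega>\<in>W. \<forall>u\<in>E j \<omega>. u \<noteq> 0 \<longrightarrow>
      (growth_rate (\<lambda>t. norm (U \<omega> t u)) \<longlongrightarrow> ereal (lam j)) at_top" using O2' by (elim conjE)
  have semiorbit [rule_format]: "\<forall>j\<ge>1. \<forall>\<omega>\<in>W. \<forall>u\<in>F (j - 1) \<omega>. u \<noteq> 0 \<longrightarrow>
      (u \<in> E j \<omega> \<longleftrightarrow> (\<exists>v. negative_semiorbit \<theta> U \<omega> u v \<and>
        (growth_rate (\<lambda>s. norm (v s)) \<longlongrightarrow> ereal (lam j)) at_bot))" using O2' by (elim conjE)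
  show ?thesis
  proof
    show "W \<in> sets M" "flow_invariant M \<theta> W" "measure M W = 1" by (fact W)+
    show "F 0 \<omega> = UNIV" if "\<omega> \<in> W" for \<omega> by (rule F0[OF that])
    fix j :: nat assume "j \<in> {1..}"
    then have j: "1 \<le> j" by simp
    show "1 \<le> j" by (rule j)
    show "n \<in> {1..}" if "1 \<le> n" "n \<le> j" for n using that by simp
    show "\<exists>l. measurable_subspaces M W l (E j)" by (rule meas[OF j])
    show "strongly_measurable M W (\<lambda>\<omega>. projection_along (\<Sum>n=1..j. E n \<omega>) (F j \<omega>))"
      "tempered M \<theta> W (\<lambda>\<omega>. projection_along (\<Sum>n=1..j. E n \<omega>) (F j \<omega>))"
      using proj[OF j] by blast+
    fix \<omega> assume w: "\<omega> \<in> W"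
    show "subspace (F j \<omega>)" "closed (F j \<omega>)"
      using Fcl[OF j w] by (simp_all add: closed_finite_codim_subspace_def)
    show "independent_subspaces {1..j} (\<lambda>n. E n \<omega>)" "is_direct_sum (\<Sum>n=1..j. E n \<omega>) (F j \<omega>) UNIV"
      using dir[OF j w] by blast+
    show "is_direct_sum (E j \<omega>) (F j \<omega>) (F (j - 1) \<omega>)"
    proof (cases "j = 1")
      case True
      then show ?thesis using dir[OF j w] F0[OF w] by simp
    next
      case False
      then have "1 \<le> j - 1" "Suc (j - 1) = j" using j by auto
      then show ?thesis using dir[of "j - 1", OF _ w] by metis
    qed
    show "U \<omega> t ` E j \<omega> = E j (\<theta> t \<omega>)" "U \<omega> t ` F j \<omega> \<subseteq> F j (\<theta> t \<omega>)" if "0 \<le> t" for t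
      using inv[OF j w that] by blast+
    fix u :: 'a assume u: "u \<noteq> 0"
    show "(growth_rate (\<lambda>t. norm (U \<omega> t u)) \<longlongrightarrow> ereal (lam j)) at_top" if "u \<in> E j \<omega>"
      by (rule growth[OF j w that u])
    show "u \<in> E j \<omega> \<longleftrightarrow> (\<exists>v. negative_semiorbit \<theta> U \<omega> u v \<and>
          (growth_rate (\<lambda>s. norm (v s)) \<longlongrightarrow> ereal (lam j)) at_bot)"
      if "u \<in> F (j - 1) \<omega>"
      by (rule semiorbit[OF j w that u])
  qed
qed

context smoothing_transfer
begin

interpretation S2: oseledets_splitting M \<theta> U2 W J lam E2 G2 by (rule splitting2)

lemma closed_finite_codim2:
  assumes "j \<in> J" "\<omega> \<in> W"
  shows "closed_finite_codim_subspace (G2 j \<omega>)"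
proof -
  obtain B where B: "finite B" "(\<Sum>n=1..j. E2 n \<omega>) = span B" using sum_E2_span[OF assms] by blast
  have "span (B \<union> G2 j \<omega>) = UNIV"
    using span_plus_subspace[OF S2.G_subspace[OF assms], of B] direct2[OF assms]
    unfolding is_direct_sum_def B(2) by simp
  then show ?thesis unfolding closed_finite_codim_subspace_def
    using B(1) S2.G_subspace[OF assms] S2.G_closed[OF assms] by (metis Un_commute)
qed

lemma growth_rate_G2:
  assumes j: "j \<in> J" and w: "\<omega> \<in> W"
    and l: "\<And>\<omega>. \<omega> \<in> W \<Longrightarrow> (growth_rate (\<lambda>t. onorm_on (G j \<omega>) (U1 \<omega> t)) \<longlongrightarrow> l) at_top"
  shows "(growth_rate (\<lambda>t. onorm_on (G2 j \<omega>) (U2 \<omega> t)) \<longlongrightarrow> l) at_top"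
proof -
  have w': "\<theta> (- 1) \<omega> \<in> W" by (rule O.flow_W[OF w])
  have "U1 (\<theta> (- 1) \<omega>) 1 ` G j (\<theta> (- 1) \<omega>) \<subseteq> G j \<omega>"
    using O.U_G[OF j w', of 1] S1.flow_inverse(1)[OF O.W_space[OF w], of 1] by simp
  then show ?thesis
    by (rule growth_rate_onorm_on[OF O.W_space[OF w] O.G_subspace[OF j w] O.G_subspace[OF j w'] _ l[OF w] l[OF w']])
qed

end

theorem theorem2p1:
  fixes M :: "'w measure"
    and \<theta> :: "real \<Rightarrow> 'w \<Rightarrow> 'w"
    and U1 :: "'w \<Rightarrow> real \<Rightarrow> ('a::banach \<Rightarrow>\<^sub>L 'a)"
    and U2 :: "'w \<Rightarrow> real \<Rightarrow> ('b::banach \<Rightarrow>\<^sub>L 'b)"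
    and i :: "'b \<Rightarrow>\<^sub>L 'a"
    and U12 :: "'w \<Rightarrow> ('a \<Rightarrow>\<^sub>L 'b)"
    and C :: real
  assumes "ergodic_system M \<theta>"
    and "semiflow M \<theta> U1" and "standing_E1 M \<theta> U1" and "standing_E2 M U1"
    and "semiflow M \<theta> U2" and "standing_E1 M \<theta> U2" and "standing_E2 M U2"
    and A1: "inj (blinfun_apply i)"
    and A2: "\<And>\<omega> t. \<omega> \<in> space M \<Longrightarrow> 0 \<le> t \<Longrightarrow> U1 \<omega> t o\<^sub>L i = i o\<^sub>L U2 \<omega> t"
    and A3: "\<And>\<omega>. \<omega> \<in> space M \<Longrightarrow> U1 \<omega> 1 = i o\<^sub>L U12 \<omega>"
            "\<And>\<omega>. \<omega> \<in> space M \<Longrightarrow> U2 \<omega> 1 = U12 \<omega> o\<^sub>L i"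
            "C > 0" "\<And>\<omega>. \<omega> \<in> space M \<Longrightarrow> norm (U12 \<omega>) \<le> C"
    and A4: "\<And>u. (\<lambda>\<omega>. blinfun_apply (U12 \<omega>) u) \<in> M \<rightarrow>\<^sub>M borel"
    and A5: "separable_space (euclidean :: 'a topology)" "separable_space (euclidean :: 'b topology)"
    and A6: "\<And>A. A \<in> sets borel \<Longrightarrow> \<exists>B\<in>sets borel. A = blinfun_apply i -` B"
  shows "(admits_oseledets_O1 M \<theta> U1 \<longrightarrow> admits_oseledets_O1 M \<theta> U2) \<and>
         (admits_oseledets_O2 M \<theta> U1 \<longrightarrow> admits_oseledets_O2 M \<theta> U2)"
proof -
  have pair: "smoothing_pair M \<theta> U1 U2 i U12 C"
    by (intro smoothing_pair.intro smoothing_pair_axioms.intro) (fact assms)+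
  have transfer: "smoothing_transfer M \<theta> U1 U2 i U12 C W J lam E G"
    if "oseledets_splitting M \<theta> U1 W J lam E G" for W J lam E G
    by (intro smoothing_transfer.intro smoothing_transfer_axioms.intro pair that)
      (fact assms)+
  have top: "top_exponent M U2 = top_exponent M U1" by (rule smoothing_pair.top_exponent_eq[OF pair])
  show ?thesis
  proof (intro conjI impI)
    assume "admits_oseledets_O1 M \<theta> U1"
    then obtain W k lam E Finf where W: "W \<in> sets M" "flow_invariant M \<theta> W" "measure M W = 1"
      and O1: "oseledets_decomposition_O1 M \<theta> U1 W k lam E Finf"
      unfolding admits_oseledets_O1_def by blast
    interpret T: smoothing_transfer M \<theta> U1 U2 i U12 C W "{1..k}" lam E "tail_sum k E Finf"
      by (rule transfer[OF splitting_of_O1[OF \<open>semiflow M \<theta> U1\<close> W O1]])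
    interpret S: oseledets_splitting M \<theta> U2 W "{1..k}" lam T.E2 T.G2 by (rule T.splitting2)
    have k: "k \<in> {1..k}" using O1 by (simp add: oseledets_decomposition_O1_def)
    let ?F = "\<lambda>\<omega>. blinfun_apply i -` Finf \<omega>"
    have tail: "tail_sum k T.E2 ?F j \<omega> = T.G2 j \<omega>" if w: "\<omega> \<in> W" and j: "j \<le> k" for j \<omega>
      using j
    proof (induction rule: inc_induct)
      case base
      then show ?case by (simp add: tail_sum_self)
    next
      case (step n)
      have "tail_sum k T.E2 ?F n \<omega> = T.E2 (Suc n) \<omega> + tail_sum k T.E2 ?F (Suc n) \<omega>"
        using tail_sum_pred[of "Suc n" k T.E2 ?F \<omega>] step.hyps by simp
      also have "\<dots> = T.E2 (Suc n) \<omega> + T.G2 (Suc n) \<omega>" by (simp only: step.IH)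
      also have "\<dots> = T.G2 n \<omega>"
        using S.split[of "Suc n", OF _ w] step.hyps by (simp add: is_direct_sum_def)
      finally show ?case .
    qed
    have proj: "projection_along (\<Sum>n=1..j. T.E2 n \<omega>) (tail_sum k T.E2 ?F j \<omega>) = T.proj2 j \<omega>"
      if "j \<in> {1..k}" "\<omega> \<in> W" for j \<omega>
      using tail that by simp
    have "oseledets_decomposition_O1 M \<theta> U2 W k lam T.E2 ?F"
      unfolding oseledets_decomposition_O1_def Let_def
    proof (intro conjI ballI allI impI)
      show "1 \<le> k" "ereal (lam 1) = top_exponent M U2"
        using O1 by (simp_all add: oseledets_decomposition_O1_def top)
      show "lam (Suc j) < lam j" if "j \<in> {1..<k}" for j
        using O1 that by (simp add: oseledets_decomposition_O1_def)
      fix \<omega> assume w: "\<omega> \<in> W"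
      show "closed_finite_codim_subspace (?F \<omega>)" using T.closed_finite_codim2[OF k w] unfolding tail_sum_self .
      show "independent_subspaces {1..k} (\<lambda>n. T.E2 n \<omega>)" by (rule S.indep[OF k w])
      show "is_direct_sum (\<Sum>n=1..k. T.E2 n \<omega>) (?F \<omega>) UNIV" using S.direct[OF k w] unfolding tail_sum_self .
      have "(growth_rate (\<lambda>t. onorm_on (tail_sum k E Finf k \<omega>) (U1 \<omega> t)) \<longlongrightarrow> - \<infinity>) at_top"
        if "\<omega> \<in> W" for \<omega>
        using O1 that by (simp add: oseledets_decomposition_O1_def tail_sum_self)
      from T.growth_rate_G2[OF k w this]
      show "(growth_rate (\<lambda>t. onorm_on (?F \<omega>) (U2 \<omega> t)) \<longlongrightarrow> - \<infinity>) at_top" unfolding tail_sum_self .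
    next
      fix j assume j: "j \<in> {1..k}"
      show "\<exists>l. measurable_subspaces M W l (T.E2 j)" by (rule S.E_measurable[OF j])
      have "strongly_measurable M W (\<lambda>\<omega>. projection_along (\<Sum>n=1..j. T.E2 n \<omega>) (tail_sum k T.E2 ?F j \<omega>))
          \<longleftrightarrow> strongly_measurable M W (T.proj2 j)"
        unfolding strongly_measurable_def
        by (intro all_cong1 measurable_cong) (simp only: proj[OF j] space_restrict_space Int_iff)
      then show "strongly_measurable M W (\<lambda>\<omega>. projection_along (\<Sum>n=1..j. T.E2 n \<omega>) (tail_sum k T.E2 ?F j \<omega>))"
        using S.proj_measurable[OF j] by blast
      show "tempered M \<theta> W (\<lambda>\<omega>. projection_along (\<Sum>n=1..j. T.E2 n \<omega>) (tail_sum k T.E2 ?F j \<omega>))"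
        using S.proj_tempered[OF j] unfolding tempered_def
      proof eventually_elim
        case (elim \<omega>)
        show ?case
        proof
          assume w: "\<omega> \<in> W"
          show "((\<lambda>t. 1 / t * ln (onorm (projection_along (\<Sum>n=1..j. T.E2 n (\<theta> t \<omega>))
                (tail_sum k T.E2 ?F j (\<theta> t \<omega>))))) \<longlongrightarrow> 0) at_top \<and>
              ((\<lambda>t. 1 / t * ln (onorm (projection_along (\<Sum>n=1..j. T.E2 n (\<theta> t \<omega>))
                (tail_sum k T.E2 ?F j (\<theta> t \<omega>))))) \<longlongrightarrow> 0) at_bot"
            using mp[OF elim w] by (simp only: proj[OF j S.flow_W[OF w]])
        qed
      qed
      fix \<omega> assume w: "\<omega> \<in> W"
      show "U2 \<omega> t ` T.E2 j \<omega> = T.E2 j (\<theta> t \<omega>)" if "0 \<le> t" for t by (rule S.U_E[OF j w that])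
      show "U2 \<omega> t ` ?F \<omega> \<subseteq> ?F (\<theta> t \<omega>)" if "0 \<le> t" for t using S.U_G[OF k w that] unfolding tail_sum_self .
      fix u :: 'b assume u: "u \<noteq> 0"
      show "(growth_rate (\<lambda>t. norm (U2 \<omega> t u)) \<longlongrightarrow> ereal (lam j)) at_top" if "u \<in> T.E2 j \<omega>"
        by (rule S.growth[OF j w that u])
    next
      fix j \<omega> u assume j: "j \<in> {1..k}" and w: "\<omega> \<in> W" and u: "u \<noteq> 0"
        and "u \<in> tail_sum k T.E2 ?F (j - 1) \<omega>"
      then have "u \<in> T.G2 (j - 1) \<omega>" using tail[OF w, of "j - 1"] by auto
      then show "u \<in> T.E2 j \<omega> \<longleftrightarrow> (\<exists>v. negative_semiorbit \<theta> U2 \<omega> u v \<and>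
          (growth_rate (\<lambda>s. norm (v s)) \<longlongrightarrow> ereal (lam j)) at_bot)"
        by (rule S.semiorbit[OF j w _ u])
    qed
    then show "admits_oseledets_O1 M \<theta> U2" unfolding admits_oseledets_O1_def using W by blast
  next
    assume "admits_oseledets_O2 M \<theta> U1"
    then obtain W lam E F where W: "W \<in> sets M" "flow_invariant M \<theta> W" "measure M W = 1"
      and O2: "oseledets_decomposition_O2 M \<theta> U1 W lam E F"
      unfolding admits_oseledets_O2_def by blast
    interpret T: smoothing_transfer M \<theta> U1 U2 i U12 C W "{1..}" lam E F
      by (rule transfer[OF splitting_of_O2[OF \<open>semiflow M \<theta> U1\<close> W O2]])
    interpret S: oseledets_splitting M \<theta> U2 W "{1..}" lam T.E2 T.G2 by (rule T.splitting2)
    have "oseledets_decomposition_O2 M \<theta> U2 W lam T.E2 T.G2"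
      unfolding oseledets_decomposition_O2_def Let_def
    proof (intro conjI ballI allI impI)
      show "ereal (lam 1) = top_exponent M U2" "filterlim lam at_bot sequentially"
        using O2 by (simp_all add: oseledets_decomposition_O2_def top)
      show "lam (Suc j) < lam j" if "1 \<le> j" for j
        using O2 that by (simp add: oseledets_decomposition_O2_def)
      show "T.G2 0 \<omega> = UNIV" if "\<omega> \<in> W" for \<omega> by (rule S.G_0[OF that])
    next
      fix j :: nat assume "1 \<le> j"
      then have j: "j \<in> {1..}" and Sj: "Suc j \<in> {1..}" by simp_all
      show "\<exists>l. measurable_subspaces M W l (T.E2 j)" by (rule S.E_measurable[OF j])
      show "strongly_measurable M W (T.proj2 j)" "tempered M \<theta> W (T.proj2 j)"
        by (rule S.proj_measurable[OF j], rule S.proj_tempered[OF j])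
      fix \<omega> assume w: "\<omega> \<in> W"
      show "closed_finite_codim_subspace (T.G2 j \<omega>)" by (rule T.closed_finite_codim2[OF j w])
      show "U2 \<omega> t ` T.E2 j \<omega> = T.E2 j (\<theta> t \<omega>)" "U2 \<omega> t ` T.G2 j \<omega> \<subseteq> T.G2 j (\<theta> t \<omega>)"
        if "0 \<le> t" for t
        using S.U_E[OF j w that] S.U_G[OF j w that] by blast+
      show "independent_subspaces {1..j} (\<lambda>n. T.E2 n \<omega>)" by (rule S.indep[OF j w])
      show "is_direct_sum (\<Sum>n=1..j. T.E2 n \<omega>) (T.G2 j \<omega>) UNIV" by (rule S.direct[OF j w])
      show "is_direct_sum (T.E2 (Suc j) \<omega>) (T.G2 (Suc j) \<omega>) (T.G2 j \<omega>)"
        using S.split[OF Sj w] by simp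
      have "(growth_rate (\<lambda>t. onorm_on (F j \<omega>) (U1 \<omega> t)) \<longlongrightarrow> ereal (lam (Suc j))) at_top"
        if "\<omega> \<in> W" for \<omega>
        using O2 that \<open>1 \<le> j\<close> by (simp add: oseledets_decomposition_O2_def)
      from T.growth_rate_G2[OF j w this]
      show "(growth_rate (\<lambda>t. onorm_on (T.G2 j \<omega>) (U2 \<omega> t)) \<longlongrightarrow> ereal (lam (Suc j))) at_top" .
      fix u :: 'b assume u: "u \<noteq> 0"
      show "(growth_rate (\<lambda>t. norm (U2 \<omega> t u)) \<longlongrightarrow> ereal (lam j)) at_top" if "u \<in> T.E2 j \<omega>"
        by (rule S.growth[OF j w that u])
    next
      fix j :: nat and \<omega> u assume j: "1 \<le> j" and w: "\<omega> \<in> W" and u: "u \<noteq> 0" "u \<in> T.G2 (j - 1) \<omega>"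
      show "u \<in> T.E2 j \<omega> \<longleftrightarrow> (\<exists>v. negative_semiorbit \<theta> U2 \<omega> u v \<and>
          (growth_rate (\<lambda>s. norm (v s)) \<longlongrightarrow> ereal (lam j)) at_bot)"
        using j by (intro S.semiorbit[OF _ w u(2,1)]) simp
    qed
    then show "admits_oseledets_O2 M \<theta> U2" unfolding admits_oseledets_O2_def using W by blast
  qed
qed

end
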